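(* Let $\Omega\subset\mathbb{R}^n$, $n\ge 2$, be open and bounded, and let $s,t,p,q,\Lambda,K_{sp},K_{tq},a$ satisfy the structural assumptions (A1)–(A5) listed in the context. Assume moreover that $$tq\le sp+\alpha\ \text{ if } s\le t,\qquad tq\le sp\ \text{ if } s>t.$$ Let $0<R\le 1$, let $B_R(x_0)\Subset\Omega$, and let $u\in\mathcal{A}(\Omega)\cap L^{p-1}_{sp}(\mathbb{R}^n)\cap L^{q-1}_{a,tq}(\Omega,\mathbb{R}^n)$ be a (local) minimizer in $\Omega$ of $$\mathcal{F}(u;\Omega)=\iint_{\mathcal{C}_\Omega}\left(|u(x)-u(y)|^pK_{sp}(x,y)+a(x,y)|u(x)-u(y)|^qK_{tq}(x,y)\right)dx\,dy .$$ Then for every $\ell>0$ there exists a constant $C_\ell\ge 1$, depending only on $\ell$ and $\mathfrak{D}_u(B_R(x_0))$, such that $$\sup_{B_{R/2}(x_0)}u\le C_\ell\left(\frac{1}{|B_R(x_0)|}\int_{B_R(x_0)}u_+^\ell\,dx\right)^{1/\ell}+C_\ell\,(h_R)^{-1}\bigl(\mathcal{T}_{R/2,R}(u_+;x_0)\bigr).$$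
   Context: Structural assumptions. (A1) $0<s,t<1$ and $1<p\le q<\infty$. (A2) $K_{sp},K_{tq}:\mathbb{R}^n\times\mathbb{R}^n\to\mathbb{R}$ are symmetric measurable kernels with, for some $\Lambda\ge1$, $\Lambda^{-1}|x-y|^{-n-sp}\le K_{sp}(x,y)\le\Lambda|x-y|^{-n-sp}$ and $\Lambda^{-1}|x-y|^{-n-tq}\le K_{tq}(x,y)\le\Lambda|x-y|^{-n-tq}$. (A3) $a:\mathbb{R}^n\times\mathbb{R}^n\to[0,\infty)$ is measurable, $a\in L^\infty_{\rm loc}(\Omega\times\Omega)$, and $a(x,y)=a(y,x)$ for a.e. $(x,y)$. (A4) If $s\le t$: there are $\alpha\in(0,1]$ and $[a]_\alpha<\infty$ with $|a(x_1,y_1)-a(x_2,y_2)|\le[a]_\alpha(|x_1-x_2|+|y_1-y_2|)^\alpha$ on $\mathbb{R}^n\times\mathbb{R}^n$. If $s>t$: $|a(x,y)|\le\|a\|_{L^\infty}<\infty$ on $\mathbb{R}^n\times\mathbb{R}^n$. (A5) $q\le\frac{np}{n-sp}$ if $sp<n$; $p\le q<\infty$ if $sp\ge n$. Domain of integration: $\mathcal{C}_\Omega=(\mathbb{R}^n\times\mathbb{R}^n)\setminus\bigl((\mathbb{R}^n\setminus\Omega)\times(\mathbb{R}^n\setminus\Omega)\bigr)$. Function spaces. $\mathcal{A}(\Omega)$ is the set of $u:\mathbb{R}^n\to\mathbb{R}$ with $u|_\Omega\in L^p(\Omega)$ and $\iint_{\mathcal{C}_\Omega}\left(\frac{|u(x)-u(y)|^p}{|x-y|^{n+sp}}+a(x,y)\frac{|u(x)-u(y)|^q}{|x-y|^{n+tq}}\right)dx\,dy<\infty$.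 $L^{p-1}_{sp}(\mathbb{R}^n)$ is the set of $u:\mathbb{R}^n\to\mathbb{R}$ with $\int_{\mathbb{R}^n}\frac{|u(x)|^{p-1}}{(1+|x|)^{n+sp}}dx<\infty$. $L^{q-1}_{a,tq}(\Omega,\mathbb{R}^n)$ is the set of $u:\mathbb{R}^n\to\mathbb{R}$ with $\sup_{x\in\Omega}\int_{\mathbb{R}^n}a(x,y)\frac{|u(y)|^{q-1}}{(1+|y|)^{n+tq}}dy<\infty$. Minimizer: $u\in\mathcal{A}(\Omega)$ is a (local) minimizer of $\mathcal{F}$ in $\Omega$ if $\mathcal{F}(u;\Omega)\le\mathcal{F}(v;\Omega)$ for every $v\in\mathcal{A}(\Omega)$ with $v=u$ a.e. in $\mathbb{R}^n\setminus\Omega$. Notation. $u_+=\max\{u,0\}$, $u_-=\max\{-u,0\}$; $\sup$ and $\inf$ of $u$ on a set are essential. For a fixed center $x_0$ and $r>0$, $a_r^-:=\inf_{B_r(x_0)\times B_r(x_0)}a(x,y)$ and, for $\tau\ge0$, $h_r(\tau):=\frac{\tau^{p-1}}{r^{sp}}+a_r^-\frac{\tau^{q-1}}{r^{tq}}$; $(h_r)^{-1}$ is its inverse on $[0,\infty)$. The two-radius tail is $$\mathcal{T}_{r,R}(v;x_0):=\int_{\mathbb{R}^n\setminus B_r(x_0)}\frac{|v(y)|^{p-1}}{|y-x_0|^{n+sp}}dy+\sup_{x\in B_R(x_0)}\int_{\mathbb{R}^n\setminus B_r(x_0)}a(x,y)\frac{|v(y)|^{q-1}}{|y-x_0|^{n+tq}}dy.$$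 Data. For $E\subset\Omega$, $\mathfrak{D}_u(E)$ is the list consisting of: $n,p,q,s,t,\Lambda$; together with $\alpha,[a]_\alpha$ if $s\le t$, or $\|a\|_{L^\infty}$ if $s>t$; together with $\|u\|_{L^\infty(E)}$ if $sp\le n$, or $[u]_{W^{s,p}(E)}:=\left(\int_E\int_E\frac{|u(x)-u(y)|^p}{|x-y|^{n+sp}}dx\,dy\right)^{1/p}$ if $sp>n$. Under the assumptions $u$ is known to be locally bounded in $\Omega$. *)

theory Defs
  imports "HOL-Analysis.Analysis" "HOL-Probability.Essential_Supremum"
begin

text \<open>
  Conventions: the ambient space is an arbitrary Euclidean space of dimension \<open>n = DIM('a)\<close>;
  functions of two points are functions on \<open>'a \<times> 'a\<close>; measurability is Lebesgue measurability;
  all integrals have nonnegative integrands and take values in \<open>[0,\<infinity>]\<close>.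
  On the diagonal \<open>x = y\<close> the singular quotients below are \<open>0 / 0 = 0\<close>; the diagonal is a null set.
\<close>

text \<open>Power of an extended nonnegative number, meant for exponents \<open>r > 0\<close>, so that \<open>\<infinity>\<close> to the \<open>r\<close>
  is \<open>\<infinity>\<close>.\<close>
definition enn_powr :: "ennreal \<Rightarrow> real \<Rightarrow> ennreal" where
  "enn_powr z r = (if z = \<infinity> then \<infinity> else ennreal (enn2real z powr r))"

definition Linf_norm :: "'b::euclidean_space set \<Rightarrow> ('b \<Rightarrow> real) \<Rightarrow> ennreal" where
  "Linf_norm E f = esssup (lebesgue_on E) (\<lambda>x. ennreal \<bar>f x\<bar>)"

definition ess_sup_on :: "'b::euclidean_space set \<Rightarrow> ('b \<Rightarrow> real) \<Rightarrow> ereal" where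
  "ess_sup_on E f = esssup (lebesgue_on E) (\<lambda>x. ereal (f x))"

text \<open>\<open>\<sigma>\<close> and \<open>m\<close> stand for \<open>s, p\<close> or \<open>t, q\<close>.  The two-sided bound is asked off the diagonal, where \<open>\<bar>x - y\<bar>\<close> to a negative power is finite.\<close>
definition kernel_cond :: "real \<Rightarrow> real \<Rightarrow> real \<Rightarrow> ('a::euclidean_space \<times> 'a \<Rightarrow> real) \<Rightarrow> bool" where
  "kernel_cond \<sigma> m \<Lambda> K \<longleftrightarrow>
     K \<in> borel_measurable lebesgue \<and>
     (\<forall>x y. K (x, y) = K (y, x)) \<and>
     (\<forall>x y. x \<noteq> y \<longrightarrow>
        inverse \<Lambda> * dist x y powr (- (real DIM('a) + \<sigma> * m)) \<le> K (x, y) \<and>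
        K (x, y) \<le> \<Lambda> * dist x y powr (- (real DIM('a) + \<sigma> * m)))"

definition coefficient_cond :: "'a::euclidean_space set \<Rightarrow> ('a \<times> 'a \<Rightarrow> real) \<Rightarrow> bool" where
  "coefficient_cond \<Omega> a \<longleftrightarrow>
     (\<forall>z. 0 \<le> a z) \<and>
     a \<in> borel_measurable lebesgue \<and>
     (\<forall>K. compact K \<and> K \<subseteq> \<Omega> \<times> \<Omega> \<longrightarrow> Linf_norm K a < \<infinity>) \<and>
     (AE z in lebesgue. a (fst z, snd z) = a (snd z, fst z))"

text \<open>The constant \<open>A\<close> is the Hoelder constant of \<open>a\<close>
  if \<open>s \<le> t\<close>, and the norm of \<open>a\<close> in \<open>L\<^sup>\<infinity>\<close> if \<open>s > t\<close>; in the latter case \<open>\<alpha>\<close> plays no role.\<close>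
definition regularity_cond ::
    "real \<Rightarrow> real \<Rightarrow> real \<Rightarrow> real \<Rightarrow> ('a::euclidean_space \<times> 'a \<Rightarrow> real) \<Rightarrow> bool" where
  "regularity_cond s t \<alpha> A a \<longleftrightarrow>
     (if s \<le> t
      then 0 < \<alpha> \<and> \<alpha> \<le> 1 \<and>
           (\<forall>x1 y1 x2 y2. \<bar>a (x1, y1) - a (x2, y2)\<bar> \<le> A * (dist x1 x2 + dist y1 y2) powr \<alpha>)
      else Linf_norm UNIV a = ennreal A \<and> (\<forall>x y. \<bar>a (x, y)\<bar> \<le> A))"

definition C_dom :: "'a::euclidean_space set \<Rightarrow> ('a \<times> 'a) set" where
  "C_dom \<Omega> = UNIV - (UNIV - \<Omega>) \<times> (UNIV - \<Omega>)"

definition A_space ::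
    "real \<Rightarrow> real \<Rightarrow> real \<Rightarrow> real \<Rightarrow> ('a::euclidean_space \<times> 'a \<Rightarrow> real) \<Rightarrow> 'a set \<Rightarrow> ('a \<Rightarrow> real) set" where
  "A_space s t p q a \<Omega> = {u \<in> borel_measurable lebesgue.
     (\<integral>\<^sup>+x\<in>\<Omega>. ennreal (\<bar>u x\<bar> powr p) \<partial>lebesgue) < \<infinity> \<and>
     (\<integral>\<^sup>+(x, y)\<in>C_dom \<Omega>. ennreal
         (\<bar>u x - u y\<bar> powr p / dist x y powr (real DIM('a) + s * p)
          + a (x, y) * (\<bar>u x - u y\<bar> powr q / dist x y powr (real DIM('a) + t * q)))
       \<partial>lebesgue) < \<infinity>}"

definition tail_space_p :: "real \<Rightarrow> real \<Rightarrow> ('a::euclidean_space \<Rightarrow> real) set" where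
  "tail_space_p s p = {u \<in> borel_measurable lebesgue.
     (\<integral>\<^sup>+x. ennreal (\<bar>u x\<bar> powr (p - 1) / (1 + norm x) powr (real DIM('a) + s * p)) \<partial>lebesgue) < \<infinity>}"

definition tail_space_q ::
    "real \<Rightarrow> real \<Rightarrow> ('a::euclidean_space \<times> 'a \<Rightarrow> real) \<Rightarrow> 'a set \<Rightarrow> ('a \<Rightarrow> real) set" where
  "tail_space_q t q a \<Omega> = {u \<in> borel_measurable lebesgue.
     (SUP x\<in>\<Omega>. \<integral>\<^sup>+y. ennreal
         (a (x, y) * (\<bar>u y\<bar> powr (q - 1) / (1 + norm y) powr (real DIM('a) + t * q))) \<partial>lebesgue) < \<infinity>}"

definition energy ::
    "real \<Rightarrow> real \<Rightarrow> ('a::euclidean_space \<times> 'a \<Rightarrow> real) \<Rightarrow> ('a \<times> 'a \<Rightarrow> real) \<Rightarrow> ('a \<times> 'a \<Rightarrow> real)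
      \<Rightarrow> ('a \<Rightarrow> real) \<Rightarrow> 'a set \<Rightarrow> ennreal" where
  "energy p q Ksp Ktq a u \<Omega> =
     (\<integral>\<^sup>+(x, y)\<in>C_dom \<Omega>. ennreal
        (\<bar>u x - u y\<bar> powr p * Ksp (x, y) + a (x, y) * \<bar>u x - u y\<bar> powr q * Ktq (x, y)) \<partial>lebesgue)"

definition is_minimizer ::
    "real \<Rightarrow> real \<Rightarrow> real \<Rightarrow> real \<Rightarrow> ('a::euclidean_space \<times> 'a \<Rightarrow> real) \<Rightarrow> ('a \<times> 'a \<Rightarrow> real)
      \<Rightarrow> ('a \<times> 'a \<Rightarrow> real) \<Rightarrow> 'a set \<Rightarrow> ('a \<Rightarrow> real) \<Rightarrow> bool" where
  "is_minimizer s t p q Ksp Ktq a \<Omega> u \<longleftrightarrow>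
     u \<in> A_space s t p q a \<Omega> \<and>
     (\<forall>v \<in> A_space s t p q a \<Omega>.
        (AE x in lebesgue. x \<notin> \<Omega> \<longrightarrow> v x = u x) \<longrightarrow>
        energy p q Ksp Ktq a u \<Omega> \<le> energy p q Ksp Ktq a v \<Omega>)"

definition a_minus :: "('a::euclidean_space \<times> 'a \<Rightarrow> real) \<Rightarrow> 'a \<Rightarrow> real \<Rightarrow> real" where
  "a_minus a x0 r = (INF z\<in>ball x0 r \<times> ball x0 r. a z)"

definition h_fun ::
    "real \<Rightarrow> real \<Rightarrow> real \<Rightarrow> real \<Rightarrow> ('a::euclidean_space \<times> 'a \<Rightarrow> real) \<Rightarrow> 'a \<Rightarrow> real \<Rightarrow> real \<Rightarrow> real" where
  "h_fun s t p q a x0 r \<tau> =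
     \<tau> powr (p - 1) / r powr (s * p) + a_minus a x0 r * (\<tau> powr (q - 1) / r powr (t * q))"

text \<open>The inverse of \<open>h_fun\<close> on \<open>[0,\<infinity>)\<close>, where \<open>h_fun\<close> is a bijection, extended by \<open>\<infinity> \<mapsto> \<infinity>\<close>.\<close>
definition h_inv ::
    "real \<Rightarrow> real \<Rightarrow> real \<Rightarrow> real \<Rightarrow> ('a::euclidean_space \<times> 'a \<Rightarrow> real) \<Rightarrow> 'a \<Rightarrow> real \<Rightarrow> ennreal \<Rightarrow> ennreal" where
  "h_inv s t p q a x0 r T =
     (if T = \<infinity> then \<infinity> else ennreal (inv_into {0..} (h_fun s t p q a x0 r) (enn2real T)))"

definition two_radius_tail ::
    "real \<Rightarrow> real \<Rightarrow> real \<Rightarrow> real \<Rightarrow> ('a::euclidean_space \<times> 'a \<Rightarrow> real) \<Rightarrow> real \<Rightarrow> real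
      \<Rightarrow> ('a \<Rightarrow> real) \<Rightarrow> 'a \<Rightarrow> ennreal" where
  "two_radius_tail s t p q a r R v x0 =
     (\<integral>\<^sup>+y\<in>UNIV - ball x0 r. ennreal
        (\<bar>v y\<bar> powr (p - 1) / dist y x0 powr (real DIM('a) + s * p)) \<partial>lebesgue)
     + (SUP x\<in>ball x0 R. \<integral>\<^sup>+y\<in>UNIV - ball x0 r. ennreal
        (a (x, y) * (\<bar>v y\<bar> powr (q - 1) / dist y x0 powr (real DIM('a) + t * q))) \<partial>lebesgue)"

definition Wsp_seminorm :: "real \<Rightarrow> real \<Rightarrow> 'a::euclidean_space set \<Rightarrow> ('a \<Rightarrow> real) \<Rightarrow> ennreal" where
  "Wsp_seminorm s p E u = enn_powr
     (\<integral>\<^sup>+(x, y)\<in>E \<times> E. ennreal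
        (\<bar>u x - u y\<bar> powr p / dist x y powr (real DIM('a) + s * p)) \<partial>lebesgue) (1 / p)"

text \<open>The only entry of the data list that involves \<open>u\<close>.\<close>
definition u_data :: "real \<Rightarrow> real \<Rightarrow> 'a::euclidean_space set \<Rightarrow> ('a \<Rightarrow> real) \<Rightarrow> ennreal" where
  "u_data s p E u = (if s * p \<le> real DIM('a) then Linf_norm E u else Wsp_seminorm s p E u)"

definition power_mean :: "real \<Rightarrow> 'a::euclidean_space set \<Rightarrow> ('a \<Rightarrow> real) \<Rightarrow> ennreal" where
  "power_mean l E f =
     enn_powr ((\<integral>\<^sup>+x\<in>E. ennreal (f x powr l) \<partial>lebesgue) / emeasure lebesgue E) (1 / l)"

end

theory Submission
  imports Defs
begin

text \<open>
  Let \<open>w = (u - k)\<^sub>+\<close> and let \<open>\<phi>\<close> be a Lipschitz cutoff.  Comparing the minimizer \<open>u\<close> with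
  \<open>v = u - \<phi>\<^sup>q w\<close> gives the Caccioppoli inequality directly, without an Euler-Lagrange equation and
  without hole filling: by convexity, and because the cutoff is raised to the power \<open>q \<ge> p\<close>, the
  energy density of \<open>v\<close> lies pointwise below that of \<open>u\<close> minus a multiple of the density of \<open>w\<close>,
  up to error terms without cancellation.

  The Sobolev gain comes from an elementary observation: if \<open>f < f(x)/2\<close> outside a set of measure
  \<open>V\<close>, then half of the ball of volume \<open>2V\<close> about \<open>x\<close> contributes to the Gagliardo integral at \<open>x\<close>,
  so \<open>f(x)\<^sup>p\<close> is at most a constant times \<open>V\<close> to the power \<open>sp/n\<close> times that integral.
  With \<open>V\<close> the measure of the support this is a Faber-Krahn inequality, which drives the De Giorgi iteration for \<open>H(w) = w h\<^sub>R(w)\<close>; the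
  two phases balance because the oscillation of \<open>a\<close> on \<open>B\<^sub>R\<close> is controlled by
  \<open>R\<close> to the power \<open>tq - sp\<close>.  With \<open>V\<close> from Chebyshev's inequality it is the critical Sobolev inequality,
  which makes \<open>u\<close> locally bounded, so that the norm of \<open>u\<close> in the data list is finite.

  The exponent \<open>l\<close> is reached by starting at the level \<open>k\<^sub>0\<close> below which \<open>u\<close> stays on half of the ball
  and interpolating between radii \<open>1 - \<mu>\<^sup>i/2\<close>.  When \<open>sp > n\<close>, that choice of \<open>k\<^sub>0\<close> also lets the
  seminorm of \<open>u\<close> bound \<open>u - k\<^sub>0\<close>.
\<close>

section \<open>Lebesgue measure on a product\<close>

text \<open>Two circularities shape the argument. The oscillation of \<open>a\<close> is absorbed by
  bounding \<open>w powr q\<close> by \<open>M1 powr (q - p) * w powr p\<close>, so a bound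
  \<open>M1\<close> for \<open>u - k0\<close> is needed before any estimate exists. It stays in the
  constants through \<open>K1 * M1 powr (q - p)\<close>, but as a size it disappears, because the
  final interpolation halves it arbitrarily often. Its finiteness comes from elsewhere: from a
  preliminary iteration with uncontrolled constants if \<open>s * p\<close> is at most the
  dimension, and from membership in \<open>A_space\<close> otherwise. The second constraint is the
  order of quantifiers: the constant is fixed before \<Omega>, the kernels, \<open>a\<close>,
  \<open>u\<close>, \<open>x0\<close> and \<open>R\<close>. Hence constants are closed terms in the
  numerical data or numbers singled out by a predicate, and powers of \<open>R\<close> have to
  cancel exactly, with measures and energies normalised by the size of the ball. Finally, integrals
  over pairs refer to the completed product measure, so sections of \<open>a\<close> are known to be
  measurable only almost everywhere, while tails are taken at every point.\<close>

lemma AE_lebesgue_iff: "(AE x in lebesgue. P x) \<longleftrightarrow> (AE x in lborel. P x)"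
  by (rule AE_completion_iff)

lemma AE_lebesgue_pair:
  fixes Q :: "'a::euclidean_space \<times> 'b::euclidean_space \<Rightarrow> bool"
  assumes "AE z in lebesgue. Q z"
  shows "AE x in lebesgue. AE y in lebesgue. Q (x, y)"
proof -
  have "AE z in (lborel :: 'a measure) \<Otimes>\<^sub>M (lborel :: 'b measure). Q z"
    using assms unfolding lborel_prod AE_lebesgue_iff .
  from lborel_pair.AE_pair[OF this] show ?thesis by (simp add: AE_lebesgue_iff)
qed

lemma null_sets_lebesgue_Times_UNIV:
  fixes N :: "'a::euclidean_space set"
  assumes "N \<in> null_sets lborel"
  shows "N \<times> (UNIV :: 'b::euclidean_space set) \<in> null_sets lborel"
    and "(UNIV :: 'b set) \<times> N \<in> null_sets lborel"
proof -
  have m: "N \<in> sets lborel" "emeasure lborel N = 0" using assms by auto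
  have "emeasure (lborel \<Otimes>\<^sub>M lborel) (N \<times> (UNIV :: 'b set)) = 0"
    using m by (subst lborel.emeasure_pair_measure_Times) auto
  moreover have "N \<times> (UNIV :: 'b set) \<in> sets (lborel \<Otimes>\<^sub>M lborel)"
    using m by (intro pair_measureI) auto
  ultimately show "N \<times> (UNIV :: 'b set) \<in> null_sets lborel"
    unfolding lborel_prod by blast
  have "emeasure (lborel \<Otimes>\<^sub>M lborel) ((UNIV :: 'b set) \<times> N) = 0"
    using m by (subst lborel.emeasure_pair_measure_Times) auto
  moreover have "(UNIV :: 'b set) \<times> N \<in> sets (lborel \<Otimes>\<^sub>M lborel)"
    using m by (intro pair_measureI) auto
  ultimately show "(UNIV :: 'b set) \<times> N \<in> null_sets lborel"
    unfolding lborel_prod by blast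
qed

text \<open>Continuity settles preimages of Borel sets. A Lebesgue set differs from a Borel set by a
  null set, so preimages of null sets must be null too; for the projections these are the strips
  treated just before.\<close>

lemma measurable_lborel_compose_lebesgue:
  fixes f :: "'a::euclidean_space \<Rightarrow> 'b::euclidean_space"
  assumes f: "continuous_on UNIV f"
    and N: "\<And>N. N \<in> null_sets lborel \<Longrightarrow> f -` N \<in> null_sets lborel"
  shows "f \<in> measurable lebesgue lebesgue"
proof -
  have m: "f \<in> measurable lebesgue lborel"
    using f by (intro measurable_completion) (simp add: borel_measurable_continuous_onI)
  show ?thesis
  proof (rule completion.measurable_completion2[OF m], rule subsetI)
    fix A assume A: "A \<in> null_sets (lborel :: 'b measure)"
    have "f -` A \<in> null_sets lborel" using N[OF A] .
    then have "emeasure lebesgue (f -` A) = 0"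
      by (metis null_sets_completionI null_setsD1)
    moreover have "emeasure (distr lebesgue lborel f) A = emeasure lebesgue (f -` A)"
      using emeasure_distr[OF m, of A] A by auto
    ultimately show "A \<in> null_sets (distr lebesgue lborel f)"
      using A by (simp add: null_sets_def)
  qed
qed

lemma measurable_fst_lebesgue [measurable]:
  "fst \<in> measurable (lebesgue :: ('a::euclidean_space \<times> 'b::euclidean_space) measure) lebesgue"
  by (rule measurable_lborel_compose_lebesgue)
    (use null_sets_lebesgue_Times_UNIV(1) in
      \<open>auto simp: fst_vimage_eq_Times continuous_on_fst continuous_on_id\<close>)

lemma measurable_snd_lebesgue [measurable]:
  "snd \<in> measurable (lebesgue :: ('a::euclidean_space \<times> 'b::euclidean_space) measure) lebesgue"
  by (rule measurable_lborel_compose_lebesgue)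
    (use null_sets_lebesgue_Times_UNIV(2) in
      \<open>auto simp: snd_vimage_eq_Times continuous_on_snd continuous_on_id\<close>)

lemma lebesgue_AE_eq_borel:
  fixes f :: "'a::euclidean_space \<Rightarrow> ennreal"
  assumes "f \<in> borel_measurable lebesgue"
  obtains g where "g \<in> borel_measurable lborel" "AE x in lebesgue. f x = g x"
  using completion_ex_borel_measurable[OF assms] AE_lebesgue_iff by blast

lemma measurable_lborel_lebesgue:
  "f \<in> measurable lborel N \<Longrightarrow> f \<in> measurable lebesgue N"
  by (rule measurable_completion)

lemma measurable_lebesgue_cong_AE:
  fixes f g :: "'a::euclidean_space \<Rightarrow> 'b::topological_space"
  assumes g: "g \<in> borel_measurable lebesgue" and ae: "AE x in lebesgue. f x = g x"
  shows "f \<in> borel_measurable lebesgue"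
proof (rule measurableI)
  fix A :: "'b set" assume A: "A \<in> sets borel"
  have m: "g -` A \<inter> space lebesgue \<in> sets lebesgue" using g A by (rule measurable_sets)
  have "AE x in lebesgue. x \<in> g -` A \<inter> space lebesgue \<longleftrightarrow> x \<in> f -` A \<inter> space lebesgue"
    using ae by eventually_elim auto
  from completion.in_sets_AE[OF this m] show "f -` A \<inter> space lebesgue \<in> sets lebesgue"
    by blast
qed auto

text \<open>The integrand is replaced by a Borel function equal to it almost everywhere. A null set
  of pairs has null sections for almost every point, in either order, so neither iterated integral
  changes. For the same reason measurability of sections holds only almost everywhere.\<close>

lemma lebesgue_Tonelli:
  fixes f :: "'a::euclidean_space \<times> 'b::euclidean_space \<Rightarrow> ennreal"
  assumes "f \<in> borel_measurable lebesgue"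
  shows "(\<integral>\<^sup>+z. f z \<partial>lebesgue) = (\<integral>\<^sup>+x. \<integral>\<^sup>+y. f (x, y) \<partial>lebesgue \<partial>lebesgue)"
    and "(\<integral>\<^sup>+z. f z \<partial>lebesgue) = (\<integral>\<^sup>+y. \<integral>\<^sup>+x. f (x, y) \<partial>lebesgue \<partial>lebesgue)"
    and "AE x in lebesgue. (\<lambda>y. f (x, y)) \<in> borel_measurable lebesgue"
    and "(\<lambda>x. \<integral>\<^sup>+y. f (x, y) \<partial>lebesgue) \<in> borel_measurable lebesgue"
proof -
  obtain g where g: "g \<in> borel_measurable lborel" and fg: "AE x in lebesgue. f x = g x"
    using lebesgue_AE_eq_borel[OF assms] .
  have g': "g \<in> borel_measurable (lborel \<Otimes>\<^sub>M lborel)"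
    unfolding lborel_prod by (rule g)
  have eq: "(\<integral>\<^sup>+z. f z \<partial>lebesgue) = (\<integral>\<^sup>+z. g z \<partial>(lborel \<Otimes>\<^sub>M lborel))"
    using nn_integral_cong_AE[OF fg] by (simp add: nn_integral_completion lborel_prod)
  have ae: "AE x in lebesgue. AE y in lebesgue. f (x, y) = g (x, y)"
    using AE_lebesgue_pair[OF fg] .
  have "(\<integral>\<^sup>+x. \<integral>\<^sup>+y. f (x, y) \<partial>lebesgue \<partial>lebesgue) = (\<integral>\<^sup>+x. \<integral>\<^sup>+y. g (x, y) \<partial>lebesgue \<partial>lebesgue)"
    by (rule nn_integral_cong_AE) (use ae in \<open>auto intro: nn_integral_cong_AE\<close>)
  also have "\<dots> = (\<integral>\<^sup>+z. g z \<partial>(lborel \<Otimes>\<^sub>M lborel))"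
    using lborel.nn_integral_fst[OF g'] by (simp add: nn_integral_completion)
  finally show "(\<integral>\<^sup>+z. f z \<partial>lebesgue) = (\<integral>\<^sup>+x. \<integral>\<^sup>+y. f (x, y) \<partial>lebesgue \<partial>lebesgue)"
    using eq by simp
  show "(\<lambda>x. \<integral>\<^sup>+y. f (x, y) \<partial>lebesgue) \<in> borel_measurable lebesgue"
  proof (rule measurable_lebesgue_cong_AE)
    show "(\<lambda>x. \<integral>\<^sup>+y. g (x, y) \<partial>lborel) \<in> borel_measurable lebesgue"
      using lborel.borel_measurable_nn_integral_fst[OF g'] by (rule measurable_lborel_lebesgue)
    show "AE x in lebesgue. (\<integral>\<^sup>+y. f (x, y) \<partial>lebesgue) = (\<integral>\<^sup>+y. g (x, y) \<partial>lborel)"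
      using ae
    proof eventually_elim
      case (elim x)
      then show ?case using nn_integral_cong_AE[OF elim] by (simp add: nn_integral_completion)
    qed
  qed
  have fg': "AE z in (lborel :: 'a measure) \<Otimes>\<^sub>M (lborel :: 'b measure). f z = g z"
    using fg unfolding lborel_prod AE_lebesgue_iff .
  have "AE z in (lborel :: 'b measure) \<Otimes>\<^sub>M (lborel :: 'a measure). f (snd z, fst z) = g (snd z, fst z)"
    using fg' by (subst (asm) lborel_pair.distr_pair_swap)
      (auto dest!: AE_distrD[rotated] simp: case_prod_beta)
  from lborel_pair.AE_pair[OF this]
  have ae': "AE y in lebesgue. AE x in lebesgue. f (x, y) = g (x, y)"
    by (simp add: AE_lebesgue_iff)
  have "(\<integral>\<^sup>+y. \<integral>\<^sup>+x. f (x, y) \<partial>lebesgue \<partial>lebesgue) = (\<integral>\<^sup>+y. \<integral>\<^sup>+x. g (x, y) \<partial>lebesgue \<partial>lebesgue)"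
    by (rule nn_integral_cong_AE) (use ae' in \<open>auto intro: nn_integral_cong_AE\<close>)
  also have "\<dots> = (\<integral>\<^sup>+z. g z \<partial>(lborel \<Otimes>\<^sub>M lborel))"
    using lborel_pair.nn_integral_snd[OF g'] by (simp add: nn_integral_completion)
  finally show "(\<integral>\<^sup>+z. f z \<partial>lebesgue) = (\<integral>\<^sup>+y. \<integral>\<^sup>+x. f (x, y) \<partial>lebesgue \<partial>lebesgue)"
    using eq by simp
  show "AE x in lebesgue. (\<lambda>y. f (x, y)) \<in> borel_measurable lebesgue"
    using ae
  proof eventually_elim
    case (elim x)
    have "(\<lambda>y. g (x, y)) \<in> borel_measurable lebesgue"
      using measurable_compose_Pair1[OF _ g', of x] by (intro measurable_lborel_lebesgue) simp
    then show ?case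
      by (rule measurable_lebesgue_cong_AE) (use elim in auto)
  qed
qed

lemma measurable_dist_lebesgue [measurable]:
  "(\<lambda>z. dist (fst z) (snd z)) \<in>
     borel_measurable (lebesgue :: ('a::euclidean_space \<times> 'a) measure)"
  by (intro measurable_lborel_lebesgue)
    (simp add: borel_measurable_continuous_onI continuous_on_dist continuous_on_fst continuous_on_snd continuous_on_id)

lemma superlevel_sets_lebesgue:
  fixes f :: "'a::euclidean_space \<Rightarrow> real"
  assumes [measurable]: "f \<in> borel_measurable lebesgue"
  shows "{x. c < f x} \<in> sets lebesgue" "{x. c \<le> f x} \<in> sets lebesgue"
    "{x \<in> ball x0 r. c < f x} \<in> sets lebesgue"
proof -
  have "{x \<in> space lebesgue. c < f x} \<in> sets lebesgue" "{x \<in> space lebesgue. c \<le> f x} \<in> sets lebesgue"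
    by measurable
  then show 1: "{x. c < f x} \<in> sets lebesgue" and "{x. c \<le> f x} \<in> sets lebesgue" by simp_all
  have "ball x0 r \<inter> {x. c < f x} \<in> sets lebesgue" using 1 by (intro sets.Int) auto
  then show "{x \<in> ball x0 r. c < f x} \<in> sets lebesgue" by (simp add: Int_def)
qed

section \<open>Pointwise inequalities for the competitor\<close>

text \<open>\<open>powr_convex\<close> covers positive points; the endpoint 0 is added through
  \<open>a powr m \<le> a\<close> for \<open>0 < a < 1\<close>, together with
  \<open>0 powr m = 0\<close>.\<close>

lemma convex_on_powr:
  assumes "1 \<le> (m::real)"
  shows "convex_on {0..} (\<lambda>x. x powr m)"
proof (rule convex_onI)
  fix t x y :: real
  assume t: "0 < t" "t < 1" and xy: "x \<in> {0..}" "y \<in> {0..}"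
  have small: "a powr m \<le> a" if "0 < a" "a < 1" for a :: real
    using powr_mono'[of 1 m a] that assms by simp
  have *: "(a * y) powr m \<le> a * y powr m" if "0 < a" "a < 1" "0 \<le> y" for a y :: real
    using small[of a] that by (simp add: powr_mult mult_right_mono)
  consider "x = 0" | "y = 0" | "x > 0" "y > 0" using xy by force
  then show "((1 - t) *\<^sub>R x + t *\<^sub>R y) powr m \<le> (1 - t) * x powr m + t * y powr m"
  proof cases
    case 1 then show ?thesis using *[of t y] t xy by simp
  next
    case 2 then show ?thesis using *[of "1 - t" x] t xy by simp
  next
    case 3
    then show ?thesis
      using convex_onD[OF powr_convex[OF assms], of t x y] t by simp
  qed
qed simp

lemma powr_convex_comb:
  assumes "1 \<le> (m::real)" "0 \<le> t" "t \<le> 1" "0 \<le> x" "0 \<le> y"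
  shows "((1 - t) * x + t * y) powr m \<le> (1 - t) * x powr m + t * y powr m"
  using convex_onD[OF convex_on_powr[OF assms(1)], of t x y] assms by simp

text \<open>\<open>y\<close> and \<open>x - d\<close> lie between \<open>y - d\<close> and
  \<open>x\<close>, and the two pairs have the same sum. One weight \<open>t\<close> therefore
  represents both inner points, with the endpoints exchanged; adding the two convexity inequalities
  removes the weight.\<close>

lemma powr_four_points:
  assumes m: "1 \<le> (m::real)" and "0 \<le> d" "d \<le> y" "y \<le> x"
  shows "y powr m + (x - d) powr m \<le> x powr m + (y - d) powr m"
proof (cases "x = y - d")
  case True then have "x = y" "d = 0" using assms by auto
  then show ?thesis by simp
next
  case False
  then have pos: "x - (y - d) > 0" using assms by auto
  define t where "t = (y - (y - d)) / (x - (y - d))"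
  have t: "0 \<le> t" "t \<le> 1" using assms pos by (auto simp: t_def)
  have tt: "t * (x - (y - d)) = d" using pos by (simp add: t_def)
  have e1: "(1 - t) * (y - d) + t * x = y" using tt by (simp add: algebra_simps)
  have e2: "(1 - t) * x + t * (y - d) = x - d" using tt by (simp add: algebra_simps)
  have "y powr m \<le> (1 - t) * (y - d) powr m + t * x powr m"
    using powr_convex_comb[OF m t, of "y - d" x] assms e1 by simp
  moreover have "(x - d) powr m \<le> (1 - t) * x powr m + t * (y - d) powr m"
    using powr_convex_comb[OF m t, of x "y - d"] assms e2 by simp
  ultimately show ?thesis by (simp add: algebra_simps)
qed

lemma powr_diff_le:
  assumes m: "1 \<le> (m::real)" and "0 \<le> a" "a \<le> b"
  shows "b powr m - a powr m \<le> m * b powr (m - 1) * (b - a)"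
proof (cases "a = 0 \<or> a = b")
  case True
  moreover have "b powr m \<le> m * b powr (m - 1) * b"
  proof -
    have "b powr m = b powr (m - 1) * b"
      using assms by (cases "b = 0") (auto simp: powr_diff)
    moreover have "1 * (b powr (m - 1) * b) \<le> m * (b powr (m - 1) * b)"
      using m assms by (intro mult_right_mono) auto
    ultimately show ?thesis by simp
  qed
  ultimately show ?thesis by auto
next
  case False
  then have ab: "0 < a" "a < b" using assms by auto
  have "\<exists>z. a < z \<and> z < b \<and> b powr m - a powr m = (b - a) * (m * z powr (m - 1))"
    using ab by (intro MVT2) (auto intro!: has_real_derivative_powr)
  then obtain z where z: "a < z" "z < b" "b powr m - a powr m = (b - a) * (m * z powr (m - 1))"
    by blast
  have "z powr (m - 1) \<le> b powr (m - 1)" using z ab m by (intro powr_mono2) auto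
  then have "(b - a) * (m * z powr (m - 1)) \<le> (b - a) * (m * b powr (m - 1))"
    using ab m by (intro mult_left_mono) auto
  then show ?thesis using z by (simp add: mult_ac)
qed

lemma powr_add_le:
  assumes "0 \<le> (m::real)" "0 \<le> a" "0 \<le> b"
  shows "(a + b) powr m \<le> 2 powr m * (a powr m + b powr m)"
proof -
  have "(a + b) powr m \<le> (2 * max a b) powr m" using assms by (intro powr_mono2) auto
  also have "\<dots> = 2 powr m * max a b powr m" using assms by (simp add: powr_mult)
  also have "\<dots> \<le> 2 powr m * (a powr m + b powr m)"
    by (intro mult_left_mono) (auto simp: max_def)
  finally show ?thesis .
qed

text \<open>The difference is \<open>(1 - M) * (wx - wy) - E\<close> with
  \<open>M = fx powr q\<close>. Convexity with weights \<open>1 - M\<close> and \<open>M\<close>,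
  applied to \<open>\<bar>wx - wy\<bar>\<close> and \<open>E / M\<close>, keeps the exact
  coefficient \<open>1 - fx powr q\<close> in front of the first term. That deficit is the whole
  gain; a triangle inequality with constants would lose it.\<close>

lemma cutoff_competitor_bound_aux:
  fixes m q :: real
  assumes m: "1 \<le> m" "m \<le> q" and f: "0 \<le> fy" "fy \<le> fx" "fx \<le> 1" and w: "0 \<le> wx" "0 \<le> wy"
  shows "\<bar>(1 - fx powr q) * wx - (1 - fy powr q) * wy\<bar> powr m
    \<le> (1 - fx powr q) * \<bar>wx - wy\<bar> powr m + q powr m * (fx - fy) powr m * wy powr m"
proof (cases "fx = 0")
  case True then have "fy = 0" using f by auto
  then show ?thesis using True m by simp
next
  case False
  then have fx: "0 < fx" using f by auto
  define M where "M = fx powr q"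
  have M: "0 < M" "M \<le> 1" using fx f m by (simp_all add: M_def powr_le1)
  have e0: "0 \<le> fx powr q - fy powr q" using f m by (simp add: powr_mono2)
  have e1: "fx powr q - fy powr q \<le> q * fx powr (q - 1) * (fx - fy)"
    using powr_diff_le[of q fy fx] m f by auto
  define E where "E = (fx powr q - fy powr q) * wy"
  have E: "0 \<le> E" using e0 w by (simp add: E_def)
  have "(1 - fx powr q) * wx - (1 - fy powr q) * wy = (1 - M) * (wx - wy) - E"
    by (simp add: M_def E_def algebra_simps)
  then have "\<bar>(1 - fx powr q) * wx - (1 - fy powr q) * wy\<bar> \<le> (1 - M) * \<bar>wx - wy\<bar> + E"
    using abs_triangle_ineq4[of "(1 - M) * (wx - wy)" E] M E by (simp add: abs_mult)
  also have "\<dots> = (1 - M) * \<bar>wx - wy\<bar> + M * (E / M)" using M by simp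
  finally have "\<bar>(1 - fx powr q) * wx - (1 - fy powr q) * wy\<bar> powr m
      \<le> ((1 - M) * \<bar>wx - wy\<bar> + M * (E / M)) powr m"
    using m by (intro powr_mono2) auto
  also have "\<dots> \<le> (1 - M) * \<bar>wx - wy\<bar> powr m + M * (E / M) powr m"
    using M E m by (intro powr_convex_comb) auto
  \<comment> \<open>Here \<open>m \<le> q\<close> is decisive: dividing \<open>E\<close> by
    \<open>M\<close> leaves one factor \<open>1 / fx\<close>, hence \<open>fx powr (- m)\<close>
    after taking powers, and the prefactor \<open>M = fx powr q\<close> repays it.\<close>
  also have "M * (E / M) powr m \<le> q powr m * (fx - fy) powr m * wy powr m"
  proof -
    have "E / M \<le> (q * fx powr (q - 1) * (fx - fy)) * wy / M"
      unfolding E_def using e1 w M by (intro divide_right_mono mult_right_mono) auto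
    also have "\<dots> = q * (fx - fy) * wy * fx powr (-1)"
      using fx by (simp add: M_def powr_diff powr_minus field_simps)
    finally have "(E / M) powr m \<le> (q * (fx - fy) * wy * fx powr (-1)) powr m"
      using E M m by (intro powr_mono2) auto
    also have "\<dots> = q powr m * (fx - fy) powr m * wy powr m * fx powr (- m)"
      using f m w fx by (simp add: powr_mult powr_divide powr_minus_divide)
    finally have "M * (E / M) powr m \<le> M * (q powr m * (fx - fy) powr m * wy powr m * fx powr (- m))"
      using M by (intro mult_left_mono) auto
    also have "\<dots> = q powr m * (fx - fy) powr m * wy powr m * fx powr (q - m)"
      using fx by (simp add: M_def powr_diff powr_minus divide_simps)
    also have "\<dots> \<le> q powr m * (fx - fy) powr m * wy powr m * 1"
      using fx f m by (intro mult_left_mono powr_le1) auto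
    finally show ?thesis by simp
  qed
  finally show ?thesis by (simp add: M_def)
qed

lemma cutoff_competitor_bound:
  fixes m q :: real
  assumes m: "1 \<le> m" "m \<le> q" and f: "0 \<le> fy" "fy \<le> 1" "0 \<le> fx" "fx \<le> 1"
    and w: "0 \<le> wx" "0 \<le> wy"
  shows "\<bar>(1 - fx powr q) * wx - (1 - fy powr q) * wy\<bar> powr m + max (fx powr q) (fy powr q) * \<bar>wx - wy\<bar> powr m
    \<le> \<bar>wx - wy\<bar> powr m + q powr m * \<bar>fx - fy\<bar> powr m * (wx powr m + wy powr m)"
proof (cases "fy \<le> fx")
  case True
  then have mx: "max (fx powr q) (fy powr q) = fx powr q"
    using f m by (intro max_absorb1 powr_mono2) auto
  have "q powr m * (fx - fy) powr m * wy powr m \<le> q powr m * \<bar>fx - fy\<bar> powr m * (wx powr m + wy powr m)"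
    using True by (intro mult_mono) auto
  then show ?thesis unfolding mx
    using cutoff_competitor_bound_aux[OF m f(1) True f(4) w] by (simp add: algebra_simps)
next
  case False
  then have le: "fx \<le> fy" by simp
  then have mx: "max (fx powr q) (fy powr q) = fy powr q"
    using f m by (intro max_absorb2 powr_mono2) auto
  have "q powr m * (fy - fx) powr m * wx powr m \<le> q powr m * \<bar>fx - fy\<bar> powr m * (wx powr m + wy powr m)"
    using le by (intro mult_mono) auto
  then show ?thesis unfolding mx
    using cutoff_competitor_bound_aux[OF m f(3) le f(2) w(2,1)]
    by (simp add: algebra_simps abs_minus_commute)
qed

text \<open>Replacing \<open>A, B\<close> by their positive parts only decreases the gain of the competitor,
  because increments of a convex function increase.\<close>

lemma powr_diff_positive_part:
  fixes m A B :: real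
  assumes m: "1 \<le> m" and e: "0 \<le> ex" "ex \<le> 1" "0 \<le> ey" "ey \<le> 1"
  defines "wx \<equiv> max A 0" and "wy \<equiv> max B 0"
  shows "\<bar>(A - ex * wx) - (B - ey * wy)\<bar> powr m + \<bar>wx - wy\<bar> powr m
    \<le> \<bar>A - B\<bar> powr m + \<bar>(1 - ex) * wx - (1 - ey) * wy\<bar> powr m"
proof -
  have le1: "e * c \<le> c" if "0 \<le> c" "e \<le> 1" for e c :: real
    using mult_right_mono[OF that(2,1)] by simp
  consider "A \<ge> 0" "B \<ge> 0" | "A \<le> 0" "B \<le> 0" | "A > 0" "B < 0" | "A < 0" "B > 0" by linarith
  then show ?thesis
  proof cases
    case 1 then show ?thesis by (simp add: wx_def wy_def algebra_simps)
  next
    case 2 then show ?thesis by (simp add: wx_def wy_def)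
  next
    case 3
    \<comment> \<open>Points on opposite sides of the level: the four points are given by
      \<open>x = A - B\<close>, \<open>y = A\<close> and \<open>d = ex * A\<close>.\<close>
    have "A powr m + (A - B - ex * A) powr m \<le> (A - B) powr m + (A - ex * A) powr m"
      using 3 m e le1[of A ex] by (intro powr_four_points) auto
    moreover have "\<bar>A - ex * A - B\<bar> = A - B - ex * A" "\<bar>A - ex * A\<bar> = A - ex * A" "\<bar>A - B\<bar> = A - B"
      using 3 le1[of A ex] e by linarith+
    ultimately show ?thesis using 3 by (simp add: wx_def wy_def algebra_simps)
  next
    case 4
    have "B powr m + (B - A - ey * B) powr m \<le> (B - A) powr m + (B - ey * B) powr m"
      using 4 m e le1[of B ey] by (intro powr_four_points) auto
    moreover have l: "ey * B \<le> B" using le1[of B ey] 4 e by simp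
    moreover have w: "wx = 0" "wy = B" using 4 by (auto simp: wx_def wy_def)
    moreover have "\<bar>(A - ex * wx) - (B - ey * wy)\<bar> = B - A - ey * B" "\<bar>wx - wy\<bar> = B"
      "\<bar>A - B\<bar> = B - A"
      unfolding w using 4 l by linarith+
    moreover have "\<bar>(1 - ex) * wx - (1 - ey) * wy\<bar> = B - ey * B"
      unfolding w using 4 l by (simp add: abs_if algebra_simps)
    ultimately show ?thesis by (simp only:)
  qed
qed

lemma competitor_energy_inside:
  fixes m q A B :: real
  assumes m: "1 \<le> m" "m \<le> q" and f: "0 \<le> fy" "fy \<le> 1" "0 \<le> fx" "fx \<le> 1"
  defines "wx \<equiv> max A 0" and "wy \<equiv> max B 0"
  shows "\<bar>(A - fx powr q * wx) - (B - fy powr q * wy)\<bar> powr m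
      + max (fx powr q) (fy powr q) * \<bar>wx - wy\<bar> powr m
    \<le> \<bar>A - B\<bar> powr m + q powr m * \<bar>fx - fy\<bar> powr m * (wx powr m + wy powr m)"
proof -
  have "fx powr q \<le> 1" "fy powr q \<le> 1" using f m by (auto intro: powr_le1)
  then show ?thesis
    using powr_diff_positive_part[OF m(1), of "fx powr q" "fy powr q" A B]
      cutoff_competitor_bound[OF m f, of wx wy]
    by (simp add: wx_def wy_def)
qed

text \<open>\<open>A\<close> and \<open>B\<close> stand for \<open>u - k\<close> at a point where
  the cutoff may be positive and at a point where it vanishes. For such distant pairs the error must
  fit the nonlocal tail: it is linear in \<open>wx\<close> and carries the power
  \<open>m - 1\<close> of \<open>wy\<close>.\<close>

lemma competitor_energy_outside:
  fixes m A B :: real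
  assumes m: "1 \<le> m" and e: "0 \<le> ex" "ex \<le> 1"
  defines "wx \<equiv> max A 0" and "wy \<equiv> max B 0"
  shows "\<bar>(A - ex * wx) - B\<bar> powr m \<le> \<bar>A - B\<bar> powr m + m * wy powr (m - 1) * wx"
proof -
  have w: "0 \<le> wx" "0 \<le> wy" by (auto simp: wx_def wy_def)
  have ew: "0 \<le> ex * wx" "ex * wx \<le> wx" using e w mult_right_mono[OF e(2) w(1)] by auto
  define c where "c = (1 - ex) * wx - wy"
  have cc: "c = wx - ex * wx - wy" by (simp add: c_def algebra_simps)
  have "\<bar>c\<bar> powr m \<le> \<bar>wx - wy\<bar> powr m + m * wy powr (m - 1) * wx"
  proof (cases "\<bar>c\<bar> \<le> \<bar>wx - wy\<bar>")
    case True
    then have "\<bar>c\<bar> powr m \<le> \<bar>wx - wy\<bar> powr m" using m by (intro powr_mono2) auto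
    then show ?thesis using m w by (simp add: add_increasing2)
  next
    case False
    \<comment> \<open>The increment has grown, which forces \<open>c < 0\<close>. Then
      \<open>\<bar>c\<bar>\<close> is at most \<open>wy\<close> and exceeds
      \<open>\<bar>wx - wy\<bar>\<close> by at most \<open>wx\<close>.\<close>
    then have c: "c < 0" using cc ew by linarith
    have "\<bar>c\<bar> powr m - \<bar>wx - wy\<bar> powr m \<le> m * \<bar>c\<bar> powr (m - 1) * (\<bar>c\<bar> - \<bar>wx - wy\<bar>)"
      using False m by (intro powr_diff_le) auto
    also have "\<dots> \<le> m * wy powr (m - 1) * wx"
    proof (intro mult_mono)
      show "\<bar>c\<bar> powr (m - 1) \<le> wy powr (m - 1)"
        using c cc ew w m by (intro powr_mono2) auto
      show "\<bar>c\<bar> - \<bar>wx - wy\<bar> \<le> wx" using c cc ew w by linarith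
    qed (use m w False in auto)
    finally show ?thesis by simp
  qed
  then show ?thesis
    using powr_diff_positive_part[OF m e, of 0 A B] by (simp add: wx_def wy_def c_def)
qed

text \<open>This bounds the truncated function to which the Faber-Krahn and Sobolev inequalities are
  applied by the gain and the error of the comparison above. The weight may stay at power one
  because \<open>gx powr q \<le> 1\<close> dominates its own \<open>m\<close>-th power.\<close>

lemma cutoff_product_bound:
  fixes m q :: real
  assumes m: "1 \<le> m" "m \<le> q" and f: "0 \<le> fy" "fy \<le> 1" "0 \<le> fx" "fx \<le> 1"
    and w: "0 \<le> wx" "0 \<le> wy"
  shows "\<bar>fx powr q * wx - fy powr q * wy\<bar> powr m
    \<le> 2 powr m * (max (fx powr q) (fy powr q) * \<bar>wx - wy\<bar> powr m
        + q powr m * \<bar>fx - fy\<bar> powr m * (wx powr m + wy powr m))"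
proof -
  have *: "\<bar>gx powr q * ax - gy powr q * ay\<bar> powr m
    \<le> 2 powr m * (max (gx powr q) (gy powr q) * \<bar>ax - ay\<bar> powr m
        + q powr m * \<bar>gx - gy\<bar> powr m * (ax powr m + ay powr m))"
    if g: "0 \<le> gy" "gy \<le> gx" "gx \<le> 1" and a: "0 \<le> ax" "0 \<le> ay" for gx gy ax ay
  proof -
    have mono: "gy powr q \<le> gx powr q" using g m by (intro powr_mono2) auto
    have g1: "gx powr q \<le> 1" using g m by (intro powr_le1) auto
    have d: "gx powr q - gy powr q \<le> q * (gx - gy)"
    proof -
      have "gx powr q - gy powr q \<le> q * gx powr (q - 1) * (gx - gy)"
        using powr_diff_le[of q gy gx] m g by auto
      also have "\<dots> \<le> q * 1 * (gx - gy)"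
        using g m by (intro mult_right_mono mult_left_mono powr_le1) auto
      finally show ?thesis by simp
    qed
    have "gx powr q * ax - gy powr q * ay = gx powr q * (ax - ay) + (gx powr q - gy powr q) * ay"
      by (simp add: algebra_simps)
    then have "\<bar>gx powr q * ax - gy powr q * ay\<bar> \<le> gx powr q * \<bar>ax - ay\<bar> + (gx powr q - gy powr q) * ay"
      using abs_triangle_ineq[of "gx powr q * (ax - ay)" "(gx powr q - gy powr q) * ay"] mono a
      by (simp add: abs_mult)
    also have "\<dots> \<le> gx powr q * \<bar>ax - ay\<bar> + q * (gx - gy) * ay"
      using d a by (intro add_left_mono mult_right_mono) auto
    finally have "\<bar>gx powr q * ax - gy powr q * ay\<bar> powr m \<le> (gx powr q * \<bar>ax - ay\<bar> + q * (gx - gy) * ay) powr m"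
      using m by (intro powr_mono2) auto
    also have "\<dots> \<le> 2 powr m * ((gx powr q * \<bar>ax - ay\<bar>) powr m + (q * (gx - gy) * ay) powr m)"
      using m g a by (intro powr_add_le) auto
    also have "\<dots> \<le> 2 powr m * (max (gx powr q) (gy powr q) * \<bar>ax - ay\<bar> powr m
        + q powr m * \<bar>gx - gy\<bar> powr m * (ax powr m + ay powr m))"
    proof (intro mult_left_mono add_mono)
      have "(gx powr q) powr m \<le> gx powr q"
        using powr_mono'[of 1 m "gx powr q"] m g1 by simp
      then show "(gx powr q * \<bar>ax - ay\<bar>) powr m \<le> max (gx powr q) (gy powr q) * \<bar>ax - ay\<bar> powr m"
        by (simp add: powr_mult) (intro mult_right_mono, auto)
      show "(q * (gx - gy) * ay) powr m \<le> q powr m * \<bar>gx - gy\<bar> powr m * (ax powr m + ay powr m)"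
        using m g a by (simp add: powr_mult) (intro mult_left_mono, auto)
    qed auto
    finally show ?thesis .
  qed
  show ?thesis
  proof (cases "fy \<le> fx")
    case True then show ?thesis using * f w by blast
  next
    case False
    then show ?thesis using *[of fx fy wy wx] f w
      by (simp add: abs_minus_commute max.commute add.commute)
  qed
qed

section \<open>The Gagliardo integral of a cutoff function\<close>

lemma emeasure_lebesgue_ball:
  fixes x :: "'a::euclidean_space"
  assumes "0 \<le> r"
  shows "emeasure lebesgue (ball x r) = ennreal (unit_ball_vol (real DIM('a)) * r ^ DIM('a))"
  using emeasure_ball[OF assms, of x] by simp

lemma ennreal_term_le_suminf: "(f :: nat \<Rightarrow> ennreal) j \<le> (\<Sum>i. f i)"
  using sum_le_suminf[of f "{j}"] by simp

lemma divide_powr: "(x::real) / y powr a = x * y powr (- a)"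
  by (simp add: powr_minus divide_inverse)

lemma dyadic_below:
  assumes "0 < (r::real)" "r < d"
  obtains j :: nat where "d * (1/2) ^ j / 2 \<le> r" "r < d * (1/2) ^ j"
proof -
  define P where "P j \<longleftrightarrow> d * (1/2) ^ j / 2 \<le> r" for j :: nat
  have "\<exists>j. P j"
  proof -
    obtain j where j: "(1/2) ^ j < r / d"
      using real_arch_pow_inv[of "r / d" "1/2 :: real"] assms by auto
    then have "d * (1/2) ^ j < r" using assms by (simp add: field_simps)
    moreover have "d * (1/2) ^ j / 2 \<le> d * (1/2) ^ j" using assms by simp
    ultimately show ?thesis unfolding P_def using less_imp_le order_trans by blast
  qed
  then have L: "P (LEAST j. P j)" by (rule LeastI_ex)
  show ?thesis
  proof (cases "LEAST j. P j")
    case 0 then show ?thesis using L assms that[of 0] by (simp add: P_def)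
  next
    case (Suc k)
    then have "\<not> P k" using not_less_Least[of k P] by simp
    then show ?thesis using L Suc that[of "Suc k"] by (simp add: P_def)
  qed
qed

lemma dyadic_above:
  assumes "0 < (d::real)" "d \<le> r"
  obtains j :: nat where "d * 2 ^ j \<le> r" "r < d * 2 ^ j * 2"
proof -
  define P where "P j \<longleftrightarrow> r < d * 2 ^ j * 2" for j :: nat
  have "\<exists>j. P j"
  proof -
    obtain j where j: "r / d < 2 ^ j"
      using real_arch_pow[of "2 :: real" "r / d"] by auto
    then have "r < d * 2 ^ j" using assms by (simp add: field_simps)
    then show ?thesis unfolding P_def using assms by (intro exI[of _ j]) simp
  qed
  then have L: "P (LEAST j. P j)" by (rule LeastI_ex)
  show ?thesis
  proof (cases "LEAST j. P j")
    case 0 then show ?thesis using L assms that[of 0] by (simp add: P_def)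
  next
    case (Suc k)
    then have "\<not> P k" using not_less_Least[of k P] by simp
    then show ?thesis using L Suc that[of "Suc k"] by (simp add: P_def)
  qed
qed

lemma suminf_ennreal_geometric:
  assumes "0 \<le> K" "0 \<le> b" "b < 1"
  shows "(\<Sum>j. ennreal (K * b ^ j)) = ennreal (K / (1 - b))"
proof -
  have s: "(\<lambda>j. K * b ^ j) sums (K * (1 / (1 - b)))"
    using assms by (intro sums_mult geometric_sums) auto
  have "(\<Sum>j. ennreal (K * b ^ j)) = ennreal (\<Sum>j. K * b ^ j)"
    using assms s by (intro suminf_ennreal2) (auto simp: sums_iff)
  then show ?thesis using s by (simp add: sums_iff)
qed

lemma power_powr_swap: "0 < (b::real) \<Longrightarrow> (b ^ j) powr c = (b powr c) ^ j"
  by (simp add: powr_power powr_powr mult.commute flip: powr_realpow)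

lemma half_power_powr: "((1/2::real) ^ j) powr (- c) = (2 powr c) ^ j"
proof -
  have "(1/2::real) powr (- c) = 2 powr c" unfolding powr_divide divide_powr by simp
  then show ?thesis using power_powr_swap[of "1/2" j "- c"] by simp
qed

text \<open>Dyadic shells around \<open>x\<close>. Within distance \<open>d\<close> the Lipschitz
  bound gives a geometric series of ratio \<open>b1\<close>, convergent because \<sigma> is below 1;
  beyond \<open>d\<close> the bound 1 gives ratio \<open>b2\<close>, convergent because \<sigma> is
  positive. Shells are enlarged to balls, which costs only constants.\<close>

lemma cutoff_kernel_integral:
  fixes \<sigma> m :: real
  assumes \<sigma>: "0 < \<sigma>" "\<sigma> < 1" and m: "1 \<le> m"
  obtains G where "0 < G"
    "\<And>(\<phi> :: 'a::euclidean_space \<Rightarrow> real) d x. 0 < d \<Longrightarrow> (\<And>y. \<bar>\<phi> x - \<phi> y\<bar> \<le> dist x y / d) \<Longrightarrow>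
       (\<And>y. \<bar>\<phi> x - \<phi> y\<bar> \<le> 1) \<Longrightarrow>
       (\<integral>\<^sup>+y. ennreal (\<bar>\<phi> x - \<phi> y\<bar> powr m / dist x y powr (real DIM('a) + \<sigma> * m)) \<partial>lebesgue)
         \<le> ennreal (G * d powr (- (\<sigma> * m)))"
proof -
  define n where "n = real DIM('a)"
  define \<omega> where "\<omega> = unit_ball_vol n"
  define b1 where "b1 = (1/2::real) powr (m - \<sigma> * m)"
  define b2 where "b2 = 2 powr (- (\<sigma> * m))"
  define K1 where "K1 = \<omega> * 2 powr (n + \<sigma> * m)"
  define K2 where "K2 = \<omega> * 2 ^ DIM('a)"
  have \<omega>: "0 < \<omega>" by (simp add: \<omega>_def n_def)
  have sm: "0 < \<sigma> * m" "\<sigma> * m < m" using \<sigma> m by auto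
  have b1: "0 \<le> b1" "b1 < 1"
    unfolding b1_def using sm powr_less_mono2[of "m - \<sigma> * m" "1/2" 1] by auto
  have b2: "0 \<le> b2" "b2 < 1"
    using sm powr_less_mono[of "- (\<sigma> * m)" 0 2] by (auto simp: b2_def)
  have K: "0 < K1" "0 < K2" using \<omega> by (auto simp: K1_def K2_def)
  have split_exponent: "a powr (- (n + \<sigma> * m)) = a powr (- n) * a powr (- (\<sigma> * m))" for a :: real
    by (simp flip: powr_add)
  have half: "(a / 2) powr (- c) = a powr (- c) * 2 powr c" for a c :: real
    unfolding powr_divide divide_powr by simp
  \<comment> \<open>Bookkeeping for the volume factors: \<open>a1, b1'\<close> and
    \<open>a2, b2'\<close> will be pairs of mutually inverse powers with exponents
    \<open>- n\<close> and \<open>n\<close>.\<close>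
  have rearr: "P * (a1 * S * (a2 * U) * W) * (\<omega> * (b1' * b2' * Z)) = \<omega> * (W * Z) * S * (P * U)"
    if "a1 * b1' = 1" "a2 * b2' = 1" for a1 b1' a2 b2' P S U W Z :: real
  proof -
    have "P * (a1 * S * (a2 * U) * W) * (\<omega> * (b1' * b2' * Z))
        = \<omega> * (W * Z) * S * (P * U) * ((a1 * b1') * (a2 * b2'))"
      by (simp only: mult_ac)
    then show ?thesis unfolding that by (simp only: mult_1_left mult_1_right)
  qed
  define G where "G = K1 / (1 - b1) + K2 / (1 - b2)"
  have G: "0 < G" using K b1 b2 by (auto simp: G_def intro!: add_pos_pos divide_pos_pos)
  show ?thesis
  proof (rule that[OF G])
    fix \<phi> :: "'a \<Rightarrow> real" and d :: real and x
    assume d: "0 < d" and L: "\<And>y. \<bar>\<phi> x - \<phi> y\<bar> \<le> dist x y / d" and B: "\<And>y. \<bar>\<phi> x - \<phi> y\<bar> \<le> 1"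
    define c1 where "c1 j = ((1/2) ^ j) powr m * (d * (1/2) ^ j / 2) powr (- (n + \<sigma> * m))" for j :: nat
    define c2 where "c2 j = (d * 2 ^ j) powr (- (n + \<sigma> * m))" for j :: nat
    define B1 where "B1 j = ball x (d * (1/2) ^ j)" for j :: nat
    define B2 where "B2 j = ball x (d * 2 ^ j * 2)" for j :: nat
    have pt: "ennreal (\<bar>\<phi> x - \<phi> y\<bar> powr m / dist x y powr (n + \<sigma> * m))
      \<le> (\<Sum>j. ennreal (c1 j) * indicator (B1 j) y) + (\<Sum>j. ennreal (c2 j) * indicator (B2 j) y)" for y
    proof -
      let ?r = "dist x y"
      have nn: "0 \<le> n + \<sigma> * m" using sm by (simp add: n_def)
      consider "?r = 0" | "0 < ?r" "?r < d" | "d \<le> ?r" by force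
      then show ?thesis
      proof cases
        case 1 then show ?thesis by simp
      next
        case 2
        then obtain j where j: "d * (1/2) ^ j / 2 \<le> ?r" "?r < d * (1/2) ^ j"
          by (rule dyadic_below)
        have "\<bar>\<phi> x - \<phi> y\<bar> powr m / ?r powr (n + \<sigma> * m) = \<bar>\<phi> x - \<phi> y\<bar> powr m * ?r powr (- (n + \<sigma> * m))"
          by (rule divide_powr)
        also have "\<dots> \<le> c1 j"
          unfolding c1_def
        proof (intro mult_mono)
          have "\<bar>\<phi> x - \<phi> y\<bar> \<le> ?r / d" by (rule L)
          also have "\<dots> \<le> (1/2) ^ j" using j d by (simp add: field_simps)
          finally show "\<bar>\<phi> x - \<phi> y\<bar> powr m \<le> ((1/2) ^ j) powr m"
            using m by (intro powr_mono2) auto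
          show "?r powr (- (n + \<sigma> * m)) \<le> (d * (1/2) ^ j / 2) powr (- (n + \<sigma> * m))"
            using j d nn by (intro powr_mono2') auto
        qed auto
        finally have "ennreal (\<bar>\<phi> x - \<phi> y\<bar> powr m / ?r powr (n + \<sigma> * m)) \<le> ennreal (c1 j) * indicator (B1 j) y"
          using j by (simp add: B1_def ennreal_leI)
        also have "\<dots> \<le> (\<Sum>j. ennreal (c1 j) * indicator (B1 j) y)"
          by (rule ennreal_term_le_suminf)
        finally show ?thesis by (rule order_trans) simp
      next
        case 3
        with d obtain j where j: "d * 2 ^ j \<le> ?r" "?r < d * 2 ^ j * 2" by (rule dyadic_above)
        have "\<bar>\<phi> x - \<phi> y\<bar> powr m / ?r powr (n + \<sigma> * m) = \<bar>\<phi> x - \<phi> y\<bar> powr m * ?r powr (- (n + \<sigma> * m))"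
          by (rule divide_powr)
        also have "\<dots> \<le> 1 * c2 j"
          unfolding c2_def
        proof (intro mult_mono)
          show "\<bar>\<phi> x - \<phi> y\<bar> powr m \<le> 1" using B m by (intro powr_le1) auto
          show "?r powr (- (n + \<sigma> * m)) \<le> (d * 2 ^ j) powr (- (n + \<sigma> * m))"
            using j d nn by (intro powr_mono2') auto
        qed auto
        finally have "ennreal (\<bar>\<phi> x - \<phi> y\<bar> powr m / ?r powr (n + \<sigma> * m)) \<le> ennreal (c2 j) * indicator (B2 j) y"
          using j by (simp add: B2_def ennreal_leI)
        also have "\<dots> \<le> (\<Sum>j. ennreal (c2 j) * indicator (B2 j) y)"
          by (rule ennreal_term_le_suminf)
        finally show ?thesis by (rule order_trans) simp
      qed
    qed
    have i1: "(\<integral>\<^sup>+y. ennreal (c1 j) * indicator (B1 j) y \<partial>lebesgue) = ennreal ((K1 * d powr (- (\<sigma> * m))) * b1 ^ j)" for j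
    proof -
      let ?t = "(1/2::real) ^ j"
      have t: "0 < ?t" by simp
      have "c1 j * (\<omega> * (d * ?t) ^ DIM('a)) = (K1 * d powr (- (\<sigma> * m))) * ?t powr (m - \<sigma> * m)"
      proof -
        have E1: "(d * ?t) ^ DIM('a) = d powr n * ?t powr n"
          using d by (simp add: n_def powr_realpow power_mult_distrib)
        have E2: "(d * ?t / 2) powr (- (n + \<sigma> * m))
            = d powr (- n) * d powr (- (\<sigma> * m)) * (?t powr (- n) * ?t powr (- (\<sigma> * m))) * 2 powr (n + \<sigma> * m)"
          unfolding half by (simp only: powr_mult split_exponent mult_ac)
        have E3: "?t powr (m - \<sigma> * m) = ?t powr m * ?t powr (- (\<sigma> * m))"
          by (simp flip: powr_add)
        have E4: "d powr (- n) * d powr n = 1" "?t powr (-n) * ?t powr n = 1"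
          using d t by (simp_all add: powr_minus)
        show ?thesis unfolding c1_def K1_def E1 E2 E3
          using rearr[OF E4, of "?t powr m" "d powr (- (\<sigma> * m))" "?t powr (- (\<sigma> * m))" "2 powr (n + \<sigma> * m)" 1]
          by (simp only: mult_1_left mult_1_right)
      qed
      also have "?t powr (m - \<sigma> * m) = b1 ^ j" by (simp add: b1_def power_powr_swap)
      finally have "c1 j * (\<omega> * (d * ?t) ^ DIM('a)) = (K1 * d powr (- (\<sigma> * m))) * b1 ^ j" .
      moreover have "(\<integral>\<^sup>+y. ennreal (c1 j) * indicator (B1 j) y \<partial>lebesgue)
        = ennreal (c1 j) * ennreal (\<omega> * (d * ?t) ^ DIM('a))"
        using d by (simp add: nn_integral_cmult_indicator B1_def emeasure_ball \<omega>_def n_def)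
      moreover have "0 \<le> c1 j" by (simp add: c1_def)
      ultimately show ?thesis by (simp only: ennreal_mult'[symmetric])
    qed
    have i2: "(\<integral>\<^sup>+y. ennreal (c2 j) * indicator (B2 j) y \<partial>lebesgue) = ennreal ((K2 * d powr (- (\<sigma> * m))) * b2 ^ j)" for j
    proof -
      let ?t = "(2::real) ^ j"
      have t: "0 < ?t" by simp
      have "c2 j * (\<omega> * (d * ?t * 2) ^ DIM('a)) = (K2 * d powr (- (\<sigma> * m))) * ?t powr (- (\<sigma> * m))"
      proof -
        have E1: "(d * ?t * 2) ^ DIM('a) = d powr n * ?t powr n * 2 ^ DIM('a)"
          using d by (simp add: n_def powr_realpow power_mult_distrib)
        have E2: "(d * ?t) powr (- (n + \<sigma> * m))
            = d powr (- n) * d powr (- (\<sigma> * m)) * (?t powr (- n) * ?t powr (- (\<sigma> * m)))"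
          by (simp only: powr_mult split_exponent mult_ac)
        have E4: "d powr (- n) * d powr n = 1" "?t powr (-n) * ?t powr n = 1"
          using d t by (simp_all add: powr_minus)
        show ?thesis unfolding c2_def K2_def E1 E2
          using rearr[OF E4, of 1 "d powr (- (\<sigma> * m))" "?t powr (- (\<sigma> * m))" 1 "2 ^ DIM('a)"]
          by (simp only: mult_1_left mult_1_right)
      qed
      also have "?t powr (- (\<sigma> * m)) = b2 ^ j" by (simp add: b2_def power_powr_swap)
      finally have "c2 j * (\<omega> * (d * ?t * 2) ^ DIM('a)) = (K2 * d powr (- (\<sigma> * m))) * b2 ^ j" .
      moreover have "(\<integral>\<^sup>+y. ennreal (c2 j) * indicator (B2 j) y \<partial>lebesgue)
        = ennreal (c2 j) * ennreal (\<omega> * (d * ?t * 2) ^ DIM('a))"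
        using d by (simp add: nn_integral_cmult_indicator B2_def emeasure_ball \<omega>_def n_def)
      moreover have "0 \<le> c2 j" by (simp add: c2_def)
      ultimately show ?thesis by (simp only: ennreal_mult'[symmetric])
    qed
    have [measurable]: "B1 j \<in> sets lebesgue" "B2 j \<in> sets lebesgue" for j
      by (auto simp: B1_def B2_def)
    have "(\<integral>\<^sup>+y. ennreal (\<bar>\<phi> x - \<phi> y\<bar> powr m / dist x y powr (n + \<sigma> * m)) \<partial>lebesgue)
      \<le> (\<integral>\<^sup>+y. (\<Sum>j. ennreal (c1 j) * indicator (B1 j) y) + (\<Sum>j. ennreal (c2 j) * indicator (B2 j) y) \<partial>lebesgue)"
      by (intro nn_integral_mono pt)
    also have "\<dots> = (\<Sum>j. ennreal ((K1 * d powr (- (\<sigma> * m))) * b1 ^ j)) + (\<Sum>j. ennreal ((K2 * d powr (- (\<sigma> * m))) * b2 ^ j))"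
      by (simp add: nn_integral_add nn_integral_suminf i1 i2)
    also have "\<dots> = ennreal (K1 * d powr (- (\<sigma> * m)) / (1 - b1)) + ennreal (K2 * d powr (- (\<sigma> * m)) / (1 - b2))"
      using K b1 b2 by (subst (1 2) suminf_ennreal_geometric) auto
    also have "\<dots> = ennreal (G * d powr (- (\<sigma> * m)))"
      using K b1 b2 by (simp add: G_def ring_distribs flip: ennreal_plus)
    finally show "(\<integral>\<^sup>+y. ennreal (\<bar>\<phi> x - \<phi> y\<bar> powr m / dist x y powr (real DIM('a) + \<sigma> * m)) \<partial>lebesgue)
         \<le> ennreal (G * d powr (- (\<sigma> * m)))" by (simp add: n_def)
  qed
qed

section \<open>Faber-Krahn and Sobolev inequalities\<close>

definition local_gag :: "real \<Rightarrow> real \<Rightarrow> ('a::euclidean_space \<Rightarrow> real) \<Rightarrow> 'a \<Rightarrow> ennreal" where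
  "local_gag \<sigma> m f x =
     (\<integral>\<^sup>+y. ennreal (\<bar>f x - f y\<bar> powr m / dist x y powr (real DIM('a) + \<sigma> * m)) \<partial>lebesgue)"

definition gagliardo :: "real \<Rightarrow> real \<Rightarrow> ('a::euclidean_space \<Rightarrow> real) \<Rightarrow> ennreal" where
  "gagliardo \<sigma> m f =
     (\<integral>\<^sup>+z. ennreal (\<bar>f (fst z) - f (snd z)\<bar> powr m
        / dist (fst z) (snd z) powr (real DIM('a) + \<sigma> * m)) \<partial>lebesgue)"

lemma gagliardo_eq:
  fixes f :: "'a::euclidean_space \<Rightarrow> real"
  assumes [measurable]: "f \<in> borel_measurable lebesgue"
  shows "gagliardo \<sigma> m f = (\<integral>\<^sup>+x. local_gag \<sigma> m f x \<partial>lebesgue)"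
  unfolding gagliardo_def local_gag_def by (subst lebesgue_Tonelli(1)) simp_all

text \<open>\<open>2 powr m\<close> comes from \<open>f x - f y \<ge> f x / 2\<close>. The other
  factor comes from the ball of volume \<open>2 * V\<close>, whose radius satisfies
  \<open>r ^ n = 2 * V / \<omega>\<close>, after division by the measure \<open>V\<close> of the
  part of the ball that contributes.\<close>

definition sob_const :: "'a::euclidean_space itself \<Rightarrow> real \<Rightarrow> real \<Rightarrow> real" where
  "sob_const _ \<sigma> m =
     2 powr m * (2 / unit_ball_vol (real DIM('a))) powr (1 + \<sigma> * m / real DIM('a))"

lemma sob_const_pos: "0 < sob_const TYPE('a::euclidean_space) \<sigma> m"
  using unit_ball_vol_pos[of "real DIM('a)"] by (simp add: sob_const_def less_imp_neq[symmetric])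

lemma powr_le_local_gag:
  fixes f :: "'a::euclidean_space \<Rightarrow> real"
  assumes f[measurable]: "f \<in> borel_measurable lebesgue"
    and pos: "0 < f x" "0 < V" and \<sigma>m: "0 < \<sigma>" "1 \<le> m"
    and V: "emeasure lebesgue {y. f x / 2 \<le> f y} \<le> ennreal V"
  shows "ennreal (f x powr m)
    \<le> ennreal (sob_const TYPE('a) \<sigma> m * V powr (\<sigma> * m / real DIM('a))) * local_gag \<sigma> m f x"
proof -
  define n where "n = real DIM('a)"
  have n: "0 < n" by (simp add: n_def)
  define \<omega> where "\<omega> = unit_ball_vol n"
  have \<omega>: "0 < \<omega>" by (simp add: \<omega>_def n_def)
  define r where "r = (2 * V / \<omega>) powr (1 / n)"
  have r: "0 < r" using \<omega> pos by (simp add: r_def)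
  have rn: "r ^ DIM('a) = 2 * V / \<omega>"
  proof -
    have "r ^ DIM('a) = r powr n" using r by (simp add: n_def powr_realpow)
    also have "\<dots> = 2 * V / \<omega>" unfolding r_def using n pos \<omega> by (simp add: powr_powr)
    finally show ?thesis .
  qed
  define S where "S = {y. f x / 2 \<le> f y}"
  have S: "S \<in> sets lebesgue" unfolding S_def using f by (rule superlevel_sets_lebesgue)
  define A where "A = ball x r - S"
  have A: "A \<in> sets lebesgue" unfolding A_def using S by (intro sets.Diff) auto
  have mA: "ennreal V \<le> emeasure lebesgue A"
  proof -
    have "ennreal (2 * V) = emeasure lebesgue (ball x r)"
      using r rn \<omega> by (subst emeasure_lebesgue_ball) (simp_all flip: \<omega>_def n_def)
    also have "\<dots> \<le> emeasure lebesgue (A \<union> S)"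
      using A S by (intro emeasure_mono) (auto simp: A_def)
    also have "\<dots> \<le> emeasure lebesgue A + emeasure lebesgue S"
      using A S by (intro emeasure_subadditive) auto
    also have "\<dots> \<le> emeasure lebesgue A + ennreal V"
      using V by (simp add: S_def add_left_mono)
    finally have *: "ennreal V + ennreal V \<le> emeasure lebesgue A + ennreal V"
      using pos by (simp flip: ennreal_plus)
    then show ?thesis
      by (cases "emeasure lebesgue A") (use pos in \<open>auto simp: add_top simp flip: ennreal_plus\<close>)
  qed
  define c where "c = (f x / 2) powr m * r powr (- (n + \<sigma> * m))"
  have c: "0 \<le> c" by (simp add: c_def)
  have "ennreal (c * V) = ennreal c * ennreal V" using c by (simp add: ennreal_mult')
  also have "\<dots> \<le> ennreal c * emeasure lebesgue A"
    using mA by (intro mult_left_mono) auto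
  also have "\<dots> = (\<integral>\<^sup>+y. ennreal c * indicator A y \<partial>lebesgue)"
    using A by (simp add: nn_integral_cmult_indicator)
  also have "\<dots> \<le> local_gag \<sigma> m f x"
    unfolding local_gag_def
  proof (rule nn_integral_mono)
    fix y
    show "ennreal c * indicator A y
      \<le> ennreal (\<bar>f x - f y\<bar> powr m / dist x y powr (real DIM('a) + \<sigma> * m))"
    proof (cases "y \<in> A")
      case True
      then have y: "dist x y < r" "f y < f x / 2" by (auto simp: A_def S_def)
      then have "x \<noteq> y" using pos by auto
      have nn: "- (n + \<sigma> * m) \<le> 0" using \<sigma>m n mult_nonneg_nonneg[of \<sigma> m] by linarith
      then have "c \<le> \<bar>f x - f y\<bar> powr m * dist x y powr (- (n + \<sigma> * m))"
        unfolding c_def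
      proof (intro mult_mono)
        show "(f x / 2) powr m \<le> \<bar>f x - f y\<bar> powr m" using y pos \<sigma>m by (intro powr_mono2) auto
        show "r powr (- (n + \<sigma> * m)) \<le> dist x y powr (- (n + \<sigma> * m))"
          using nn \<open>x \<noteq> y\<close> y by (intro powr_mono2') auto
      qed auto
      then show ?thesis using True by (simp add: divide_powr n_def ennreal_leI)
    qed simp
  qed
  finally have main: "ennreal (c * V) \<le> local_gag \<sigma> m f x" .
  define K where "K = sob_const TYPE('a) \<sigma> m * V powr (\<sigma> * m / n)"
  have K: "0 \<le> K" using sob_const_pos[where ?'a = 'a, of \<sigma> m] by (simp add: K_def)
  have "f x powr m = K * (c * V)"
  proof -
    have "r powr (- (n + \<sigma> * m)) = (2 * V / \<omega>) powr (- (1 + \<sigma> * m / n))"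
    proof -
      have "1 / n * (- (n + \<sigma> * m)) = - (1 + \<sigma> * m / n)" using n by (simp add: field_simps)
      then show ?thesis unfolding r_def powr_powr by simp
    qed
    also have "\<dots> = (2 / \<omega>) powr (- (1 + \<sigma> * m / n)) * V powr (- (1 + \<sigma> * m / n))"
      using powr_mult[of "2 / \<omega>" V] by simp
    finally have r1: "r powr (- (n + \<sigma> * m)) = \<dots>" .
    have f1: "(f x / 2) powr m = f x powr m / 2 powr m"
      using pos by (simp add: powr_divide)
    have "(2 / \<omega>) powr (1 + \<sigma> * m / n) * (2 / \<omega>) powr (- (1 + \<sigma> * m / n)) = 1"
      using \<omega> by (simp flip: powr_add)
    moreover have "V powr (\<sigma> * m / n) * V powr (- (1 + \<sigma> * m / n)) * V = 1"
    proof -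
      have "V powr (\<sigma> * m / n) * V powr (- (1 + \<sigma> * m / n)) = V powr (- 1)"
        by (simp flip: powr_add)
      then show ?thesis using pos by (simp add: powr_minus)
    qed
    moreover have "K * (c * V) = f x powr m * (2 powr m / 2 powr m) *
       ((2 / \<omega>) powr (1 + \<sigma> * m / n) * (2 / \<omega>) powr (- (1 + \<sigma> * m / n))) *
       (V powr (\<sigma> * m / n) * V powr (- (1 + \<sigma> * m / n)) * V)"
      unfolding K_def c_def sob_const_def r1 f1 by (simp add: n_def \<omega>_def)
    ultimately show ?thesis by simp
  qed
  then have "ennreal (f x powr m) = ennreal K * ennreal (c * V)"
    using K by (simp add: ennreal_mult')
  also have "\<dots> \<le> ennreal K * local_gag \<sigma> m f x"
    using main by (intro mult_left_mono) auto
  finally show ?thesis by (simp add: K_def n_def)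
qed

lemma measurable_local_gag [measurable]:
  fixes f :: "'a::euclidean_space \<Rightarrow> real"
  assumes f: "f \<in> borel_measurable lebesgue"
  shows "local_gag \<sigma> m f \<in> borel_measurable lebesgue"
proof -
  note [measurable] = f
  have "(\<lambda>z. ennreal (\<bar>f (fst z) - f (snd z)\<bar> powr m
      / dist (fst z) (snd z) powr (real DIM('a) + \<sigma> * m))) \<in> borel_measurable lebesgue"
    by measurable
  from lebesgue_Tonelli(4)[OF this] show ?thesis by (simp add: local_gag_def[abs_def])
qed

lemma Faber_Krahn:
  fixes f :: "'a::euclidean_space \<Rightarrow> real"
  assumes f[measurable]: "f \<in> borel_measurable lebesgue" and f0: "\<And>x. 0 \<le> f x"
    and \<sigma>m: "0 < \<sigma>" "1 \<le> m"
    and V: "emeasure lebesgue {x. 0 < f x} \<le> ennreal V"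
  shows "(\<integral>\<^sup>+x. ennreal (f x powr m) \<partial>lebesgue)
    \<le> ennreal (sob_const TYPE('a) \<sigma> m * V powr (\<sigma> * m / real DIM('a))) * gagliardo \<sigma> m f"
proof -
  note S = superlevel_sets_lebesgue(1)[OF f, of 0]
  show ?thesis
  proof (cases "0 < V")
    \<comment> \<open>A nonpositive \<open>V\<close> forces \<open>f\<close> to vanish almost
      everywhere; the pointwise estimate is available for positive \<open>V\<close>.\<close>
    case False
    then have "{x. 0 < f x} \<in> null_sets lebesgue"
      using V S by (auto simp: null_sets_def ennreal_neg)
    then have "AE x in lebesgue. ennreal (f x powr m) = 0"
      by (rule AE_I') (use f0 in \<open>auto simp: less_le\<close>)
    then have "(\<integral>\<^sup>+x. ennreal (f x powr m) \<partial>lebesgue) = (\<integral>\<^sup>+x. 0 \<partial>(lebesgue :: 'a measure))"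
      by (rule nn_integral_cong_AE)
    then show ?thesis by simp
  next
    case True
    have "ennreal (f x powr m)
      \<le> ennreal (sob_const TYPE('a) \<sigma> m * V powr (\<sigma> * m / real DIM('a))) * local_gag \<sigma> m f x" for x
    proof (cases "0 < f x")
      case x: True
      have "emeasure lebesgue {y. f x / 2 \<le> f y} \<le> emeasure lebesgue {x. 0 < f x}"
        using x S by (intro emeasure_mono) auto
      then show ?thesis using V x True \<sigma>m f by (intro powr_le_local_gag) auto
    next
      case False
      then have "f x = 0" using f0[of x] by simp
      then show ?thesis by simp
    qed
    then have "(\<integral>\<^sup>+x. ennreal (f x powr m) \<partial>lebesgue)
      \<le> (\<integral>\<^sup>+x. ennreal (sob_const TYPE('a) \<sigma> m * V powr (\<sigma> * m / real DIM('a))) * local_gag \<sigma> m f x \<partial>lebesgue)"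
      by (intro nn_integral_mono) auto
    then show ?thesis by (simp add: nn_integral_cmult gagliardo_eq)
  qed
qed

text \<open>Let \<open>N\<close> be the integral of \<open>f powr r\<close>. Chebyshev bounds the
  set where \<open>f \<ge> f x / 2\<close> by \<open>N * (2 / f x) powr r\<close>. Because
  \<open>r * \<tau> = r - m\<close>, inserting this into the pointwise estimate turns
  \<open>f powr m\<close> into \<open>f powr r\<close> and produces \<open>N powr \<tau>\<close>;
  integration gives \<open>N \<le> N powr \<tau> * (K * E)\<close>. Dividing by
  \<open>N powr \<tau>\<close> requires \<open>N\<close> to be finite, which the bound
  \<open>B\<close> guarantees.\<close>

lemma Sobolev_bounded:
  fixes f :: "'a::euclidean_space \<Rightarrow> real"
  assumes f[measurable]: "f \<in> borel_measurable lebesgue" and f0: "\<And>x. 0 \<le> f x" and fB: "\<And>x. f x \<le> B"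
    and \<sigma>m: "0 < \<sigma>" "1 \<le> m"
    and V: "0 < V" "emeasure lebesgue {x. 0 < f x} \<le> ennreal V"
    and r: "m < r" "real DIM('a) / m - real DIM('a) / r \<le> \<sigma>"
    and E: "gagliardo \<sigma> m f \<le> ennreal E" "0 \<le> E"
  defines "K \<equiv> sob_const TYPE('a) \<sigma> m * V powr (\<sigma> * m / real DIM('a) - (1 - m / r)) * 2 powr (r - m)"
  shows "(\<integral>\<^sup>+x. ennreal (f x powr r) \<partial>lebesgue) \<le> ennreal ((K * E) powr (r / m))"
proof -
  define n where "n = real DIM('a)"
  define \<tau> where "\<tau> = 1 - m / r"
  have n: "0 < n" by (simp add: n_def)
  have mr: "0 < m" "0 < r" using \<sigma>m r by auto
  have \<tau>: "0 < \<tau>" "\<tau> \<le> \<sigma> * m / n"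
  proof -
    show "0 < \<tau>" using mr r by (simp add: \<tau>_def)
    have "m / n * (n / m - n / r) \<le> m / n * \<sigma>"
      using r(2) mr n by (intro mult_left_mono) (auto simp: n_def)
    moreover have "m / n * (n / m - n / r) = \<tau>"
      using mr n by (simp add: \<tau>_def field_simps)
    ultimately show "\<tau> \<le> \<sigma> * m / n" by (simp add: mult_ac)
  qed
  have K: "0 < K"
    unfolding K_def using V sob_const_pos[where ?'a = 'a, of \<sigma> m] by simp
  have B: "0 \<le> B" using f0 fB order_trans by blast
  note S = superlevel_sets_lebesgue(1,2)[OF f]
  define N where "N = enn2real (\<integral>\<^sup>+x. ennreal (f x powr r) \<partial>lebesgue)"
  have fin: "(\<integral>\<^sup>+x. ennreal (f x powr r) \<partial>lebesgue) < \<infinity>"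
  proof -
    have "(\<integral>\<^sup>+x. ennreal (f x powr r) \<partial>lebesgue)
        \<le> (\<integral>\<^sup>+x. ennreal (B powr r) * indicator {x. 0 < f x} x \<partial>lebesgue)"
    proof (rule nn_integral_mono)
      fix x show "ennreal (f x powr r) \<le> ennreal (B powr r) * indicator {x. 0 < f x} x"
      proof (cases "0 < f x")
        case True then show ?thesis using fB f0 mr by (simp add: ennreal_leI powr_mono2)
      next
        case False then have "f x = 0" using f0[of x] by simp
        then show ?thesis by simp
      qed
    qed
    also have "\<dots> = ennreal (B powr r) * emeasure lebesgue {x. 0 < f x}"
      using S by (simp add: nn_integral_cmult_indicator)
    also have "\<dots> < \<infinity>" using V
      by (metis ennreal_less_top ennreal_mult_less_top infinity_ennreal_def le_less_trans)
    finally show ?thesis .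
  qed
  have N: "(\<integral>\<^sup>+x. ennreal (f x powr r) \<partial>lebesgue) = ennreal N" "0 \<le> N"
    using fin by (auto simp: N_def)
  show ?thesis
  proof (cases "N = 0")
    case True then show ?thesis using N by simp
  next
    case False
    then have Np: "0 < N" using N by simp
    have pt: "ennreal (f x powr r) \<le> ennreal (K * N powr \<tau>) * local_gag \<sigma> m f x" for x
    proof (cases "0 < f x")
      case False
      then have "f x = 0" using f0[of x] by simp
      then show ?thesis by simp
    next
      case x: True
      \<comment> \<open>Both bounds are used: Chebyshev for the exponent \<tau>, and
        \<open>V\<close> for the surplus \<open>\<sigma> * m / n - \<tau>\<close>, which is
        nonnegative by the hypothesis on \<open>r\<close>.\<close>
      define W where "W = min V (N * (2 / f x) powr r)"
      have W: "0 < W" using V Np x by (simp add: W_def)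
      have "emeasure lebesgue {y. f x / 2 \<le> f y} \<le> ennreal (N * (2 / f x) powr r)"
      proof -
        have "ennreal ((f x / 2) powr r) * emeasure lebesgue {y. f x / 2 \<le> f y}
            = (\<integral>\<^sup>+y. ennreal ((f x / 2) powr r) * indicator {y. f x / 2 \<le> f y} y \<partial>lebesgue)"
          by (rule nn_integral_cmult_indicator[OF S(2), symmetric])
        also have "\<dots> \<le> (\<integral>\<^sup>+y. ennreal (f y powr r) \<partial>lebesgue)"
          using x mr by (intro nn_integral_mono) (auto split: split_indicator intro!: ennreal_leI powr_mono2)
        finally have *: "ennreal ((f x / 2) powr r) * emeasure lebesgue {y. f x / 2 \<le> f y} \<le> ennreal N"
          using N by simp
        have "emeasure lebesgue {y. f x / 2 \<le> f y}
            = ennreal ((2 / f x) powr r) * (ennreal ((f x / 2) powr r) * emeasure lebesgue {y. f x / 2 \<le> f y})"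
        proof -
          have "(2 / f x) powr r * (f x / 2) powr r = 1"
            using x by (simp flip: powr_mult)
          then have "ennreal ((2 / f x) powr r) * ennreal ((f x / 2) powr r) = 1"
            by (simp flip: ennreal_mult')
          then show ?thesis by (simp flip: mult.assoc)
        qed
        also have "\<dots> \<le> ennreal ((2 / f x) powr r) * ennreal N"
          using * by (intro mult_left_mono) auto
        finally show ?thesis using N by (simp add: ennreal_mult' mult.commute)
      qed
      moreover have "emeasure lebesgue {y. f x / 2 \<le> f y} \<le> emeasure lebesgue {x. 0 < f x}"
        using x S by (intro emeasure_mono) auto
      ultimately have "emeasure lebesgue {y. f x / 2 \<le> f y} \<le> ennreal W"
        using V by (auto simp: W_def min_def)
      from powr_le_local_gag[OF f x W \<sigma>m this]
      have 1: "ennreal (f x powr m) \<le> ennreal (sob_const TYPE('a) \<sigma> m * W powr (\<sigma> * m / n)) * local_gag \<sigma> m f x"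
        by (simp add: n_def)
      have rt: "r * \<tau> = r - m" using mr by (simp add: \<tau>_def field_simps)
      have 2: "W powr (\<sigma> * m / n) \<le> V powr (\<sigma> * m / n - \<tau>) * (N powr \<tau> * 2 powr (r - m) * f x powr (m - r))"
      proof -
        have "W powr (\<sigma> * m / n) = W powr (\<sigma> * m / n - \<tau>) * W powr \<tau>"
          by (simp flip: powr_add)
        also have "\<dots> \<le> V powr (\<sigma> * m / n - \<tau>) * (N * (2 / f x) powr r) powr \<tau>"
          using W V \<tau> by (intro mult_mono powr_mono2) (auto simp: W_def)
        also have "(N * (2 / f x) powr r) powr \<tau> = N powr \<tau> * 2 powr (r - m) * f x powr (m - r)"
        proof -
          have e: "((2 / f x) powr r) powr \<tau> = (2 / f x) powr (r - m)"
            by (simp only: powr_powr rt)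
          show ?thesis unfolding powr_mult e unfolding powr_divide divide_powr by simp
        qed
        finally show ?thesis .
      qed
      have "f x powr r = f x powr (r - m) * f x powr m" using x by (simp flip: powr_add)
      then have "ennreal (f x powr r) = ennreal (f x powr (r - m)) * ennreal (f x powr m)"
        by (simp add: ennreal_mult')
      also have "\<dots> \<le> ennreal (f x powr (r - m)) *
          (ennreal (sob_const TYPE('a) \<sigma> m * W powr (\<sigma> * m / n)) * local_gag \<sigma> m f x)"
        using 1 by (intro mult_left_mono) auto
      also have "\<dots> = ennreal (f x powr (r - m) * (sob_const TYPE('a) \<sigma> m * W powr (\<sigma> * m / n))) * local_gag \<sigma> m f x"
        by (simp add: ennreal_mult' mult.assoc)
      also have "\<dots> \<le> ennreal (K * N powr \<tau>) * local_gag \<sigma> m f x"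
      proof (intro mult_right_mono ennreal_leI)
        have "f x powr (r - m) * (sob_const TYPE('a) \<sigma> m * W powr (\<sigma> * m / n)) \<le>
          f x powr (r - m) * (sob_const TYPE('a) \<sigma> m *
            (V powr (\<sigma> * m / n - \<tau>) * (N powr \<tau> * 2 powr (r - m) * f x powr (m - r))))"
          using 2 less_imp_le[OF sob_const_pos[where ?'a = 'a, of \<sigma> m]] by (intro mult_left_mono) auto
        also have "\<dots> = (K * N powr \<tau>) * (f x powr (r - m) * f x powr (m - r))"
          by (simp add: K_def n_def \<tau>_def mult_ac)
        also have "f x powr (r - m) * f x powr (m - r) = 1"
          using x by (simp flip: powr_add)
        finally show "f x powr (r - m) * (sob_const TYPE('a) \<sigma> m * W powr (\<sigma> * m / n)) \<le> K * N powr \<tau>"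
          by simp
      qed auto
      finally show ?thesis .
    qed
    have "ennreal N \<le> (\<integral>\<^sup>+x. ennreal (K * N powr \<tau>) * local_gag \<sigma> m f x \<partial>lebesgue)"
      unfolding N(1)[symmetric] by (intro nn_integral_mono pt)
    also have "\<dots> = ennreal (K * N powr \<tau>) * gagliardo \<sigma> m f"
      by (simp add: nn_integral_cmult gagliardo_eq)
    also have "\<dots> \<le> ennreal (K * N powr \<tau>) * ennreal E"
      using E by (intro mult_left_mono) auto
    also have "\<dots> = ennreal (K * N powr \<tau> * E)"
      using K by (simp add: ennreal_mult')
    finally have le: "N \<le> N powr \<tau> * (K * E)"
      using K E by (simp add: ennreal_le_iff mult_ac)
    have "N powr \<tau> * N powr (m / r) = N" using Np by (simp add: \<tau>_def flip: powr_add)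
    then have "N powr \<tau> * N powr (m / r) \<le> N powr \<tau> * (K * E)" using le by simp
    then have "N powr (m / r) \<le> K * E" using Np by simp
    then have "(N powr (m / r)) powr (r / m) \<le> (K * E) powr (r / m)"
      using mr by (intro powr_mono2) auto
    also have "(N powr (m / r)) powr (r / m) = N" using mr Np by (simp add: powr_powr)
    finally show ?thesis using N by (simp add: ennreal_leI)
  qed
qed

lemma gagliardo_min_le:
  "gagliardo \<sigma> m (\<lambda>x. min (f x) c) \<le> gagliardo \<sigma> m f" if "0 \<le> m"
  unfolding gagliardo_def using that
  by (intro nn_integral_mono ennreal_leI divide_right_mono powr_mono2) (auto simp: min_def)

text \<open>Truncation at height \<open>k\<close> does not increase the Gagliardo integral, and the
  bound for truncated functions is independent of \<open>k\<close>; monotone convergence does the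
  rest.\<close>

lemma Sobolev:
  fixes f :: "'a::euclidean_space \<Rightarrow> real"
  assumes f[measurable]: "f \<in> borel_measurable lebesgue" and f0: "\<And>x. 0 \<le> f x"
    and \<sigma>m: "0 < \<sigma>" "1 \<le> m"
    and V: "0 < V" "emeasure lebesgue {x. 0 < f x} \<le> ennreal V"
    and r: "m < r" "real DIM('a) / m - real DIM('a) / r \<le> \<sigma>"
    and E: "gagliardo \<sigma> m f \<le> ennreal E" "0 \<le> E"
  defines "K \<equiv> sob_const TYPE('a) \<sigma> m * V powr (\<sigma> * m / real DIM('a) - (1 - m / r)) * 2 powr (r - m)"
  shows "(\<integral>\<^sup>+x. ennreal (f x powr r) \<partial>lebesgue) \<le> ennreal ((K * E) powr (r / m))"
proof -
  have *: "(\<integral>\<^sup>+x. ennreal (min (f x) (real k) powr r) \<partial>lebesgue) \<le> ennreal ((K * E) powr (r / m))" for k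
    unfolding K_def
  proof (rule Sobolev_bounded[where B = "real k"])
    have "emeasure lebesgue {x. 0 < min (f x) (real k)} \<le> emeasure lebesgue {x. 0 < f x}"
      by (intro emeasure_mono superlevel_sets_lebesgue(1)[OF f]) auto
    then show "emeasure lebesgue {x. 0 < min (f x) (real k)} \<le> ennreal V" using V by auto
    show "gagliardo \<sigma> m (\<lambda>x. min (f x) (real k)) \<le> ennreal E"
      using gagliardo_min_le[of m \<sigma> f "real k"] \<sigma>m E by auto
  qed (use assms in auto)
  have "(\<integral>\<^sup>+x. ennreal (f x powr r) \<partial>lebesgue)
    = (\<integral>\<^sup>+x. (SUP k. ennreal (min (f x) (real k) powr r)) \<partial>lebesgue)"
  proof (rule nn_integral_cong)
    fix x
    show "ennreal (f x powr r) = (SUP k. ennreal (min (f x) (real k) powr r))"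
    proof (rule antisym)
      obtain k where "f x \<le> real k" using real_arch_simple by blast
      then have "ennreal (f x powr r) = ennreal (min (f x) (real k) powr r)" by (simp add: min_absorb1)
      then show "ennreal (f x powr r) \<le> (SUP k. ennreal (min (f x) (real k) powr r))"
        using SUP_upper[of k UNIV "\<lambda>k. ennreal (min (f x) (real k) powr r)"] by simp
      show "(SUP k. ennreal (min (f x) (real k) powr r)) \<le> ennreal (f x powr r)"
        using f0 r \<sigma>m by (intro SUP_least ennreal_leI powr_mono2) auto
    qed
  qed
  also have "\<dots> = (SUP k. \<integral>\<^sup>+x. ennreal (min (f x) (real k) powr r) \<partial>lebesgue)"
    using f0 r \<sigma>m by (intro nn_integral_monotone_convergence_SUP)
      (auto simp: incseq_def le_fun_def intro!: ennreal_leI powr_mono2)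
  also have "\<dots> \<le> ennreal ((K * E) powr (r / m))" by (intro SUP_least *)
  finally show ?thesis .
qed

text \<open>The threshold \<open>y\<close> solves \<open>C * y powr \<kappa> = e\<close> with
  \<open>e = b powr (- 1 / \<kappa>)\<close>. Then \<open>Y j \<le> y * e ^ j\<close> reproduces
  itself: \<open>(e ^ j) powr \<kappa>\<close> cancels \<open>b ^ j\<close>, and the remaining
  factor is exactly \<open>e\<close>.\<close>

lemma fast_geometric_convergence:
  fixes Y :: "nat \<Rightarrow> real"
  assumes Y0: "\<And>j. 0 \<le> Y j" and C: "0 < C" and b: "1 < b" and \<kappa>: "0 < \<kappa>"
    and step: "\<And>j. Y (Suc j) \<le> C * b ^ j * Y j powr (1 + \<kappa>)"
    and small: "Y 0 \<le> C powr (- 1 / \<kappa>) * b powr (- 1 / \<kappa>\<^sup>2)"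
  shows "Y \<longlonglongrightarrow> 0"
proof -
  define y where "y = C powr (- 1 / \<kappa>) * b powr (- 1 / \<kappa>\<^sup>2)"
  define e where "e = b powr (- 1 / \<kappa>)"
  have y: "0 < y" using C b by (simp add: y_def)
  have e: "0 < e" "e < 1" using b \<kappa> powr_less_mono[of "- 1 / \<kappa>" 0 b] by (auto simp: e_def)
  have yk: "C * y powr \<kappa> = e"
  proof -
    have "y powr \<kappa> = C powr (- 1) * b powr (- 1 / \<kappa>)"
      using C b \<kappa> by (simp add: y_def powr_mult powr_powr power2_eq_square)
    then show ?thesis using C by (simp add: e_def powr_minus)
  qed
  have bound: "Y j \<le> y * e ^ j" for j
  proof (induction j)
    case 0 then show ?case using small by (simp add: y_def)
  next
    case (Suc j)
    have ej: "(e ^ j) powr \<kappa> * b ^ j = 1"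
    proof -
      have "(e ^ j) powr \<kappa> = (e powr \<kappa>) ^ j" using e by (simp add: power_powr_swap)
      also have "e powr \<kappa> = 1 / b" unfolding e_def powr_powr using b \<kappa> by (simp add: powr_minus divide_inverse)
      finally show ?thesis using b by (simp add: field_simps)
    qed
    have "Y (Suc j) \<le> C * b ^ j * Y j powr (1 + \<kappa>)" by (rule step)
    also have "\<dots> \<le> C * b ^ j * (y * e ^ j) powr (1 + \<kappa>)"
      using Suc Y0 C b \<kappa> by (intro mult_left_mono powr_mono2) auto
    also have "\<dots> = C * b ^ j * (y * e ^ j) * (y powr \<kappa> * (e ^ j) powr \<kappa>)"
      using y e by (simp add: powr_add powr_mult)
    also have "\<dots> = (C * y powr \<kappa>) * (y * e ^ j) * ((e ^ j) powr \<kappa> * b ^ j)"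
      by (simp add: mult_ac)
    also have "\<dots> = y * e ^ Suc j" unfolding yk ej by simp
    finally show ?case .
  qed
  have "(\<lambda>j. y * e ^ j) \<longlonglongrightarrow> y * 0" using e by (intro tendsto_mult tendsto_const LIMSEQ_power_zero) auto
  then show ?thesis
    using tendsto_sandwich[of "\<lambda>_. 0" Y sequentially "\<lambda>j. y * e ^ j" 0] Y0 bound by auto
qed

section \<open>The Caccioppoli inequality\<close>

locale double_phase =
  fixes s t p q \<Lambda> :: real and \<Omega> :: "'a::euclidean_space set"
    and Ksp Ktq a :: "'a \<times> 'a \<Rightarrow> real"
  assumes s: "0 < s" "s < 1" and t: "0 < t" "t < 1" and p: "1 < p" and pq: "p \<le> q"
    and \<Lambda>: "1 \<le> \<Lambda>" and open_\<Omega>: "open \<Omega>"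
    and Ksp: "kernel_cond s p \<Lambda> Ksp" and Ktq: "kernel_cond t q \<Lambda> Ktq"
    and a: "coefficient_cond \<Omega> a"
begin

lemma exponent_bounds: "s * p \<le> q" "t * q \<le> q" "0 \<le> s * p" "0 \<le> t * q"
proof -
  have "s * p \<le> 1 * p" "t * q \<le> 1 * q" using s t p pq by (auto intro!: mult_right_mono)
  then show "s * p \<le> q" "t * q \<le> q" using pq by auto
  show "0 \<le> s * p" "0 \<le> t * q" using s t p pq by auto
qed

text \<open>Since \<open>0 powr c = 0\<close>, multiplying by the model kernel agrees with the
  quotient in the definitions, also on the diagonal.\<close>

definition kp :: "'a \<times> 'a \<Rightarrow> real" where
  "kp z = dist (fst z) (snd z) powr (- (real DIM('a) + s * p))"

definition kq :: "'a \<times> 'a \<Rightarrow> real" where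
  "kq z = dist (fst z) (snd z) powr (- (real DIM('a) + t * q))"

lemma kp_nonneg [simp]: "0 \<le> kp z" and kq_nonneg [simp]: "0 \<le> kq z"
  by (simp_all add: kp_def kq_def)

lemma a_nonneg [simp]: "0 \<le> a z"
  using a unfolding coefficient_cond_def by blast

lemma kernels_measurable [measurable]:
  "Ksp \<in> borel_measurable lebesgue" "Ktq \<in> borel_measurable lebesgue" "a \<in> borel_measurable lebesgue"
  "kp \<in> borel_measurable lebesgue" "kq \<in> borel_measurable lebesgue"
  using a Ksp Ktq by (simp_all add: coefficient_cond_def kernel_cond_def kp_def[abs_def] kq_def[abs_def])

lemma Ksp_bounds:
  "fst z \<noteq> snd z \<Longrightarrow> kp z / \<Lambda> \<le> Ksp z" "fst z \<noteq> snd z \<Longrightarrow> Ksp z \<le> \<Lambda> * kp z"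
  using Ksp by (cases z; simp add: kernel_cond_def kp_def divide_inverse mult.commute)+

lemma Ktq_bounds:
  "fst z \<noteq> snd z \<Longrightarrow> kq z / \<Lambda> \<le> Ktq z" "fst z \<noteq> snd z \<Longrightarrow> Ktq z \<le> \<Lambda> * kq z"
  using Ktq by (cases z; simp add: kernel_cond_def kq_def divide_inverse mult.commute)+

definition dens :: "('a \<Rightarrow> real) \<Rightarrow> 'a \<times> 'a \<Rightarrow> real" where
  "dens u z = \<bar>u (fst z) - u (snd z)\<bar> powr p * Ksp z + a z * \<bar>u (fst z) - u (snd z)\<bar> powr q * Ktq z"

definition gdens :: "('a \<Rightarrow> real) \<Rightarrow> 'a \<times> 'a \<Rightarrow> real" where
  "gdens u z = \<bar>u (fst z) - u (snd z)\<bar> powr p * kp z + a z * (\<bar>u (fst z) - u (snd z)\<bar> powr q * kq z)"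

lemma measurable_dens [measurable]:
  assumes [measurable]: "u \<in> borel_measurable lebesgue"
  shows "dens u \<in> borel_measurable lebesgue" "gdens u \<in> borel_measurable lebesgue"
  unfolding dens_def[abs_def] gdens_def[abs_def] by measurable

lemma gdens_nonneg: "0 \<le> gdens u z"
  by (simp add: gdens_def)

lemma dens_gdens: "dens u z \<le> \<Lambda> * gdens u z" "gdens u z \<le> \<Lambda> * dens u z" "0 \<le> dens u z"
proof -
  have "dens u z \<le> \<Lambda> * gdens u z \<and> gdens u z \<le> \<Lambda> * dens u z"
  proof (cases "fst z = snd z")
    case True then show ?thesis by (simp add: dens_def gdens_def)
  next
    case False
    let ?P = "\<bar>u (fst z) - u (snd z)\<bar> powr p" and ?Q = "a z * \<bar>u (fst z) - u (snd z)\<bar> powr q"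
    have K: "kp z \<le> \<Lambda> * Ksp z" "kq z \<le> \<Lambda> * Ktq z" "Ksp z \<le> \<Lambda> * kp z" "Ktq z \<le> \<Lambda> * kq z"
      using Ksp_bounds[OF False] Ktq_bounds[OF False] \<Lambda> by (simp_all add: field_simps)
    have "?P * Ksp z + ?Q * Ktq z \<le> ?P * (\<Lambda> * kp z) + ?Q * (\<Lambda> * kq z)"
      using K by (intro add_mono mult_left_mono) auto
    moreover have "?P * kp z + ?Q * kq z \<le> ?P * (\<Lambda> * Ksp z) + ?Q * (\<Lambda> * Ktq z)"
      using K by (intro add_mono mult_left_mono) auto
    ultimately show ?thesis by (simp add: dens_def gdens_def algebra_simps)
  qed
  then show "dens u z \<le> \<Lambda> * gdens u z" "gdens u z \<le> \<Lambda> * dens u z" by auto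
  then show "0 \<le> dens u z" using gdens_nonneg[of u z] \<Lambda>
    by (metis dual_order.trans zero_le_mult_iff not_one_le_zero)
qed

lemma energy_eq: "energy p q Ksp Ktq a u \<Omega> = (\<integral>\<^sup>+z. ennreal (dens u z) * indicator (C_dom \<Omega>) z \<partial>lebesgue)"
  unfolding energy_def by (intro nn_integral_cong) (auto simp: dens_def)

lemma A_space_eq:
  "u \<in> A_space s t p q a \<Omega> \<longleftrightarrow> u \<in> borel_measurable lebesgue \<and>
     (\<integral>\<^sup>+x\<in>\<Omega>. ennreal (\<bar>u x\<bar> powr p) \<partial>lebesgue) < \<infinity> \<and>
     (\<integral>\<^sup>+z. ennreal (gdens u z) * indicator (C_dom \<Omega>) z \<partial>lebesgue) < \<infinity>"
proof -
  have "(\<integral>\<^sup>+(x, y)\<in>C_dom \<Omega>. ennreal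
         (\<bar>u x - u y\<bar> powr p / dist x y powr (real DIM('a) + s * p)
          + a (x, y) * (\<bar>u x - u y\<bar> powr q / dist x y powr (real DIM('a) + t * q)))
       \<partial>lebesgue) = (\<integral>\<^sup>+z. ennreal (gdens u z) * indicator (C_dom \<Omega>) z \<partial>lebesgue)"
    by (intro nn_integral_cong) (auto simp: gdens_def divide_powr kp_def kq_def)
  then show ?thesis by (simp add: A_space_def)
qed

lemma C_dom_measurable [measurable]: "C_dom \<Omega> \<in> sets lebesgue"
proof -
  have "open (C_dom \<Omega>)"
    using open_\<Omega> unfolding C_dom_def by (intro open_Diff closed_Times) (auto simp: closed_def Compl_eq_Diff_UNIV[symmetric])
  then show ?thesis by auto
qed

lemma A_space_energy:
  "u \<in> A_space s t p q a \<Omega> \<longleftrightarrow> u \<in> borel_measurable lebesgue \<and>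
     (\<integral>\<^sup>+x\<in>\<Omega>. ennreal (\<bar>u x\<bar> powr p) \<partial>lebesgue) < \<infinity> \<and> energy p q Ksp Ktq a u \<Omega> < \<infinity>"
proof -
  have "(\<integral>\<^sup>+z. ennreal (gdens u z) * indicator (C_dom \<Omega>) z \<partial>lebesgue) < \<infinity> \<longleftrightarrow>
      (\<integral>\<^sup>+z. ennreal (dens u z) * indicator (C_dom \<Omega>) z \<partial>lebesgue) < \<infinity>"
    if [measurable]: "u \<in> borel_measurable lebesgue"
  proof -
    have *: "(\<integral>\<^sup>+z. ennreal (F z) * indicator (C_dom \<Omega>) z \<partial>lebesgue)
       \<le> ennreal \<Lambda> * (\<integral>\<^sup>+z. ennreal (G z) * indicator (C_dom \<Omega>) z \<partial>lebesgue)"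
      if FG: "\<And>z. F z \<le> \<Lambda> * G z" and [measurable]: "G \<in> borel_measurable lebesgue" for F G
    proof -
      have "(\<integral>\<^sup>+z. ennreal (F z) * indicator (C_dom \<Omega>) z \<partial>lebesgue)
         \<le> (\<integral>\<^sup>+z. ennreal \<Lambda> * (ennreal (G z) * indicator (C_dom \<Omega>) z) \<partial>lebesgue)"
        using FG \<Lambda> by (intro nn_integral_mono)
          (auto split: split_indicator simp: ennreal_leI simp flip: ennreal_mult')
      then show ?thesis by (simp add: nn_integral_cmult)
    qed
    show ?thesis
      using *[of "gdens u" "dens u"] *[of "dens u" "gdens u"] dens_gdens
      by (auto simp: ennreal_mult_less_top dest: le_less_trans[where z = \<infinity>])
  qed
  then show ?thesis unfolding A_space_eq energy_eq by blast
qed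

end

text \<open>The cutoff is supported in the ball of radius \<open>\<rho> - d\<close>; the shell of
  width \<open>d\<close> separates its support from the complement of \<open>B\<close>, where only
  tails are available.\<close>

locale cutoff = double_phase +
  fixes u :: "'a \<Rightarrow> real" and x0 :: 'a and \<rho> d k :: real and \<phi> :: "'a \<Rightarrow> real"
  assumes minimizer: "is_minimizer s t p q Ksp Ktq a \<Omega> u"
    and ball: "ball x0 \<rho> \<subseteq> \<Omega>" and d: "0 < d" "d < \<rho>" and k: "0 \<le> k"
    and \<phi>_meas [measurable]: "\<phi> \<in> borel_measurable lebesgue"
    and \<phi>: "\<And>x. 0 \<le> \<phi> x" "\<And>x. \<phi> x \<le> 1" "\<And>x. x \<notin> ball x0 (\<rho> - d) \<Longrightarrow> \<phi> x = 0"
begin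

definition w :: "'a \<Rightarrow> real" where "w x = max (u x - k) 0"
definition v :: "'a \<Rightarrow> real" where "v x = u x - \<phi> x powr q * w x"
definition f :: "'a \<Rightarrow> real" where "f x = \<phi> x powr q * w x"

abbreviation "B \<equiv> ball x0 \<rho>"
abbreviation "B' \<equiv> ball x0 (\<rho> - d)"

definition good :: "real \<Rightarrow> 'a \<times> 'a \<Rightarrow> real" where
  "good m z = indicator (B \<times> B) z *
     (max (\<phi> (fst z) powr q) (\<phi> (snd z) powr q) * \<bar>w (fst z) - w (snd z)\<bar> powr m)"

text \<open>One indicator per summand, rather than one for \<open>B \<times> B\<close>, so that
  pairs with a single point in \<open>B\<close> are included: the increment of \<open>f\<close>
  across the boundary of \<open>B\<close> is charged to this term in \<open>f_phase\<close>.\<close>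

definition near_err :: "real \<Rightarrow> 'a \<times> 'a \<Rightarrow> real" where
  "near_err m z = \<bar>\<phi> (fst z) - \<phi> (snd z)\<bar> powr m
     * (indicator B (fst z) * w (fst z) powr m + indicator B (snd z) * w (snd z) powr m)"

text \<open>Only pairs whose first point lies in the smaller ball. \<open>far_err'\<close> is the
  mirror image, and the two integrals agree because \<open>a\<close> is symmetric almost
  everywhere.\<close>

definition far_err :: "real \<Rightarrow> 'a \<times> 'a \<Rightarrow> real" where
  "far_err m z = indicator (B' \<times> (- B)) z * (w (fst z) * w (snd z) powr (m - 1))"

definition far_err' :: "real \<Rightarrow> 'a \<times> 'a \<Rightarrow> real" where
  "far_err' m z = indicator ((- B) \<times> B') z * (w (snd z) * w (fst z) powr (m - 1))"

lemma u_A: "u \<in> A_space s t p q a \<Omega>" and u_meas [measurable]: "u \<in> borel_measurable lebesgue"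
  using minimizer by (auto simp: is_minimizer_def A_space_def)

lemma wfv_meas [measurable]:
  "w \<in> borel_measurable lebesgue" "v \<in> borel_measurable lebesgue" "f \<in> borel_measurable lebesgue"
  unfolding w_def[abs_def] v_def[abs_def] f_def[abs_def] by measurable

lemma w_nonneg [simp]: "0 \<le> w x" by (simp add: w_def)
lemma f_nonneg [simp]: "0 \<le> f x" by (simp add: f_def)

lemma B_meas [measurable]: "B \<in> sets lebesgue" "B' \<in> sets lebesgue" "- B \<in> sets lebesgue"
  "B \<times> B \<in> sets lebesgue" "B' \<times> (- B) \<in> sets lebesgue" "(- B) \<times> B' \<in> sets lebesgue"
proof -
  show "B \<in> sets lebesgue" "B' \<in> sets lebesgue" "- B \<in> sets lebesgue" by auto
  show "B \<times> B \<in> sets lebesgue" by (auto simp: open_Times)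
  have "B' \<times> (- B) \<in> sets borel" "(- B) \<times> B' \<in> sets borel"
    by (auto intro!: borel_Times)
  then show "B' \<times> (- B) \<in> sets lebesgue" "(- B) \<times> B' \<in> sets lebesgue" by auto
qed

lemma err_meas [measurable]:
  "good m \<in> borel_measurable lebesgue" "near_err m \<in> borel_measurable lebesgue"
  "far_err m \<in> borel_measurable lebesgue" "far_err' m \<in> borel_measurable lebesgue"
  unfolding good_def[abs_def] near_err_def[abs_def] far_err_def[abs_def] far_err'_def[abs_def]
  by measurable

lemma err_nonneg [simp]:
  "0 \<le> good m z" "0 \<le> near_err m z" "0 \<le> far_err m z" "0 \<le> far_err' m z"
  by (auto simp: good_def near_err_def far_err_def far_err'_def le_max_iff_disj)

text \<open>One phase of the comparison, for a kernel value \<open>K\<close> comparable to \<kappa>.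
  On the diagonal nothing is known about \<open>K\<close>, but all increments vanish there. The
  constants \<open>q powr m\<close> and \<open>m\<close> are both enlarged to
  \<open>q powr q\<close>, which serves the two phases simultaneously.\<close>

lemma phase_inequality:
  assumes m: "1 < m" "m \<le> q" and K: "fst z \<noteq> snd z \<Longrightarrow> \<kappa> / \<Lambda> \<le> K" "fst z \<noteq> snd z \<Longrightarrow> K \<le> \<Lambda> * \<kappa>"
    and \<kappa>: "0 \<le> \<kappa>"
  shows "\<bar>v (fst z) - v (snd z)\<bar> powr m * K + good m z * \<kappa> / \<Lambda>
    \<le> \<bar>u (fst z) - u (snd z)\<bar> powr m * K
      + \<Lambda> * q powr q * ((indicator (B \<times> B) z * near_err m z + far_err m z + far_err' m z) * \<kappa>)"
    (is "?L \<le> ?R")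
proof (cases "fst z = snd z")
  case True
  have "0 \<le> \<Lambda> * q powr q * ((indicator (B \<times> B) z * near_err m z + far_err m z + far_err' m z) * \<kappa>)"
    using \<Lambda> \<kappa> by (intro mult_nonneg_nonneg add_nonneg_nonneg) auto
  then show ?thesis using True by (simp add: good_def)
next
  case False
  obtain x y where z: "z = (x, y)" by (cases z)
  have K1: "\<kappa> / \<Lambda> \<le> K" "K \<le> \<Lambda> * \<kappa>" using K False by auto
  have K0: "0 \<le> K" using K1 \<kappa> \<Lambda> by (meson divide_nonneg_nonneg order_trans zero_le_one)
  have qq: "q powr m \<le> q powr q" "m \<le> q powr q"
  proof -
    show "q powr m \<le> q powr q" using m by (intro powr_mono) auto
    have "q powr 1 \<le> q powr q" using m by (intro powr_mono) auto
    then show "m \<le> q powr q" using m by simp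
  qed
  have p1: "\<phi> x powr q \<le> 1" for x using \<phi> m by (intro powr_le1) auto
  have split: "v x - v y = (u x - k - \<phi> x powr q * max (u x - k) 0) - (u y - k - \<phi> y powr q * max (u y - k) 0)"
      "u x - u y = (u x - k) - (u y - k)" for x y
    by (simp_all add: v_def w_def)
  have aux: "X * K + G * \<kappa> / \<Lambda> \<le> U * K + \<Lambda> * q powr q * (E * \<kappa>)"
    if "X + G \<le> U + c * E" "0 \<le> G" "0 \<le> E" "c \<le> q powr q" for X G U c E :: real
  proof -
    have "X * K + G * \<kappa> / \<Lambda> \<le> X * K + G * K"
      using mult_left_mono[OF K1(1) that(2)] by simp
    also have "\<dots> \<le> (U + c * E) * K"
      using mult_right_mono[OF that(1) K0] by (simp add: distrib_right)
    also have "\<dots> \<le> U * K + (q powr q * E) * (\<Lambda> * \<kappa>)"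
      unfolding distrib_right using that K0 K1 \<kappa> \<Lambda>
      by (intro add_left_mono mult_mono mult_right_mono) auto
    finally show ?thesis by (simp add: mult_ac)
  qed
  consider (inside) "x \<in> B" "y \<in> B" | (xin) "x \<in> B" "y \<notin> B" | (yin) "x \<notin> B" "y \<in> B"
    | (out) "x \<notin> B" "y \<notin> B" by blast
  then show ?thesis
  proof cases
    case inside
    have "\<bar>v x - v y\<bar> powr m + max (\<phi> x powr q) (\<phi> y powr q) * \<bar>w x - w y\<bar> powr m
      \<le> \<bar>u x - u y\<bar> powr m + q powr m * (\<bar>\<phi> x - \<phi> y\<bar> powr m * (w x powr m + w y powr m))"
      unfolding split w_def using competitor_energy_inside[of m q "\<phi> y" "\<phi> x" "u x - k" "u y - k"] m \<phi>
      by (simp add: mult_ac)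
    then have "\<bar>v x - v y\<bar> powr m * K + good m z * \<kappa> / \<Lambda>
      \<le> \<bar>u x - u y\<bar> powr m * K + \<Lambda> * q powr q * (near_err m z * \<kappa>)"
      using inside qq by (intro aux) (auto simp: good_def near_err_def z le_max_iff_disj)
    moreover have "far_err m z = 0" "far_err' m z = 0" using inside by (auto simp: far_err_def far_err'_def z)
    ultimately show ?thesis using inside by (simp add: z)
  next
    case xin
    have y0: "\<phi> y = 0" using xin d \<phi>(3)[of y] by auto
    have g: "good m z = 0" "far_err' m z = 0" "indicator (B \<times> B) z = (0::real)"
      using xin d by (auto simp: good_def far_err'_def z)
    have "\<bar>v x - v y\<bar> powr m + 0 \<le> \<bar>u x - u y\<bar> powr m + m * far_err m z"
    proof (cases "x \<in> B'")
      case True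
      have "\<bar>v x - v y\<bar> powr m \<le> \<bar>u x - u y\<bar> powr m + m * w y powr (m - 1) * w x"
        unfolding split w_def using competitor_energy_outside[of m "\<phi> x powr q" "u x - k" "u y - k"] m p1[of x] y0
        by simp
      then show ?thesis using True xin by (simp add: far_err_def z mult_ac)
    next
      case False
      then have "\<phi> x = 0" using \<phi> by simp
      then show ?thesis using y0 m by (simp add: v_def)
    qed
    then have "\<bar>v x - v y\<bar> powr m * K + 0 * \<kappa> / \<Lambda> \<le> \<bar>u x - u y\<bar> powr m * K + \<Lambda> * q powr q * (far_err m z * \<kappa>)"
      using qq by (intro aux[where c = m]) auto
    then show ?thesis using g by (simp add: z)
  next
    case yin
    have x0: "\<phi> x = 0" using yin d \<phi>(3)[of x] by auto
    have g: "good m z = 0" "far_err m z = 0" "indicator (B \<times> B) z = (0::real)"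
      using yin d by (auto simp: good_def far_err_def z)
    have "\<bar>v x - v y\<bar> powr m + 0 \<le> \<bar>u x - u y\<bar> powr m + m * far_err' m z"
    proof (cases "y \<in> B'")
      case True
      have "\<bar>v y - v x\<bar> powr m \<le> \<bar>u y - u x\<bar> powr m + m * w x powr (m - 1) * w y"
        unfolding split w_def using competitor_energy_outside[of m "\<phi> y powr q" "u y - k" "u x - k"] m p1[of y] x0
        by simp
      then show ?thesis using True yin by (simp add: far_err'_def z mult_ac abs_minus_commute)
    next
      case False
      then have "\<phi> y = 0" using \<phi> by simp
      then show ?thesis using x0 m by (simp add: v_def)
    qed
    then have "\<bar>v x - v y\<bar> powr m * K + 0 * \<kappa> / \<Lambda> \<le> \<bar>u x - u y\<bar> powr m * K + \<Lambda> * q powr q * (far_err' m z * \<kappa>)"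
      using qq by (intro aux[where c = m]) auto
    then show ?thesis using g by (simp add: z)
  next
    case out
    have "\<phi> x = 0" "\<phi> y = 0" using out d \<phi>(3)[of x] \<phi>(3)[of y] by auto
    moreover have "good m z = 0" "far_err m z = 0" "far_err' m z = 0" "indicator (B \<times> B) z = (0::real)"
      using out d by (auto simp: good_def far_err_def far_err'_def z)
    ultimately show ?thesis by (simp add: z v_def)
  qed
qed

definition Pgood :: "'a \<times> 'a \<Rightarrow> real" where
  "Pgood z = good p z * kp z + a z * (good q z * kq z)"

definition Near :: "real \<Rightarrow> 'a \<times> 'a \<Rightarrow> real" where
  "Near a2 z = near_err p z * kp z + a2 * (near_err q z * kq z)"

definition Far :: "'a \<times> 'a \<Rightarrow> real" where
  "Far z = far_err p z * kp z + a z * (far_err q z * kq z)"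

definition Far' :: "'a \<times> 'a \<Rightarrow> real" where
  "Far' z = far_err' p z * kp z + a z * (far_err' q z * kq z)"

lemma densities_nonneg [simp]: "0 \<le> Pgood z" "0 \<le> a2 \<Longrightarrow> 0 \<le> Near a2 z" "0 \<le> Far z" "0 \<le> Far' z"
  by (auto simp: Pgood_def Near_def Far_def Far'_def)

lemma densities_measurable [measurable]: "Pgood \<in> borel_measurable lebesgue" "Near a2 \<in> borel_measurable lebesgue"
  "Far \<in> borel_measurable lebesgue" "Far' \<in> borel_measurable lebesgue"
  unfolding Pgood_def[abs_def] Near_def[abs_def] Far_def[abs_def] Far'_def[abs_def] by measurable

text \<open>The near error receives the constant coefficient \<open>a2\<close>, because it will be
  integrated in one variable against the cutoff kernel alone. The gain and the far errors keep
  \<open>a\<close>: the first is compared with a lower bound of \<open>a\<close>, the others with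
  the tail, which contains \<open>a\<close> itself.\<close>

lemma density_inequality:
  assumes a2: "\<And>x y. x \<in> B \<Longrightarrow> y \<in> B \<Longrightarrow> a (x, y) \<le> a2" "0 \<le> a2"
  shows "dens v z + Pgood z / \<Lambda> \<le> dens u z + \<Lambda> * q powr q * (Near a2 z + Far z + Far' z)"
proof -
  have 1: "\<bar>v (fst z) - v (snd z)\<bar> powr p * Ksp z + good p z * kp z / \<Lambda>
    \<le> \<bar>u (fst z) - u (snd z)\<bar> powr p * Ksp z
      + \<Lambda> * q powr q * ((indicator (B \<times> B) z * near_err p z + far_err p z + far_err' p z) * kp z)"
    using p pq Ksp_bounds by (intro phase_inequality) auto
  have 2: "\<bar>v (fst z) - v (snd z)\<bar> powr q * Ktq z + good q z * kq z / \<Lambda>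
    \<le> \<bar>u (fst z) - u (snd z)\<bar> powr q * Ktq z
      + \<Lambda> * q powr q * ((indicator (B \<times> B) z * near_err q z + far_err q z + far_err' q z) * kq z)"
    using p pq Ktq_bounds by (intro phase_inequality) auto
  have "dens v z + Pgood z / \<Lambda> \<le> dens u z
      + \<Lambda> * q powr q * ((indicator (B \<times> B) z * near_err p z + far_err p z + far_err' p z) * kp z)
      + a z * (\<Lambda> * q powr q * ((indicator (B \<times> B) z * near_err q z + far_err q z + far_err' q z) * kq z))"
    using add_mono[OF 1 mult_left_mono[OF 2 a_nonneg[of z]]]
    by (simp add: dens_def Pgood_def add_divide_distrib algebra_simps)
  also have "\<dots> = dens u z + \<Lambda> * q powr q * (indicator (B \<times> B) z * near_err p z * kp z
      + a z * indicator (B \<times> B) z * (near_err q z * kq z) + Far z + Far' z)"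
    by (simp add: Far_def Far'_def algebra_simps)
  also have "\<dots> \<le> dens u z + \<Lambda> * q powr q * (1 * near_err p z * kp z + a2 * (near_err q z * kq z) + Far z + Far' z)"
  proof (intro add_left_mono mult_left_mono add_right_mono add_mono mult_right_mono)
    show "a z * indicator (B \<times> B) z \<le> a2"
      using a2 by (cases z) (auto split: split_indicator)
  qed (use \<Lambda> in \<open>auto split: split_indicator\<close>)
  finally show ?thesis by (simp add: Near_def)
qed

text \<open>Above the level \<open>v\<close> lies between \<open>k\<close> and \<open>u\<close>, and
  \<open>k\<close> is nonnegative. This makes the competitor admissible as far as the integral of
  its \<open>p\<close>-th power is concerned.\<close>

lemma v_between: "\<bar>v x\<bar> \<le> \<bar>u x\<bar>"
proof (cases "u x \<le> k")
  case True then show ?thesis by (simp add: v_def w_def)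
next
  case False
  have "\<phi> x powr q \<le> 1" using \<phi> p pq by (intro powr_le1) auto
  then have "\<phi> x powr q * (u x - k) \<le> 1 * (u x - k)" "0 \<le> \<phi> x powr q * (u x - k)"
    using False by (intro mult_right_mono mult_nonneg_nonneg, auto)+
  moreover have "w x = u x - k" using False by (simp add: w_def)
  ultimately show ?thesis using False k unfolding v_def by (simp only: mult_1_left)
qed

text \<open>Minimality enters here. If the error integral is infinite the claim is trivial;
  otherwise the integrated comparison itself shows that \<open>v\<close> has finite energy, so
  \<open>v\<close> is admissible, and the finite energy of \<open>v\<close> can be cancelled on both
  sides.\<close>

lemma good_energy:
  assumes a2: "\<And>x y. x \<in> B \<Longrightarrow> y \<in> B \<Longrightarrow> a (x, y) \<le> a2" "0 \<le> a2"
  shows "(\<integral>\<^sup>+z. ennreal (Pgood z) \<partial>lebesgue)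
    \<le> ennreal (\<Lambda>\<^sup>2 * q powr q) * (\<integral>\<^sup>+z. ennreal (Near a2 z + Far z + Far' z) \<partial>lebesgue)"
proof -
  let ?N = "\<integral>\<^sup>+z. ennreal (\<Lambda> * q powr q * (Near a2 z + Far z + Far' z)) \<partial>lebesgue"
  let ?P = "\<integral>\<^sup>+z. ennreal (Pgood z / \<Lambda>) \<partial>lebesgue"
  \<comment> \<open>The energies live on \<open>C_dom \<Omega>\<close>, the gain and the errors on
    the whole space; outside \<open>C_dom \<Omega>\<close> the gain vanishes, so the comparison
    extends.\<close>
  have P0: "Pgood z = 0" if "z \<notin> C_dom \<Omega>" for z
    using that ball by (cases z) (auto simp: Pgood_def good_def C_dom_def split: split_indicator)
  have nn: "0 \<le> \<Lambda> * q powr q * (Near a2 z + Far z + Far' z)" for z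
    using \<Lambda> a2 by (intro mult_nonneg_nonneg add_nonneg_nonneg) auto
  have "energy p q Ksp Ktq a v \<Omega> + ?P
    = (\<integral>\<^sup>+z. ennreal (dens v z) * indicator (C_dom \<Omega>) z + ennreal (Pgood z / \<Lambda>) \<partial>lebesgue)"
    unfolding energy_eq by (subst nn_integral_add) auto
  also have "\<dots> \<le> (\<integral>\<^sup>+z. ennreal (dens u z) * indicator (C_dom \<Omega>) z
      + ennreal (\<Lambda> * q powr q * (Near a2 z + Far z + Far' z)) \<partial>lebesgue)"
  proof (rule nn_integral_mono)
    fix z
    show "ennreal (dens v z) * indicator (C_dom \<Omega>) z + ennreal (Pgood z / \<Lambda>)
      \<le> ennreal (dens u z) * indicator (C_dom \<Omega>) z
        + ennreal (\<Lambda> * q powr q * (Near a2 z + Far z + Far' z))"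
    proof (cases "z \<in> C_dom \<Omega>")
      case True
      have "ennreal (dens v z + Pgood z / \<Lambda>) \<le> ennreal (dens u z + \<Lambda> * q powr q * (Near a2 z + Far z + Far' z))"
        using density_inequality[OF a2, of z] by (rule ennreal_leI)
      then show ?thesis using True nn[of z] dens_gdens(3) \<Lambda> by (simp flip: ennreal_plus)
    next
      case False then show ?thesis using P0 by simp
    qed
  qed
  also have "\<dots> = energy p q Ksp Ktq a u \<Omega> + ?N"
    unfolding energy_eq by (subst nn_integral_add) auto
  finally have main: "energy p q Ksp Ktq a v \<Omega> + ?P \<le> energy p q Ksp Ktq a u \<Omega> + ?N" .
  have PN: "?P \<le> ?N"
  proof (cases "?N = \<infinity>")
    case False
    have eu: "energy p q Ksp Ktq a u \<Omega> < \<infinity>" using u_A A_space_energy by blast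
    have "energy p q Ksp Ktq a v \<Omega> \<le> energy p q Ksp Ktq a u \<Omega> + ?N"
      using main order_trans[OF _ main] by (simp add: add_increasing2)
    also have "\<dots> < \<infinity>" using False eu by (simp add: less_top)
    finally have ev: "energy p q Ksp Ktq a v \<Omega> < \<infinity>" .
    have "(\<integral>\<^sup>+x\<in>\<Omega>. ennreal (\<bar>v x\<bar> powr p) \<partial>lebesgue) \<le> (\<integral>\<^sup>+x\<in>\<Omega>. ennreal (\<bar>u x\<bar> powr p) \<partial>lebesgue)"
      using v_between p by (intro nn_integral_mono mult_right_mono ennreal_leI powr_mono2) auto
    also have "\<dots> < \<infinity>" using u_A A_space_energy by blast
    finally have "v \<in> A_space s t p q a \<Omega>" using ev A_space_energy wfv_meas by blast
    moreover have "v x = u x" if "x \<notin> \<Omega>" for x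
    proof -
      have "x \<notin> B'" using that ball d subset_ball[of "\<rho> - d" \<rho> x0] by auto
      then show ?thesis using \<phi> by (simp add: v_def)
    qed
    ultimately have "energy p q Ksp Ktq a u \<Omega> \<le> energy p q Ksp Ktq a v \<Omega>"
      using minimizer by (auto simp: is_minimizer_def)
    then have "energy p q Ksp Ktq a v \<Omega> + ?P \<le> energy p q Ksp Ktq a v \<Omega> + ?N"
      using main by (meson add_right_mono order_trans)
    then show ?thesis using ev by (auto simp: ennreal_add_left_cancel_le)
  qed simp
  have "(\<integral>\<^sup>+z. ennreal (Pgood z) \<partial>lebesgue) = (\<integral>\<^sup>+z. ennreal \<Lambda> * ennreal (Pgood z / \<Lambda>) \<partial>lebesgue)"
    using \<Lambda> by (simp flip: ennreal_mult')
  also have "\<dots> = ennreal \<Lambda> * ?P" by (rule nn_integral_cmult) simp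
  also have "\<dots> \<le> ennreal \<Lambda> * ?N" using PN by (intro mult_left_mono) auto
  also have "?N = (\<integral>\<^sup>+z. ennreal (\<Lambda> * q powr q) * ennreal (Near a2 z + Far z + Far' z) \<partial>lebesgue)"
    using \<Lambda> by (simp add: ennreal_mult')
  also have "\<dots> = ennreal (\<Lambda> * q powr q) * (\<integral>\<^sup>+z. ennreal (Near a2 z + Far z + Far' z) \<partial>lebesgue)"
    by (rule nn_integral_cmult) simp
  finally show ?thesis
    using \<Lambda> by (simp add: power2_eq_square ennreal_mult' mult_ac)
qed

end

section \<open>Integrals of the error terms\<close>

lemma measurable_dist_left_lebesgue [measurable]:
  "(\<lambda>y. dist x y) \<in> borel_measurable (lebesgue :: 'a::euclidean_space measure)"
  "(\<lambda>y. dist y x) \<in> borel_measurable (lebesgue :: 'a::euclidean_space measure)"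
  by (intro measurable_lborel_lebesgue; simp)+

text \<open>The tail seen from one point \<open>x\<close>, before taking the supremum, for
  nonnegative \<open>v\<close>. The two phases are kept in separate integrals: for exceptional
  \<open>x\<close> the section of \<open>a\<close> may fail to be measurable, and additivity would
  then be in doubt.\<close>

definition far_tail ::
    "real \<Rightarrow> real \<Rightarrow> real \<Rightarrow> real \<Rightarrow> ('a::euclidean_space \<times> 'a \<Rightarrow> real) \<Rightarrow> ('a \<Rightarrow> real) \<Rightarrow> 'a \<Rightarrow> real \<Rightarrow> 'a \<Rightarrow> ennreal" where
  "far_tail s t p q a v x0 r x =
     (\<integral>\<^sup>+y. ennreal (v y powr (p - 1) / dist y x0 powr (real DIM('a) + s * p)) * indicator (- ball x0 r) y \<partial>lebesgue)
     + (\<integral>\<^sup>+y. ennreal (a (x, y) * (v y powr (q - 1) / dist y x0 powr (real DIM('a) + t * q))) * indicator (- ball x0 r) y \<partial>lebesgue)"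

lemma far_tail_mono:
  assumes "\<And>y. 0 \<le> v y" "\<And>y. v y \<le> v' y" "r' \<le> r" "1 < p" "1 < q" "\<And>z. 0 \<le> a z"
  shows "far_tail s t p q a v x0 r x \<le> far_tail s t p q a v' x0 r' x"
  unfolding far_tail_def using assms
  by (intro add_mono nn_integral_mono mult_mono ennreal_leI divide_right_mono mult_left_mono powr_mono2)
    (auto split: split_indicator)

context cutoff
begin

definition wint :: "real \<Rightarrow> ennreal" where
  "wint m = (\<integral>\<^sup>+x. ennreal (w x powr m) * indicator B x \<partial>lebesgue)"

definition wint1 :: ennreal where
  "wint1 = (\<integral>\<^sup>+x. ennreal (w x) * indicator B x \<partial>lebesgue)"

text \<open>Each of the two summands carries \<open>w\<close> at one point only. Integrating first
  in the other variable leaves the kernel integral of the cutoff, which is at most \<open>G\<close>;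
  the two orders of integration produce the factor 2.\<close>

lemma near_err_integral:
  assumes G: "\<And>x. local_gag \<sigma> m \<phi> x \<le> ennreal G" "0 \<le> G"
  shows "(\<integral>\<^sup>+z. ennreal (near_err m z * dist (fst z) (snd z) powr (- (real DIM('a) + \<sigma> * m))) \<partial>lebesgue)
    \<le> ennreal (2 * G) * wint m"
proof -
  let ?g = "\<lambda>x y. \<bar>\<phi> x - \<phi> y\<bar> powr m / dist x y powr (real DIM('a) + \<sigma> * m)"
  let ?h = "\<lambda>x. indicator B x * w x powr m"
  have 0: "(\<integral>\<^sup>+y. ennreal (?g x y * ?h x) \<partial>lebesgue) \<le> ennreal G * (ennreal (w x powr m) * indicator B x)" for x
  proof -
    have "(\<integral>\<^sup>+y. ennreal (?g x y * ?h x) \<partial>lebesgue) = (\<integral>\<^sup>+y. ennreal (?g x y) * ennreal (?h x) \<partial>lebesgue)"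
      by (intro nn_integral_cong ennreal_mult') simp
    also have "\<dots> = local_gag \<sigma> m \<phi> x * ennreal (?h x)"
      unfolding local_gag_def by (rule nn_integral_multc) measurable
    also have "\<dots> \<le> ennreal G * ennreal (?h x)"
      using G by (intro mult_right_mono) auto
    also have "ennreal (?h x) = ennreal (w x powr m) * indicator B x"
      by (simp split: split_indicator)
    finally show ?thesis .
  qed
  have I: "(\<integral>\<^sup>+x. ennreal G * (ennreal (w x powr m) * indicator B x) \<partial>lebesgue) = ennreal G * wint m"
    unfolding wint_def by (rule nn_integral_cmult) measurable
  have "(\<integral>\<^sup>+z. ennreal (?g (fst z) (snd z) * ?h (fst z)) \<partial>lebesgue)
     = (\<integral>\<^sup>+x. \<integral>\<^sup>+y. ennreal (?g x y * ?h x) \<partial>lebesgue \<partial>lebesgue)"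
    by (subst lebesgue_Tonelli(1)) simp_all
  also have "\<dots> \<le> ennreal G * wint m" unfolding I[symmetric] by (intro nn_integral_mono 0)
  finally have 1: "(\<integral>\<^sup>+z. ennreal (?g (fst z) (snd z) * ?h (fst z)) \<partial>lebesgue) \<le> ennreal G * wint m" .
  have "(\<integral>\<^sup>+z. ennreal (?g (fst z) (snd z) * ?h (snd z)) \<partial>lebesgue)
     = (\<integral>\<^sup>+y. \<integral>\<^sup>+x. ennreal (?g x y * ?h y) \<partial>lebesgue \<partial>lebesgue)"
    by (subst lebesgue_Tonelli(2)) simp_all
  also have "\<dots> = (\<integral>\<^sup>+y. \<integral>\<^sup>+x. ennreal (?g y x * ?h y) \<partial>lebesgue \<partial>lebesgue)"
    by (simp add: dist_commute abs_minus_commute)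
  also have "\<dots> \<le> ennreal G * wint m" unfolding I[symmetric] by (intro nn_integral_mono 0)
  finally have 2: "(\<integral>\<^sup>+z. ennreal (?g (fst z) (snd z) * ?h (snd z)) \<partial>lebesgue) \<le> ennreal G * wint m" .
  have "(\<integral>\<^sup>+z. ennreal (near_err m z * dist (fst z) (snd z) powr (- (real DIM('a) + \<sigma> * m))) \<partial>lebesgue)
    = (\<integral>\<^sup>+z. ennreal (?g (fst z) (snd z) * ?h (fst z)) + ennreal (?g (fst z) (snd z) * ?h (snd z)) \<partial>lebesgue)"
    by (intro nn_integral_cong)
      (simp add: near_err_def divide_powr ring_distribs mult_ac flip: ennreal_plus)
  also have "\<dots> = (\<integral>\<^sup>+z. ennreal (?g (fst z) (snd z) * ?h (fst z)) \<partial>lebesgue)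
      + (\<integral>\<^sup>+z. ennreal (?g (fst z) (snd z) * ?h (snd z)) \<partial>lebesgue)"
    by (rule nn_integral_add) measurable
  also have "\<dots> \<le> ennreal G * wint m + ennreal G * wint m"
    using 1 2 by (rule add_mono)
  also have "\<dots> = ennreal (2 * G) * wint m"
    using G(2) by (simp add: distrib_right[symmetric] flip: ennreal_plus)
  finally show ?thesis .
qed

lemma Near_integral:
  assumes G: "\<And>x. local_gag s p \<phi> x \<le> ennreal Gp" "0 \<le> Gp"
    "\<And>x. local_gag t q \<phi> x \<le> ennreal Gq" "0 \<le> Gq" and a2: "0 \<le> a2"
  shows "(\<integral>\<^sup>+z. ennreal (Near a2 z) \<partial>lebesgue)
    \<le> ennreal (2 * Gp) * wint p + ennreal (a2 * (2 * Gq)) * wint q"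
proof -
  have "(\<integral>\<^sup>+z. ennreal (Near a2 z) \<partial>lebesgue)
    = (\<integral>\<^sup>+z. ennreal (near_err p z * kp z) + ennreal a2 * ennreal (near_err q z * kq z) \<partial>lebesgue)"
    using a2 by (simp add: Near_def ennreal_mult')
  also have "\<dots> = (\<integral>\<^sup>+z. ennreal (near_err p z * kp z) \<partial>lebesgue)
      + ennreal a2 * (\<integral>\<^sup>+z. ennreal (near_err q z * kq z) \<partial>lebesgue)"
    by (subst nn_integral_add) (auto simp: nn_integral_cmult)
  also have "\<dots> \<le> ennreal (2 * Gp) * wint p + ennreal a2 * (ennreal (2 * Gq) * wint q)"
    using near_err_integral[OF G(1,2)] near_err_integral[OF G(3,4)]
    by (intro add_mono mult_left_mono) (auto simp: kp_def kq_def)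
  finally show ?thesis unfolding ennreal_mult'[OF a2] mult.assoc .
qed

text \<open>\<open>dist x y \<ge> dist y x0 - (\<rho> - d) \<ge> (d / \<rho>) * dist y x0\<close>,
  the second inequality because \<open>dist y x0 \<ge> \<rho>\<close>. As
  \<open>\<rho> / d > 1\<close>, the exponent may be raised to a common \<open>e\<close> for both
  phases.\<close>

lemma kernel_far:
  assumes "x \<in> B'" "y \<notin> B" "0 \<le> c" "c \<le> e"
  shows "dist x y powr (- c) \<le> (\<rho> / d) powr e / dist y x0 powr c"
proof -
  have xy: "dist x x0 < \<rho> - d" "\<rho> \<le> dist y x0" using assms by (auto simp: dist_commute)
  have "dist y x0 \<le> dist x y + dist x x0"
    using dist_triangle[of y x0 x] by (simp add: dist_commute)
  then have 1: "dist y x0 - (\<rho> - d) \<le> dist x y" using xy by simp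
  have "d * dist y x0 \<le> \<rho> * (dist y x0 - (\<rho> - d))"
  proof -
    have "0 \<le> (\<rho> - d) * (dist y x0 - \<rho>)" using xy d by (intro mult_nonneg_nonneg) auto
    then show ?thesis by (simp add: algebra_simps)
  qed
  also have "\<dots> \<le> \<rho> * dist x y" using 1 d by (intro mult_left_mono) auto
  finally have "d / \<rho> * dist y x0 \<le> dist x y" using d by (simp add: field_simps)
  moreover have "0 < d / \<rho> * dist y x0" using d xy by (intro mult_pos_pos) auto
  ultimately have "dist x y powr (- c) \<le> (d / \<rho> * dist y x0) powr (- c)"
    using assms by (intro powr_mono2') auto
  also have "\<dots> = (\<rho> / d) powr c / dist y x0 powr c"
    unfolding powr_mult powr_divide divide_powr by (simp add: mult_ac)
  also have "\<dots> \<le> (\<rho> / d) powr e / dist y x0 powr c"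
    using d assms by (intro divide_right_mono powr_mono) auto
  finally show ?thesis .
qed

lemma Far_integral:
  assumes T: "\<And>x. x \<in> B \<Longrightarrow> far_tail s t p q a w x0 \<rho> x \<le> ennreal T" "0 \<le> T"
  defines "c \<equiv> (\<rho> / d) powr (real DIM('a) + q)"
  shows "(\<integral>\<^sup>+z. ennreal (Far z) \<partial>lebesgue) \<le> ennreal (c * T) * wint1"
proof -
  let ?P = "\<lambda>y. w y powr (p - 1) / dist y x0 powr (real DIM('a) + s * p)"
  let ?Q = "\<lambda>y. w y powr (q - 1) / dist y x0 powr (real DIM('a) + t * q)"
  have c: "0 \<le> c" by (simp add: c_def)
  note sp = exponent_bounds
  have pt: "Far (x, y) \<le> c * w x * indicator B x * ((?P y + a (x, y) * ?Q y) * indicator (- B) y)" for x y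
  proof (cases "x \<in> B' \<and> y \<notin> B")
    case True
    then have xB: "x \<in> B" using d by auto
    have k: "kp (x, y) \<le> c / dist y x0 powr (real DIM('a) + s * p)"
        "kq (x, y) \<le> c / dist y x0 powr (real DIM('a) + t * q)"
      unfolding c_def kp_def kq_def fst_conv snd_conv using True sp by - (rule kernel_far; simp)+
    have "Far (x, y) = w x * w y powr (p - 1) * kp (x, y) + a (x, y) * (w x * w y powr (q - 1) * kq (x, y))"
      using True by (simp add: Far_def far_err_def)
    also have "\<dots> \<le> w x * w y powr (p - 1) * (c / dist y x0 powr (real DIM('a) + s * p))
       + a (x, y) * (w x * w y powr (q - 1) * (c / dist y x0 powr (real DIM('a) + t * q)))"
      using k by (intro add_mono mult_left_mono) auto
    also have "\<dots> = c * w x * (?P y + a (x, y) * ?Q y)"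
      by (simp add: ring_distribs mult_ac)
    finally show ?thesis using True xB by simp
  next
    case False
    then have "Far (x, y) = 0" by (auto simp: Far_def far_err_def)
    then show ?thesis using c by (simp split: split_indicator)
  qed
  \<comment> \<open>Sections of \<open>a\<close> are measurable for almost every \<open>x\<close>,
    which suffices under the outer integral.\<close>
  have ae: "AE x in lebesgue. (\<lambda>y. ennreal (a (x, y))) \<in> borel_measurable lebesgue"
    by (rule lebesgue_Tonelli(3)) measurable
  have "(\<integral>\<^sup>+z. ennreal (Far z) \<partial>lebesgue) = (\<integral>\<^sup>+x. \<integral>\<^sup>+y. ennreal (Far (x, y)) \<partial>lebesgue \<partial>lebesgue)"
    by (rule lebesgue_Tonelli(1)) measurable
  also have "\<dots> \<le> (\<integral>\<^sup>+x. ennreal (c * T) * (ennreal (w x) * indicator B x) \<partial>lebesgue)"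
  proof (rule nn_integral_mono_AE, use ae in eventually_elim)
    case (elim x)
    note [measurable] = elim
    have "(\<integral>\<^sup>+y. ennreal (Far (x, y)) \<partial>lebesgue)
      \<le> (\<integral>\<^sup>+y. ennreal (c * w x * indicator B x) * (ennreal (?P y) * indicator (- B) y
          + ennreal (a (x, y) * ?Q y) * indicator (- B) y) \<partial>lebesgue)"
    proof (rule nn_integral_mono)
      fix y
      have "ennreal (Far (x, y)) \<le> ennreal (c * w x * indicator B x * ((?P y + a (x, y) * ?Q y) * indicator (- B) y))"
        using pt by (rule ennreal_leI)
      also have "\<dots> = ennreal (c * w x * indicator B x) * (ennreal (?P y) * indicator (- B) y
          + ennreal (a (x, y) * ?Q y) * indicator (- B) y)"
        using c by (auto simp: ennreal_mult' split: split_indicator simp flip: ennreal_plus)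
      finally show "ennreal (Far (x, y)) \<le> \<dots>" .
    qed
    also have "\<dots> = ennreal (c * w x * indicator B x) * far_tail s t p q a w x0 \<rho> x"
    proof -
      have m: "(\<lambda>y. ennreal (a (x, y) * ?Q y)) \<in> borel_measurable lebesgue"
        unfolding ennreal_mult'[OF a_nonneg] by measurable
      show ?thesis unfolding far_tail_def using m
        by (subst nn_integral_cmult, measurable) (subst nn_integral_add, auto)
    qed
    also have "\<dots> \<le> ennreal (c * T) * (ennreal (w x) * indicator B x)"
    proof (cases "x \<in> B")
      case True
      have "ennreal (c * w x) * far_tail s t p q a w x0 \<rho> x \<le> ennreal (c * w x) * ennreal T"
        using T(1)[OF True] by (intro mult_left_mono) auto
      then show ?thesis using True c T by (simp add: ennreal_mult' mult_ac)
    qed simp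
    finally show ?case .
  qed
  also have "\<dots> = ennreal (c * T) * wint1"
    unfolding wint1_def by (rule nn_integral_cmult) measurable
  finally show ?thesis .
qed

lemma Far'_integral: "(\<integral>\<^sup>+z. ennreal (Far' z) \<partial>lebesgue) = (\<integral>\<^sup>+z. ennreal (Far z) \<partial>lebesgue)"
proof -
  have sym: "AE z in lebesgue. a (fst z, snd z) = a (snd z, fst z)"
    using a unfolding coefficient_cond_def by blast
  have "(\<integral>\<^sup>+z. ennreal (Far' z) \<partial>lebesgue) = (\<integral>\<^sup>+x. \<integral>\<^sup>+y. ennreal (Far' (x, y)) \<partial>lebesgue \<partial>lebesgue)"
    by (rule lebesgue_Tonelli(1)) measurable
  also have "\<dots> = (\<integral>\<^sup>+x. \<integral>\<^sup>+y. ennreal (Far (y, x)) \<partial>lebesgue \<partial>lebesgue)"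
  proof (rule nn_integral_cong_AE, use AE_lebesgue_pair[OF sym] in eventually_elim)
    case (elim x)
    show ?case
    proof (rule nn_integral_cong_AE, use elim in eventually_elim)
      case (elim y)
      have "far_err' m (x, y) = far_err m (y, x)" for m
        by (simp add: far_err_def far_err'_def indicator_def conj_commute)
      then show ?case using elim by (simp add: Far_def Far'_def kp_def kq_def dist_commute)
    qed
  qed
  also have "\<dots> = (\<integral>\<^sup>+z. ennreal (Far z) \<partial>lebesgue)"
    by (rule lebesgue_Tonelli(2)[symmetric]) measurable
  finally show ?thesis .
qed

lemma f_phase:
  assumes "1 \<le> m" "m \<le> q"
  shows "\<bar>f (fst z) - f (snd z)\<bar> powr m \<le> 2 powr q * (good m z + q powr q * near_err m z)"
proof -
  obtain x y where z: "z = (x, y)" by (cases z)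
  have two: "2 powr m \<le> 2 powr q" "q powr m \<le> q powr q" "1 \<le> q powr q" "1 \<le> 2 powr q" "0 \<le> q"
    using assms by (auto intro!: powr_mono ge_one_powr_ge_zero)
  have one: "c \<le> 2 powr q * (q powr q * c)" if "0 \<le> c" for c
  proof -
    have "1 * (1 * c) \<le> 2 powr q * (q powr q * c)"
      using that two by (intro mult_mono) auto
    then show ?thesis by simp
  qed
  \<comment> \<open>One point lies outside \<open>B\<close>, where the cutoff vanishes, so
    \<open>\<phi> x\<close> is itself the increment of the cutoff;
    \<open>\<phi> powr q \<le> \<phi>\<close> then yields a summand of
    \<open>near_err\<close>.\<close>
  have edge: "\<bar>\<phi> x powr q * w x\<bar> powr m \<le> 2 powr q * (q powr q * (\<bar>\<phi> x - 0\<bar> powr m * w x powr m))" for x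
  proof -
    have "\<phi> x powr q \<le> \<phi> x" using powr_mono'[of 1 q "\<phi> x"] \<phi>[of x] assms by simp
    then have "\<bar>\<phi> x powr q * w x\<bar> powr m \<le> (\<phi> x * w x) powr m"
      using assms \<phi>[of x] by (intro powr_mono2) (auto intro!: mult_right_mono)
    also have "\<dots> = \<bar>\<phi> x - 0\<bar> powr m * w x powr m" using \<phi> by (simp add: powr_mult)
    also have "\<dots> \<le> 2 powr q * (q powr q * (\<bar>\<phi> x - 0\<bar> powr m * w x powr m))" by (rule one) simp
    finally show ?thesis .
  qed
  have sub: "x \<notin> B \<Longrightarrow> \<phi> x = 0" for x using \<phi>(3)[of x] d by auto
  consider (inside) "x \<in> B" "y \<in> B" | (xin) "x \<in> B" "y \<notin> B" | (yin) "x \<notin> B" "y \<in> B"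
    | (out) "x \<notin> B" "y \<notin> B" by blast
  then show ?thesis
  proof cases
    case inside
    have "\<bar>\<phi> x powr q * w x - \<phi> y powr q * w y\<bar> powr m
      \<le> 2 powr m * (max (\<phi> x powr q) (\<phi> y powr q) * \<bar>w x - w y\<bar> powr m
          + q powr m * \<bar>\<phi> x - \<phi> y\<bar> powr m * (w x powr m + w y powr m))"
      using assms \<phi> by (intro cutoff_product_bound) auto
    also have "\<dots> = 2 powr m * (good m z + q powr m * near_err m z)"
      using inside by (simp add: good_def near_err_def z)
    also have "\<dots> \<le> 2 powr q * (good m z + q powr q * near_err m z)"
      using two by (intro mult_mono add_mono mult_right_mono order_refl) auto
    finally show ?thesis by (simp add: f_def z)
  next
    case xin
    then show ?thesis using edge[of x] sub[of y] assms by (simp add: f_def z good_def near_err_def)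
  next
    case yin
    then show ?thesis using edge[of y] sub[of x] assms by (simp add: f_def z good_def near_err_def)
  next
    case out
    then show ?thesis using sub assms by (simp add: f_def z good_def near_err_def)
  qed
qed

text \<open>\<open>2 powr q\<close> stems from the product estimate for \<open>f\<close> and
  \<open>\<Lambda>\<^sup>2 * q powr q\<close> from the energy comparison. One factor 2 counts the
  two orderings of far pairs and the two sources of the near error, the other the two summands of
  \<open>near_err\<close>. The gain is supported in \<open>B \<times> B\<close>, so there
  \<open>a1 \<le> a\<close> gives the second phase with a constant coefficient.\<close>

theorem Caccioppoli:
  assumes G: "\<And>x. local_gag s p \<phi> x \<le> ennreal Gp" "0 \<le> Gp"
    "\<And>x. local_gag t q \<phi> x \<le> ennreal Gq" "0 \<le> Gq"
    and a2: "\<And>x y. x \<in> B \<Longrightarrow> y \<in> B \<Longrightarrow> a (x, y) \<le> a2"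
    and a1: "\<And>x y. x \<in> B \<Longrightarrow> y \<in> B \<Longrightarrow> a1 \<le> a (x, y)" "0 \<le> a1"
    and T: "\<And>x. x \<in> B \<Longrightarrow> far_tail s t p q a w x0 \<rho> x \<le> ennreal T" "0 \<le> T"
  defines "C \<equiv> 2 powr q * \<Lambda>\<^sup>2 * q powr q * 4"
  shows "gagliardo s p f + ennreal a1 * gagliardo t q f
    \<le> ennreal C * (ennreal Gp * wint p + ennreal (a2 * Gq) * wint q
        + ennreal ((\<rho> / d) powr (real DIM('a) + q) * T) * wint1)"
proof -
  have x0: "x0 \<in> B" using d by simp
  have a12: "a1 \<le> a2" "0 \<le> a2" using a1(1)[OF x0 x0] a2[OF x0 x0] a1(2) by auto
  let ?IN = "\<integral>\<^sup>+z. ennreal (Near a2 z) \<partial>lebesgue" and ?IF = "\<integral>\<^sup>+z. ennreal (Far z) \<partial>lebesgue"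
  let ?IP = "\<integral>\<^sup>+z. ennreal (Pgood z) \<partial>lebesgue"
  define c1 where "c1 = 2 powr q * (\<Lambda>\<^sup>2 * q powr q)"
  define c2 where "c2 = 2 powr q * q powr q"
  have c: "0 \<le> c1" "0 \<le> c2" "c2 \<le> c1"
    using mult_right_mono[OF one_le_power[OF \<Lambda>, of 2], of "q powr q"] by (auto simp: c1_def c2_def)
  have pt: "\<bar>f (fst z) - f (snd z)\<bar> powr p * kp z + a1 * (\<bar>f (fst z) - f (snd z)\<bar> powr q * kq z)
      \<le> 2 powr q * Pgood z + c2 * Near a2 z" for z
  proof -
    have ga: "a1 * good q z \<le> a z * good q z"
      using a1(1)[of "fst z" "snd z"] by (cases z) (auto simp: good_def le_max_iff_disj intro!: mult_right_mono split: split_indicator)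
    have na: "a1 * near_err q z \<le> a2 * near_err q z" using a12 by (intro mult_right_mono) auto
    have "\<bar>f (fst z) - f (snd z)\<bar> powr p * kp z + a1 * (\<bar>f (fst z) - f (snd z)\<bar> powr q * kq z)
      \<le> 2 powr q * (good p z + q powr q * near_err p z) * kp z
        + a1 * (2 powr q * (good q z + q powr q * near_err q z) * kq z)"
      using f_phase p pq a1 by (intro add_mono mult_right_mono mult_left_mono) auto
    also have "\<dots> = 2 powr q * (good p z * kp z + q powr q * (near_err p z * kp z)
        + (a1 * good q z) * kq z + q powr q * ((a1 * near_err q z) * kq z))"
      by (simp add: algebra_simps)
    also have "\<dots> \<le> 2 powr q * (good p z * kp z + q powr q * (near_err p z * kp z)
        + (a z * good q z) * kq z + q powr q * ((a2 * near_err q z) * kq z))"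
      using mult_right_mono[OF ga kq_nonneg[of z]] mult_right_mono[OF na kq_nonneg[of z]]
      by (intro mult_left_mono add_mono order_refl) auto
    also have "\<dots> = 2 powr q * Pgood z + c2 * Near a2 z"
      by (simp add: Pgood_def Near_def c2_def algebra_simps)
    finally show ?thesis .
  qed
  have "gagliardo s p f + ennreal a1 * gagliardo t q f
    = (\<integral>\<^sup>+z. ennreal (\<bar>f (fst z) - f (snd z)\<bar> powr p * kp z)
       + ennreal a1 * ennreal (\<bar>f (fst z) - f (snd z)\<bar> powr q * kq z) \<partial>lebesgue)"
    unfolding gagliardo_def divide_powr kp_def[symmetric] kq_def[symmetric]
    by (subst nn_integral_add) (auto simp: nn_integral_cmult)
  also have "\<dots> \<le> (\<integral>\<^sup>+z. ennreal (2 powr q) * ennreal (Pgood z) + ennreal c2 * ennreal (Near a2 z) \<partial>lebesgue)"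
  proof (rule nn_integral_mono)
    fix z
    show "ennreal (\<bar>f (fst z) - f (snd z)\<bar> powr p * kp z)
       + ennreal a1 * ennreal (\<bar>f (fst z) - f (snd z)\<bar> powr q * kq z)
      \<le> ennreal (2 powr q) * ennreal (Pgood z) + ennreal c2 * ennreal (Near a2 z)"
      using ennreal_leI[OF pt[of z]] a1 a12 c by (simp add: ennreal_mult')
  qed
  also have "\<dots> = ennreal (2 powr q) * ?IP + ennreal c2 * ?IN"
    by (subst nn_integral_add) (auto simp: nn_integral_cmult)
  also have "\<dots> \<le> ennreal (2 powr q) * (ennreal (\<Lambda>\<^sup>2 * q powr q) * (?IN + ?IF + ?IF)) + ennreal c1 * ?IN"
  proof (intro add_mono mult_left_mono mult_right_mono ennreal_leI)
    have "(\<integral>\<^sup>+z. ennreal (Near a2 z + Far z + Far' z) \<partial>lebesgue)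
      = (\<integral>\<^sup>+z. ennreal (Near a2 z) + ennreal (Far z) + ennreal (Far' z) \<partial>lebesgue)"
      using a12 by simp
    also have "\<dots> = ?IN + ?IF + ?IF"
      by (subst nn_integral_add, simp, simp, subst nn_integral_add) (auto simp: Far'_integral)
    finally show "?IP \<le> ennreal (\<Lambda>\<^sup>2 * q powr q) * (?IN + ?IF + ?IF)"
      using good_energy[OF a2 a12(2)] by simp
  qed (use c in auto)
  also have "\<dots> = ennreal c1 * (?IN + ?IF + ?IF) + ennreal c1 * ?IN"
    by (simp add: c1_def ennreal_mult' mult.assoc)
  also have "\<dots> = ennreal (2 * c1) * (?IN + ?IF)"
  proof -
    have two: "X * (a + b + b) + X * a = 2 * X * (a + b)" for X a b :: ennreal
      by (simp only: mult_2 distrib_left distrib_right add_ac)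
    have "ennreal (2 * c1) = 2 * ennreal c1" by (simp add: ennreal_mult')
    then show ?thesis by (simp only: two)
  qed
  also have "\<dots> \<le> ennreal (2 * c1) * ((ennreal (2 * Gp) * wint p + ennreal (a2 * (2 * Gq)) * wint q)
        + ennreal (2 * ((\<rho> / d) powr (real DIM('a) + q) * T)) * wint1)"
  proof (intro mult_left_mono add_mono)
    have "?IF \<le> ennreal ((\<rho> / d) powr (real DIM('a) + q) * T) * wint1"
      by (rule Far_integral[OF T])
    also have "\<dots> \<le> ennreal (2 * ((\<rho> / d) powr (real DIM('a) + q) * T)) * wint1"
      using T by (intro mult_right_mono ennreal_leI) auto
    finally show "?IF \<le> \<dots>" .
  qed (use Near_integral[OF G a12(2)] in auto)
  also have "\<dots> = ennreal (2 * c1) * (ennreal 2 * (ennreal Gp * wint p + ennreal (a2 * Gq) * wint q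
        + ennreal ((\<rho> / d) powr (real DIM('a) + q) * T) * wint1))"
    using G T a12 by (simp add: ennreal_mult' distrib_left mult_ac)
  also have "\<dots> = ennreal C * (ennreal Gp * wint p + ennreal (a2 * Gq) * wint q
        + ennreal ((\<rho> / d) powr (real DIM('a) + q) * T) * wint1)"
  proof -
    have "ennreal C = ennreal (2 * c1) * ennreal 2"
      unfolding C_def c1_def by (subst ennreal_mult''[symmetric]) (auto simp: mult_ac)
    then show ?thesis by (simp add: mult.assoc)
  qed
  finally show ?thesis .
qed

end

section \<open>De Giorgi iteration\<close>

text \<open>Turns the constant of \<open>cutoff_kernel_integral\<close> into a property of a number,
  so that one value of \<open>G\<close> can be fixed before the solution, the ball and the cutoffs
  are known.\<close>

definition cutoff_const :: "'a::euclidean_space itself \<Rightarrow> real \<Rightarrow> real \<Rightarrow> real \<Rightarrow> bool" where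
  "cutoff_const _ \<sigma> m G \<longleftrightarrow> 0 < G \<and>
     (\<forall>(\<phi> :: 'a \<Rightarrow> real) d x. 0 < d \<longrightarrow> (\<forall>y. \<bar>\<phi> x - \<phi> y\<bar> \<le> dist x y / d) \<longrightarrow>
       (\<forall>y. \<bar>\<phi> x - \<phi> y\<bar> \<le> 1) \<longrightarrow> local_gag \<sigma> m \<phi> x \<le> ennreal (G * d powr (- (\<sigma> * m))))"

lemma cutoff_const_exists:
  assumes "0 < \<sigma>" "\<sigma> < 1" "1 \<le> m"
  obtains G where "cutoff_const TYPE('a::euclidean_space) \<sigma> m G"
proof -
  show ?thesis
  proof (rule cutoff_kernel_integral[OF assms, where ?'a = 'a])
    fix G :: real
    assume G: "0 < G" "\<And>(\<phi> :: 'a \<Rightarrow> real) d x. 0 < d \<Longrightarrow> (\<And>y. \<bar>\<phi> x - \<phi> y\<bar> \<le> dist x y / d) \<Longrightarrow>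
       (\<And>y. \<bar>\<phi> x - \<phi> y\<bar> \<le> 1) \<Longrightarrow>
       (\<integral>\<^sup>+y. ennreal (\<bar>\<phi> x - \<phi> y\<bar> powr m / dist x y powr (real DIM('a) + \<sigma> * m)) \<partial>lebesgue)
         \<le> ennreal (G * d powr (- (\<sigma> * m)))"
    show thesis
    proof (rule that[of G], unfold cutoff_const_def local_gag_def, intro conjI allI impI)
      show "0 < G" by (rule G)
    qed (rule G(2), auto)
  qed
qed

definition cut :: "'a::euclidean_space \<Rightarrow> real \<Rightarrow> real \<Rightarrow> 'a \<Rightarrow> real" where
  "cut x0 r d x = max 0 (min 1 ((r - dist x0 x) / d))"

lemma cut_bounds: "0 \<le> cut x0 r d x" "cut x0 r d x \<le> 1"
  by (auto simp: cut_def)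

lemma cut_eq_0: "0 < d \<Longrightarrow> x \<notin> ball x0 r \<Longrightarrow> cut x0 r d x = 0"
  by (auto simp: cut_def max_def min_def divide_simps)

lemma cut_eq_1: "0 < d \<Longrightarrow> x \<in> ball x0 (r - d) \<Longrightarrow> cut x0 r d x = 1"
  by (auto simp: cut_def min_def divide_simps)

lemma cut_Lipschitz:
  assumes "0 < d"
  shows "\<bar>cut x0 r d x - cut x0 r d y\<bar> \<le> dist x y / d"
proof -
  have "\<bar>cut x0 r d x - cut x0 r d y\<bar> \<le> \<bar>(r - dist x0 x) / d - (r - dist x0 y) / d\<bar>"
    unfolding cut_def by linarith
  also have "\<dots> = \<bar>dist x0 y - dist x0 x\<bar> / d"
    using assms by (simp add: diff_divide_distrib[symmetric] abs_divide)
  also have "\<dots> \<le> dist x y / d"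
    using assms abs_dist_diff_le[of y x0 x] by (intro divide_right_mono) (auto simp: dist_commute)
  finally show ?thesis .
qed

lemma cut_diff_le_1: "\<bar>cut x0 r d x - cut x0 r d y\<bar> \<le> 1"
  using cut_bounds[of x0 r d x] cut_bounds[of x0 r d y] by linarith

lemma cut_measurable [measurable]: "cut x0 r d \<in> borel_measurable lebesgue"
  unfolding cut_def[abs_def] by measurable

lemma cut_local_gag:
  assumes "cutoff_const TYPE('a::euclidean_space) \<sigma> m G" "0 < d"
  shows "local_gag \<sigma> m (cut (x0 :: 'a) r d) x \<le> ennreal (G * d powr (- (\<sigma> * m)))"
  using assms cut_Lipschitz[OF assms(2), of x0 r x] cut_diff_le_1[of x0 r d x]
  unfolding cutoff_const_def by blast

text \<open>Faber-Krahn gains the power \<open>s * p / n\<close> of the measure in one phase and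
  \<open>t * q / n\<close> in the other; the smaller one is available in both.\<close>

definition dg_exponent :: "'a::euclidean_space itself \<Rightarrow> real \<Rightarrow> real \<Rightarrow> real \<Rightarrow> real \<Rightarrow> real" where
  "dg_exponent _ s t p q = min (s * p) (t * q) / real DIM('a)"

text \<open>The prefactor is the Caccioppoli constant. In the bracket, \<open>G1\<close> belongs to
  the first phase, \<open>G2 * (1 + K1 * M1 powr (q - p))\<close> to the second with the oscillation
  of \<open>a\<close> absorbed, and \<open>1\<close> to the tail.\<close>

definition energy_const :: "real \<Rightarrow> real \<Rightarrow> real \<Rightarrow> real \<Rightarrow> real \<Rightarrow> real \<Rightarrow> real \<Rightarrow> real" where
  "energy_const p q \<Lambda> K1 M1 G1 G2 =
     2 powr q * \<Lambda>\<^sup>2 * q powr q * 4 * (G1 + G2 * (1 + K1 * M1 powr (q - p)) + 1)"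

definition dg_const ::
    "'a::euclidean_space itself \<Rightarrow> real \<Rightarrow> real \<Rightarrow> real \<Rightarrow> real \<Rightarrow> real \<Rightarrow> real \<Rightarrow> real \<Rightarrow> real \<Rightarrow> real \<Rightarrow> real" where
  "dg_const T s t p q \<Lambda> K1 M1 G1 G2 =
     (sob_const T s p + sob_const T t q) * (1 + unit_ball_vol (real DIM('a))) powr q
       * energy_const p q \<Lambda> K1 M1 G1 G2"

lemma ball_sets_lebesgue [measurable]: "ball (x :: 'a::euclidean_space) r \<in> sets lebesgue"
  by simp

lemma ennreal_mult_sum3:
  assumes "0 \<le> c" "0 \<le> x" "0 \<le> y" "0 \<le> z"
  shows "ennreal c * (ennreal x + ennreal y + ennreal z) = ennreal (c * (x + y + z))"
  unfolding ennreal_mult'[OF assms(1)] using assms by simp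

text \<open>\<open>b\<close> will be the infimum of \<open>a\<close> over pairs in the ball.
  \<open>M1\<close> serves to bound \<open>osc * w powr q\<close> by the first phase. \<kappa>,
  \<open>C3\<close> and \<open>C4\<close> are parameters tied by equations, so that they can be
  identified with numbers chosen before the other data.\<close>

locale De_Giorgi = double_phase +
  fixes u :: "'a \<Rightarrow> real" and x0 :: 'a and R b osc K1 k0 M1 T G1 G2 \<kappa> C3 C4 :: real
  assumes minimizer: "is_minimizer s t p q Ksp Ktq a \<Omega> u"
    and ball: "ball x0 R \<subseteq> \<Omega>" and R: "0 < R" "R \<le> 1" and b: "0 \<le> b"
    and a_lower: "\<And>x y. x \<in> ball x0 R \<Longrightarrow> y \<in> ball x0 R \<Longrightarrow> b \<le> a (x, y)"
    and a_upper: "\<And>x y. x \<in> ball x0 R \<Longrightarrow> y \<in> ball x0 R \<Longrightarrow> a (x, y) \<le> b + osc"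
    and osc: "0 \<le> osc" "osc * R powr (- (t * q)) \<le> K1 * R powr (- (s * p))"
    and k0: "0 \<le> k0" and M1: "0 < M1"
    and bounded: "AE x in lebesgue. x \<in> ball x0 R \<longrightarrow> u x - k0 \<le> M1"
    and T: "0 \<le> T"
    and tail: "\<And>x. x \<in> ball x0 R \<Longrightarrow>
      far_tail s t p q a (\<lambda>y. max (u y) 0) x0 (R / 2) x \<le> ennreal T"
    and G1: "cutoff_const TYPE('a) s p G1" and G2: "cutoff_const TYPE('a) t q G2"
    and \<kappa>_def: "\<kappa> = dg_exponent TYPE('a) s t p q"
    and C3_def: "C3 = energy_const p q \<Lambda> K1 M1 G1 G2"
    and C4_def: "C4 = dg_const TYPE('a) s t p q \<Lambda> K1 M1 G1 G2"
begin

definition H :: "real \<Rightarrow> real" where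
  "H \<tau> = \<tau> powr p / R powr (s * p) + b * (\<tau> powr q / R powr (t * q))"

definition h :: "real \<Rightarrow> real" where
  "h \<tau> = \<tau> powr (p - 1) / R powr (s * p) + b * (\<tau> powr (q - 1) / R powr (t * q))"

lemma Rp: "0 < R powr c" using R by simp

lemma u_meas [measurable]: "u \<in> borel_measurable lebesgue"
  using minimizer by (auto simp: is_minimizer_def A_space_def)

lemma K1: "0 \<le> K1"
proof -
  have "0 \<le> K1 * R powr (- (s * p))" using osc by (meson mult_nonneg_nonneg order_trans powr_ge_zero)
  then show ?thesis using Rp[of "- (s * p)"] by (simp add: zero_le_mult_iff)
qed

lemma G12: "0 < G1" "0 < G2"
  using G1 G2 by (auto simp: cutoff_const_def)

lemma C3: "0 < C3"
  using G12 K1 \<Lambda> p pq unfolding C3_def energy_const_def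
  by (intro mult_pos_pos add_nonneg_pos add_nonneg_nonneg mult_nonneg_nonneg) auto

lemma C4: "0 < C4"
  using C3 add_pos_pos[OF zero_less_one unit_ball_vol_pos[of "real DIM('a)"]] sob_const_pos[where ?'a = 'a, of s p] sob_const_pos[where ?'a = 'a, of t q]
  unfolding C4_def dg_const_def C3_def[symmetric] by (intro mult_pos_pos add_pos_pos) auto

lemma \<kappa>: "0 < \<kappa>" "\<kappa> \<le> s * p / real DIM('a)" "\<kappa> \<le> t * q / real DIM('a)"
  using s t p pq by (auto simp: \<kappa>_def dg_exponent_def divide_right_mono)

lemma H_nonneg [simp]: "0 \<le> H \<tau>" and h_nonneg [simp]: "0 \<le> h \<tau>"
  using b by (simp_all add: H_def h_def)

lemma H_pos: "0 < \<tau> \<Longrightarrow> 0 < H \<tau>"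
  using b Rp unfolding H_def by (intro add_pos_nonneg) auto

lemma h_pos: "0 < \<tau> \<Longrightarrow> 0 < h \<tau>"
  using b Rp unfolding h_def by (intro add_pos_nonneg) auto

lemma H_mono: "0 \<le> x \<Longrightarrow> x \<le> y \<Longrightarrow> H x \<le> H y"
  unfolding H_def using b p pq
  by (intro add_mono mult_left_mono divide_right_mono powr_mono2) auto

lemma h_mono: "0 \<le> x \<Longrightarrow> x \<le> y \<Longrightarrow> h x \<le> h y"
  unfolding h_def using b p pq
  by (intro add_mono mult_left_mono divide_right_mono powr_mono2) auto

lemma H_eq: "0 \<le> \<tau> \<Longrightarrow> H \<tau> = \<tau> * h \<tau>"
proof -
  assume \<tau>: "0 \<le> \<tau>"
  have e: "\<tau> powr m = \<tau> * \<tau> powr (m - 1)" for m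
    using \<tau> by (cases "\<tau> = 0") (auto simp: powr_diff)
  show ?thesis unfolding H_def h_def by (subst e[of p], subst e[of q]) (simp add: algebra_simps)
qed

lemma H_scale: "0 \<le> \<theta> \<Longrightarrow> \<theta> \<le> 1 \<Longrightarrow> 0 \<le> \<tau> \<Longrightarrow> \<theta> powr q * H \<tau> \<le> H (\<theta> * \<tau>)"
proof -
  assume \<theta>: "0 \<le> \<theta>" "\<theta> \<le> 1" and \<tau>: "0 \<le> \<tau>"
  have "\<theta> powr q \<le> \<theta> powr p" using \<theta> pq p powr_mono'[of p q \<theta>] by simp
  then have "\<theta> powr q * (\<tau> powr p / R powr (s * p)) \<le> \<theta> powr p * (\<tau> powr p / R powr (s * p))"
    by (intro mult_right_mono) auto
  then show ?thesis unfolding H_def by (simp add: powr_mult algebra_simps)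
qed

text \<open>The natural exponents \<open>p - 1\<close> and \<open>q - 1\<close> are weakened to
  \<open>q\<close>, so that \<open>h\<close> and \<open>H\<close> lose the same factor.\<close>

lemma h_scale: "0 \<le> \<theta> \<Longrightarrow> \<theta> \<le> 1 \<Longrightarrow> 0 \<le> \<tau> \<Longrightarrow> \<theta> powr q * h \<tau> \<le> h (\<theta> * \<tau>)"
proof -
  assume \<theta>: "0 \<le> \<theta>" "\<theta> \<le> 1" and \<tau>: "0 \<le> \<tau>"
  have "\<theta> powr q \<le> \<theta> powr (p - 1)" "\<theta> powr q \<le> \<theta> powr (q - 1)"
    using \<theta> pq p powr_mono'[of "p - 1" q \<theta>] powr_mono'[of "q - 1" q \<theta>] by simp_all
  then have "\<theta> powr q * (\<tau> powr (p - 1) / R powr (s * p)) \<le> \<theta> powr (p - 1) * (\<tau> powr (p - 1) / R powr (s * p))"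
    "\<theta> powr q * (b * (\<tau> powr (q - 1) / R powr (t * q))) \<le> \<theta> powr (q - 1) * (b * (\<tau> powr (q - 1) / R powr (t * q)))"
    using b by (auto intro!: mult_right_mono simp del: times_divide_eq_right)
  then show ?thesis unfolding h_def by (simp add: powr_mult algebra_simps)
qed

lemma H_meas [measurable]: "H \<in> borel_measurable borel"
  unfolding H_def[abs_def] by measurable

definition I :: "real \<Rightarrow> real \<Rightarrow> ennreal" where
  "I l r = (\<integral>\<^sup>+x. ennreal (H (max (u x - l) 0)) * indicator (ball x0 r) x \<partial>lebesgue)"

lemma integral_le_I:
  assumes "AE x in lebesgue. x \<in> ball x0 r \<longrightarrow> g x \<le> c * H (max (u x - l) 0)"
    and "0 \<le> c" "I l r \<le> ennreal A" "0 \<le> A"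
  shows "(\<integral>\<^sup>+x. ennreal (g x) * indicator (ball x0 r) x \<partial>lebesgue) \<le> ennreal (c * A)"
proof -
  have "(\<integral>\<^sup>+x. ennreal (g x) * indicator (ball x0 r) x \<partial>lebesgue)
    \<le> (\<integral>\<^sup>+x. ennreal c * (ennreal (H (max (u x - l) 0)) * indicator (ball x0 r) x) \<partial>lebesgue)"
  proof (rule nn_integral_mono_AE, use assms(1) in eventually_elim)
    case (elim x)
    then show ?case using assms(2) by (auto split: split_indicator simp: ennreal_leI simp flip: ennreal_mult')
  qed
  also have "\<dots> = ennreal c * I l r"
    unfolding I_def by (rule nn_integral_cmult) measurable
  also have "\<dots> \<le> ennreal c * ennreal A" using assms by (intro mult_left_mono) auto
  finally show ?thesis using assms by (simp add: ennreal_mult')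
qed

text \<open>\<open>A\<close> is used twice: Chebyshev turns it into a bound for the measure of the
  set where the truncated function is positive, Caccioppoli into a bound for its energy. Faber-Krahn
  multiplies the two, whence the total power \<open>1 + \<kappa>\<close>. The powers of \<eta> and
  \<theta> are the price of the radius gap and of the level gap.\<close>

lemma De_Giorgi_step:
  fixes l k \<theta> r r' A :: real
  assumes l: "k0 \<le> l" and k: "0 < k" "T \<le> h k" and \<theta>: "0 < \<theta>" "\<theta> \<le> 1"
    and r: "R / 2 \<le> r'" "r' < r" "r \<le> R" and A: "I l r \<le> ennreal A" "0 \<le> A"
  defines "\<eta> \<equiv> (r - r') / (2 * R)"
  shows "I (l + \<theta> * k) r'
    \<le> ennreal (C4 * \<eta> powr (- (real DIM('a) + q)) * \<theta> powr (- q * (1 + \<kappa>)) * (A / (R ^ DIM('a) * H k)) powr \<kappa> * A)"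
proof -
  \<comment> \<open>Half of the gap is the transition of the cutoff, which equals 1 on the ball of
    radius \<open>r'\<close>; the other half keeps its support away from the complement of
    \<open>ball x0 r\<close>.\<close>
  define d where "d = (r - r') / 2"
  have d: "0 < d" "d < r" "r - d - d = r'" using r R by (auto simp: d_def field_simps)
  have d\<eta>: "d = \<eta> * R" using R by (simp add: d_def \<eta>_def)
  have \<eta>: "0 < \<eta>" "\<eta> \<le> 1" using r R by (auto simp: \<eta>_def)
  define \<phi> where "\<phi> = cut x0 (r - d) d"
  define l' where "l' = l + \<theta> * k"
  define \<delta> where "\<delta> = \<theta> * k"
  have \<delta>: "0 < \<delta>" using \<theta> k by (simp add: \<delta>_def)
  have l': "l \<le> l'" "0 \<le> l'" "k0 \<le> l'" using \<theta> k l k0 by (auto simp: l'_def intro!: add_nonneg_nonneg order_trans[OF l])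
  interpret c: cutoff s t p q \<Lambda> \<Omega> Ksp Ktq a u x0 r d l' \<phi>
  proof
    show "ball x0 r \<subseteq> \<Omega>" using ball r by auto
    show "x \<notin> ball x0 (r - d) \<Longrightarrow> \<phi> x = 0" for x using d by (auto simp: \<phi>_def cut_eq_0)
  qed (use minimizer d l' cut_bounds in \<open>auto simp: \<phi>_def\<close>)
  have pos: "0 < p" "0 < q" using p pq by auto
  have w: "c.w x = max (u x - l') 0" for x by (rule c.w_def)
  have w_le: "c.w x \<le> max (u x - l) 0" for x using l' by (auto simp: w)
  have Hw: "H (c.w x) \<le> H (max (u x - l) 0)" for x using w_le by (intro H_mono) auto
  have wp: "c.w x powr p \<le> R powr (s * p) * H (c.w x)" for x
    using Rp b unfolding H_def by (simp add: distrib_left)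
  have wq: "b * c.w x powr q \<le> R powr (t * q) * H (c.w x)" for x
  proof -
    have "R powr (t * q) * H (c.w x) = R powr (t * q) * (c.w x powr p / R powr (s * p)) + b * c.w x powr q"
      using Rp[of "t * q"] R unfolding H_def by (simp add: distrib_left)
    moreover have "0 \<le> R powr (t * q) * (c.w x powr p / R powr (s * p))" by simp
    ultimately show ?thesis by linarith
  qed
  have sub: "ball x0 r \<subseteq> ball x0 R" using r by auto
  \<comment> \<open>The first summand bounds \<open>b * w powr q\<close> by the second phase of
    \<open>H\<close>; the second bounds \<open>osc * w powr q\<close> by the first phase, at the
    cost of \<open>M1 powr (q - p)\<close>.\<close>
  define e where "e = R powr (t * q) + osc * M1 powr (q - p) * R powr (s * p)"
  have e: "0 \<le> e" using osc by (auto simp: e_def intro!: add_nonneg_nonneg)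
  have wint_p: "c.wint p \<le> ennreal (R powr (s * p) * A)"
    unfolding c.wint_def
  proof (rule integral_le_I[OF _ _ A])
    show "AE x in lebesgue. x \<in> ball x0 r \<longrightarrow> c.w x powr p \<le> R powr (s * p) * H (max (u x - l) 0)"
      using wp Hw Rp[of "s * p"] by (intro AE_I2 impI) (meson less_imp_le mult_left_mono order_trans)
  qed simp
  have wint_q: "ennreal (b + osc) * c.wint q \<le> ennreal (e * A)"
  proof -
    have "ennreal (b + osc) * c.wint q
      = (\<integral>\<^sup>+x. ennreal (b + osc) * (ennreal (c.w x powr q) * indicator (ball x0 r) x) \<partial>lebesgue)"
      unfolding c.wint_def by (rule nn_integral_cmult[symmetric]) measurable
    also have "\<dots> = (\<integral>\<^sup>+x. ennreal ((b + osc) * c.w x powr q) * indicator (ball x0 r) x \<partial>lebesgue)"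
      using b osc by (simp add: ennreal_mult' mult.assoc)
    also have "\<dots> \<le> ennreal (e * A)"
    proof (rule integral_le_I[OF _ e A], use bounded in eventually_elim)
      case (elim x)
      show ?case
      proof
        assume "x \<in> ball x0 r"
        then have M: "c.w x \<le> M1" using elim sub l' M1 by (auto simp: w)
        have "c.w x powr q = c.w x powr (q - p) * c.w x powr p" by (simp flip: powr_add)
        also have "\<dots> \<le> M1 powr (q - p) * (R powr (s * p) * H (c.w x))"
          using M pq wp by (intro mult_mono powr_mono2) auto
        finally have "osc * c.w x powr q \<le> osc * (M1 powr (q - p) * (R powr (s * p) * H (c.w x)))"
          using osc by (intro mult_left_mono)
        then have "(b + osc) * c.w x powr q \<le> e * H (c.w x)"
          using wq[of x] by (simp add: e_def algebra_simps)
        also have "\<dots> \<le> e * H (max (u x - l) 0)" using Hw e by (intro mult_left_mono)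
        finally show "(b + osc) * c.w x powr q \<le> e * H (max (u x - l) 0)" .
      qed
    qed
    finally show ?thesis .
  qed
  have above: "\<delta> \<le> max (u x - l) 0" if "0 < c.w x" for x
    using that unfolding w by (simp add: l'_def \<delta>_def)
  \<comment> \<open>Where \<open>w\<close> is positive, \<open>u - l\<close> is at least \<delta>,
    so \<open>H (u - l) = (u - l) * h (u - l)\<close> is at least
    \<open>w * h \<delta>\<close>.\<close>
  have wint1: "c.wint1 \<le> ennreal (1 / h \<delta> * A)"
    unfolding c.wint1_def
  proof (rule integral_le_I[OF _ _ A], intro AE_I2 impI)
    fix x
    show "c.w x \<le> 1 / h \<delta> * H (max (u x - l) 0)"
    proof (cases "0 < c.w x")
      case True
      let ?m = "max (u x - l) 0"
      have "?m * h \<delta> \<le> ?m * h ?m" using above[OF True] \<delta> by (intro mult_left_mono h_mono) auto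
      moreover have "H ?m = ?m * h ?m" by (rule H_eq) simp
      ultimately have "?m \<le> H ?m / h \<delta>"
        by (simp only: pos_le_divide_eq[OF h_pos[OF \<delta>]])
      with w_le[of x] have "c.w x \<le> H ?m / h \<delta>" by (rule order_trans)
      then show ?thesis by simp
    next
      case False
      then have "c.w x = 0" using c.w_nonneg[of x] by linarith
      then show ?thesis by simp
    qed
  qed simp
  \<comment> \<open>The first bound is Chebyshev's. The volume of the ball keeps the ratio
    \<open>X\<close> bounded, so that powers of \<open>X\<close> beyond \<kappa> can be
    discarded.\<close>
  define V where "V = min (1 / H \<delta> * A) (unit_ball_vol (real DIM('a)) * R ^ DIM('a))"
  have V0: "0 \<le> V" using A R by (auto simp: V_def)
  have V: "emeasure lebesgue {x. 0 < c.f x} \<le> ennreal V"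
  proof -
    have S: "{x. 0 < c.f x} \<in> sets lebesgue" by (intro superlevel_sets_lebesgue) measurable
    have f: "x \<in> ball x0 r" "0 < c.w x" if "0 < c.f x" for x
    proof -
      have "\<phi> x \<noteq> 0" using that by (auto simp: c.f_def)
      then show "x \<in> ball x0 r" using c.\<phi>(3)[of x] d by (cases "x \<in> ball x0 (r - d)") auto
      show "0 < c.w x" using that c.w_nonneg[of x] by (cases "c.w x = 0") (auto simp: c.f_def less_le)
    qed
    have "emeasure lebesgue {x. 0 < c.f x} = (\<integral>\<^sup>+x. indicator {x. 0 < c.f x} x \<partial>lebesgue)"
      using S by simp
    also have "\<dots> = (\<integral>\<^sup>+x. ennreal (indicator {x. 0 < c.f x} x) * indicator (ball x0 r) x \<partial>lebesgue)"
      using f by (intro nn_integral_cong) (auto split: split_indicator)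
    also have "\<dots> \<le> ennreal (1 / H \<delta> * A)"
    proof (rule integral_le_I[OF _ _ A], intro AE_I2 impI)
      fix x
      show "indicator {x. 0 < c.f x} x \<le> 1 / H \<delta> * H (max (u x - l) 0)"
      proof (cases "0 < c.f x")
        case True
        then have "H \<delta> \<le> H (max (u x - l) 0)" using above f \<delta> by (intro H_mono) auto
        then show ?thesis using True H_pos[OF \<delta>] by simp
      qed simp
    qed simp
    finally have 1: "emeasure lebesgue {x. 0 < c.f x} \<le> ennreal (1 / H \<delta> * A)" .
    have "emeasure lebesgue {x. 0 < c.f x} \<le> emeasure lebesgue (ball x0 R)"
      using f sub by (intro emeasure_mono) auto
    then have "emeasure lebesgue {x. 0 < c.f x} \<le> ennreal (unit_ball_vol (real DIM('a)) * R ^ DIM('a))"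
      using R by (simp add: emeasure_ball)
    with 1 show ?thesis by (auto simp: V_def min_def)
  qed
  define E where "E = C3 * \<eta> powr (- (real DIM('a) + q)) * \<theta> powr (- q) * A"
  have E: "gagliardo s p c.f + ennreal b * gagliardo t q c.f \<le> ennreal E"
  proof -
    define Gp where "Gp = G1 * d powr (- (s * p))"
    define Gq where "Gq = G2 * d powr (- (t * q))"
    define Z where "Z = (r / d) powr (real DIM('a) + q) * T"
    have nn: "0 \<le> Gp" "0 \<le> Gq" "0 \<le> Z" using G12 T by (auto simp: Gp_def Gq_def Z_def)
    have tails: "far_tail s t p q a c.w x0 r x \<le> ennreal T" if "x \<in> ball x0 r" for x
    proof (rule order_trans[OF far_tail_mono])
      show "far_tail s t p q a (\<lambda>y. max (u y) 0) x0 (R / 2) x \<le> ennreal T" using that sub by (intro tail) auto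
    qed (use l' r p pq in \<open>auto simp: w\<close>)
    have "gagliardo s p c.f + ennreal b * gagliardo t q c.f
      \<le> ennreal (2 powr q * \<Lambda>\<^sup>2 * q powr q * 4) *
         (ennreal Gp * c.wint p + ennreal ((b + osc) * Gq) * c.wint q + ennreal Z * c.wint1)"
      unfolding Z_def
    proof (rule c.Caccioppoli)
      show "local_gag s p \<phi> x \<le> ennreal Gp" for x
        unfolding \<phi>_def Gp_def by (rule cut_local_gag[OF G1 d(1)])
      show "local_gag t q \<phi> x \<le> ennreal Gq" for x
        unfolding \<phi>_def Gq_def by (rule cut_local_gag[OF G2 d(1)])
      show "a (x, y) \<le> b + osc" "b \<le> a (x, y)" if "x \<in> ball x0 r" "y \<in> ball x0 r" for x y
        using a_lower[of x y] a_upper[of x y] sub that by blast+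
    qed (use nn b T tails in auto)
    also have "\<dots> \<le> ennreal (2 powr q * \<Lambda>\<^sup>2 * q powr q * 4) *
         (ennreal (Gp * (R powr (s * p) * A)) + ennreal (Gq * (e * A)) + ennreal (Z * (1 / h \<delta> * A)))"
    proof (intro mult_left_mono add_mono)
      show "ennreal Gp * c.wint p \<le> ennreal (Gp * (R powr (s * p) * A))"
        using mult_left_mono[OF wint_p, of "ennreal Gp"] nn by (simp add: ennreal_mult')
      have "ennreal ((b + osc) * Gq) * c.wint q = ennreal Gq * (ennreal (b + osc) * c.wint q)"
        using nn b osc by (simp add: ennreal_mult'' mult_ac)
      also have "\<dots> \<le> ennreal Gq * ennreal (e * A)" using wint_q by (intro mult_left_mono) auto
      finally show "ennreal ((b + osc) * Gq) * c.wint q \<le> ennreal (Gq * (e * A))"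
        using nn by (simp add: ennreal_mult')
      show "ennreal Z * c.wint1 \<le> ennreal (Z * (1 / h \<delta> * A))"
        unfolding ennreal_mult'[OF nn(3)] by (intro mult_left_mono wint1) simp
    qed auto
    also have "\<dots> = ennreal (2 powr q * \<Lambda>\<^sup>2 * q powr q * 4 *
         (Gp * (R powr (s * p) * A) + Gq * (e * A) + Z * (1 / h \<delta> * A)))"
      using nn e A(2) h_nonneg[of \<delta>] by (intro ennreal_mult_sum3) auto
    also have "\<dots> \<le> ennreal E"
    proof (rule ennreal_leI)
      let ?x = "\<eta> powr (- (real DIM('a) + q)) * \<theta> powr (- q)"
      have th1: "1 \<le> \<theta> powr (- q)"
        using \<theta> pos powr_mono'[of "- q" 0 \<theta>] by simp
      have et: "\<eta> powr (- c) \<le> ?x" if "c \<le> q" for c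
      proof -
        have "\<eta> powr (- c) \<le> \<eta> powr (- (real DIM('a) + q))" using that \<eta> by (intro powr_mono') auto
        also have "\<dots> \<le> ?x" using mult_left_mono[OF th1, of "\<eta> powr (- (real DIM('a) + q))"] by simp
        finally show ?thesis .
      qed
      note spq = exponent_bounds
      have dR: "d powr (- c) * R powr c = \<eta> powr (- c)" for c
        using R unfolding d\<eta> powr_mult by (simp add: powr_minus)
      have 1: "Gp * R powr (s * p) \<le> G1 * ?x"
        unfolding Gp_def mult.assoc dR using et[OF spq(1)] G12 by (intro mult_left_mono) auto
      have 2: "Gq * e \<le> G2 * (1 + K1 * M1 powr (q - p)) * ?x"
      proof -
        have "osc * R powr (s * p) \<le> K1 * R powr (t * q)"
        proof -
          have "osc * R powr (- (t * q)) * (R powr (t * q) * R powr (s * p))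
              \<le> K1 * R powr (- (s * p)) * (R powr (t * q) * R powr (s * p))"
            using osc by (intro mult_right_mono) auto
          then show ?thesis using R by (simp add: powr_minus field_simps)
        qed
        then have "M1 powr (q - p) * (osc * R powr (s * p)) \<le> M1 powr (q - p) * (K1 * R powr (t * q))"
          by (intro mult_left_mono) auto
        then have "e \<le> (1 + K1 * M1 powr (q - p)) * R powr (t * q)"
          by (simp add: e_def algebra_simps)
        then have "Gq * e \<le> Gq * ((1 + K1 * M1 powr (q - p)) * R powr (t * q))"
          using nn by (intro mult_left_mono)
        also have "\<dots> = G2 * (1 + K1 * M1 powr (q - p)) * (d powr (- (t * q)) * R powr (t * q))"
          by (simp add: Gq_def mult_ac)
        also have "\<dots> \<le> G2 * (1 + K1 * M1 powr (q - p)) * ?x"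
          unfolding dR using et[OF spq(2)] G12 K1 by (intro mult_left_mono) auto
        finally show ?thesis .
      qed
      \<comment> \<open>The tail is controlled by the full height \<open>k\<close>, whereas the
        linear term was divided by \<open>h \<delta>\<close> with
        \<open>\<delta> = \<theta> * k\<close>; scaling costs
        \<open>\<theta> powr (- q)\<close>.\<close>
      have 3: "Z * (1 / h \<delta>) \<le> ?x"
      proof -
        have "\<theta> powr q * T \<le> \<theta> powr q * h k" using k by (intro mult_left_mono) auto
        also have "\<dots> \<le> h \<delta>" unfolding \<delta>_def using \<theta> k by (intro h_scale) auto
        finally have "T \<le> \<theta> powr (- q) * h \<delta>"
          using \<theta> by (simp add: powr_minus field_simps)
        then have Th: "T * (1 / h \<delta>) \<le> \<theta> powr (- q)"
          using h_pos[OF \<delta>] by (simp add: field_simps)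
        have "r / d \<le> R / d" using r d by (intro divide_right_mono) auto
        also have "R / d = 1 / \<eta>" using R by (simp add: d\<eta>)
        finally have "(r / d) powr (real DIM('a) + q) \<le> (1 / \<eta>) powr (real DIM('a) + q)"
          using d pos by (intro powr_mono2) auto
        also have "\<dots> = \<eta> powr (- (real DIM('a) + q))" unfolding powr_divide divide_powr by simp
        finally have "(r / d) powr (real DIM('a) + q) * (T * (1 / h \<delta>)) \<le> ?x"
          using Th T by (intro mult_mono) auto
        then show ?thesis by (simp add: Z_def mult.assoc)
      qed
      have "Gp * (R powr (s * p) * A) + Gq * (e * A) + Z * (1 / h \<delta> * A)
        = (Gp * R powr (s * p) + Gq * e + Z * (1 / h \<delta>)) * A" by (simp add: algebra_simps)
      also have "\<dots> \<le> ((G1 + G2 * (1 + K1 * M1 powr (q - p)) + 1) * ?x) * A"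
        using 1 2 3 A by (intro mult_right_mono) (auto simp: distrib_right)
      finally have "2 powr q * \<Lambda>\<^sup>2 * q powr q * 4 * (Gp * (R powr (s * p) * A) + Gq * (e * A) + Z * (1 / h \<delta> * A))
        \<le> 2 powr q * \<Lambda>\<^sup>2 * q powr q * 4 * (((G1 + G2 * (1 + K1 * M1 powr (q - p)) + 1) * ?x) * A)"
        by (intro mult_left_mono) auto
      also have "\<dots> = E" by (simp add: E_def C3_def energy_const_def)
      finally show "2 powr q * \<Lambda>\<^sup>2 * q powr q * 4 * (Gp * (R powr (s * p) * A) + Gq * (e * A) + Z * (1 / h \<delta> * A)) \<le> E" .
    qed
    finally show ?thesis .
  qed
  have E0: "0 \<le> E" using C3 A by (simp add: E_def)
  define X where "X = V / R ^ DIM('a)"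
  have X: "0 \<le> X" "X \<le> unit_ball_vol (real DIM('a))" using V0 R by (auto simp: X_def V_def field_simps)
  define cs where "cs = sob_const TYPE('a) s p + sob_const TYPE('a) t q"
  have cs: "0 < sob_const TYPE('a) s p" "0 < sob_const TYPE('a) t q" by (rule sob_const_pos)+
  define S where "S = cs * (1 + unit_ball_vol (real DIM('a))) powr q * X powr \<kappa>"
  \<comment> \<open>Written in terms of \<open>X = V / R ^ n\<close>, the Faber-Krahn gain divided
    by the weight of its phase in \<open>H\<close> no longer contains \<open>R\<close>.\<close>
  have Xe: "V powr (c / real DIM('a)) / R powr c \<le> (1 + unit_ball_vol (real DIM('a))) powr q * X powr \<kappa>"
    if c: "\<kappa> \<le> c / real DIM('a)" "c \<le> q" "0 \<le> c" for c
  proof -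
    have "R powr c = (R ^ DIM('a)) powr (c / real DIM('a))"
      using R by (simp add: powr_powr flip: powr_realpow)
    then have "V powr (c / real DIM('a)) / R powr c = X powr (c / real DIM('a))"
      by (simp add: X_def powr_divide)
    also have "\<dots> = X powr (c / real DIM('a) - \<kappa>) * X powr \<kappa>" by (simp flip: powr_add)
    also have "\<dots> \<le> (1 + unit_ball_vol (real DIM('a))) powr q * X powr \<kappa>"
    proof (intro mult_right_mono)
      have "X powr (c / real DIM('a) - \<kappa>) \<le> (1 + unit_ball_vol (real DIM('a))) powr (c / real DIM('a) - \<kappa>)" using X c by (intro powr_mono2) auto
      also have "\<dots> \<le> (1 + unit_ball_vol (real DIM('a))) powr q"
      proof (rule powr_mono)
        have "c / real DIM('a) \<le> c / 1" using c by (intro divide_left_mono) auto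
        then show "c / real DIM('a) - \<kappa> \<le> q" using c \<kappa>(1) by simp
      qed simp
      finally show "X powr (c / real DIM('a) - \<kappa>) \<le> (1 + unit_ball_vol (real DIM('a))) powr q" .
    qed simp
    finally show ?thesis .
  qed
  note spq = exponent_bounds
  have main: "I l' r' \<le> ennreal S * (gagliardo s p c.f + ennreal b * gagliardo t q c.f)"
  proof -
    have "I l' r' \<le> (\<integral>\<^sup>+x. ennreal (1 / R powr (s * p)) * ennreal (c.f x powr p)
         + ennreal (b / R powr (t * q)) * ennreal (c.f x powr q) \<partial>lebesgue)"
      unfolding I_def
    proof (rule nn_integral_mono)
      fix x
      show "ennreal (H (max (u x - l') 0)) * indicator (ball x0 r') x
        \<le> ennreal (1 / R powr (s * p)) * ennreal (c.f x powr p)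
         + ennreal (b / R powr (t * q)) * ennreal (c.f x powr q)"
      proof (cases "x \<in> ball x0 r'")
        case True
        then have "\<phi> x = 1" using d cut_eq_1[of d x x0 "r - d"] by (simp add: \<phi>_def)
        then have "c.f x = max (u x - l') 0" by (simp add: c.f_def w)
        then have "H (max (u x - l') 0) = 1 / R powr (s * p) * c.f x powr p + b / R powr (t * q) * c.f x powr q"
          by (simp add: H_def)
        then show ?thesis using True b by (simp only: ennreal_mult' ennreal_plus) (simp flip: ennreal_mult' ennreal_plus)
      qed simp
    qed
    also have "\<dots> = ennreal (1 / R powr (s * p)) * (\<integral>\<^sup>+x. ennreal (c.f x powr p) \<partial>lebesgue)
         + ennreal (b / R powr (t * q)) * (\<integral>\<^sup>+x. ennreal (c.f x powr q) \<partial>lebesgue)"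
      by (subst nn_integral_add) (auto simp: nn_integral_cmult)
    also have "\<dots> \<le> ennreal (1 / R powr (s * p)) * (ennreal (sob_const TYPE('a) s p * V powr (s * p / real DIM('a))) * gagliardo s p c.f)
         + ennreal (b / R powr (t * q)) * (ennreal (sob_const TYPE('a) t q * V powr (t * q / real DIM('a))) * gagliardo t q c.f)"
      using s t p pq V by (intro add_mono mult_left_mono Faber_Krahn) auto
    also have "\<dots> = ennreal (sob_const TYPE('a) s p * (V powr (s * p / real DIM('a)) / R powr (s * p))) * gagliardo s p c.f
         + ennreal (sob_const TYPE('a) t q * (V powr (t * q / real DIM('a)) / R powr (t * q))) * (ennreal b * gagliardo t q c.f)"
    proof -
      have r1: "1 / R powr (s * p) * (sob_const TYPE('a) s p * V powr (s * p / real DIM('a)))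
          = sob_const TYPE('a) s p * (V powr (s * p / real DIM('a)) / R powr (s * p))" by simp
      have r2: "b / R powr (t * q) * (sob_const TYPE('a) t q * V powr (t * q / real DIM('a)))
          = sob_const TYPE('a) t q * (V powr (t * q / real DIM('a)) / R powr (t * q)) * b" by simp
      show ?thesis
        unfolding mult.assoc[symmetric] using b cs
        by (subst (1 2 3) ennreal_mult'[symmetric], simp, simp, simp) (simp only: r1 r2)
    qed
    also have "\<dots> \<le> ennreal S * gagliardo s p c.f + ennreal S * (ennreal b * gagliardo t q c.f)"
    proof (intro add_mono mult_right_mono ennreal_leI)
      have "sob_const TYPE('a) s p * (V powr (s * p / real DIM('a)) / R powr (s * p)) \<le> cs * ((1 + unit_ball_vol (real DIM('a))) powr q * X powr \<kappa>)"
        using cs \<kappa> spq by (intro mult_mono Xe) (auto simp: cs_def)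
      then show "sob_const TYPE('a) s p * (V powr (s * p / real DIM('a)) / R powr (s * p)) \<le> S" by (simp add: S_def)
      have "sob_const TYPE('a) t q * (V powr (t * q / real DIM('a)) / R powr (t * q)) \<le> cs * ((1 + unit_ball_vol (real DIM('a))) powr q * X powr \<kappa>)"
        using cs \<kappa> spq by (intro mult_mono Xe) (auto simp: cs_def)
      then show "sob_const TYPE('a) t q * (V powr (t * q / real DIM('a)) / R powr (t * q)) \<le> S" by (simp add: S_def)
    qed auto
    finally show ?thesis by (simp add: distrib_left)
  qed
  have S0: "0 \<le> S" using cs by (simp add: S_def cs_def)
  have "I l' r' \<le> ennreal S * ennreal E" using main mult_left_mono[OF E, of "ennreal S"] by auto
  also have "\<dots> = ennreal (S * E)" using S0 by (simp add: ennreal_mult')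
  also have "\<dots> \<le> ennreal (C4 * \<eta> powr (- (real DIM('a) + q)) * \<theta> powr (- q * (1 + \<kappa>)) * (A / (R ^ DIM('a) * H k)) powr \<kappa> * A)"
  proof (rule ennreal_leI)
    have "X \<le> (1 / H \<delta> * A) / R ^ DIM('a)" unfolding X_def using R by (intro divide_right_mono) (auto simp: V_def)
    also have "\<dots> \<le> (1 / (\<theta> powr q * H k) * A) / R ^ DIM('a)"
      using R A \<theta> k H_pos H_scale[of \<theta> k]
      by (intro divide_right_mono mult_right_mono divide_left_mono) (auto simp: \<delta>_def)
    also have "\<dots> = \<theta> powr (- q) * (A / (R ^ DIM('a) * H k))"
      by (simp add: powr_minus field_simps)
    finally have "X powr \<kappa> \<le> (\<theta> powr (- q) * (A / (R ^ DIM('a) * H k))) powr \<kappa>"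
      using X \<kappa> by (intro powr_mono2) auto
    also have "\<dots> = \<theta> powr (- q * \<kappa>) * (A / (R ^ DIM('a) * H k)) powr \<kappa>"
      unfolding powr_mult powr_powr ..
    finally have "S \<le> cs * (1 + unit_ball_vol (real DIM('a))) powr q * (\<theta> powr (- q * \<kappa>) * (A / (R ^ DIM('a) * H k)) powr \<kappa>)"
      unfolding S_def using cs by (intro mult_left_mono) (auto simp: cs_def)
    then have "S * E \<le> cs * (1 + unit_ball_vol (real DIM('a))) powr q * (\<theta> powr (- q * \<kappa>) * (A / (R ^ DIM('a) * H k)) powr \<kappa>) * E"
      using E0 by (intro mult_right_mono)
    also have "\<dots> = C4 * \<eta> powr (- (real DIM('a) + q)) * (\<theta> powr (- q * \<kappa>) * \<theta> powr (- q)) * (A / (R ^ DIM('a) * H k)) powr \<kappa> * A"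
      by (simp only: E_def C4_def C3_def dg_const_def cs_def mult_ac)
    also have "\<theta> powr (- q * \<kappa>) * \<theta> powr (- q) = \<theta> powr (- q * (1 + \<kappa>))"
      by (simp add: algebra_simps flip: powr_add)
    finally show "S * E \<le> C4 * \<eta> powr (- (real DIM('a) + q)) * \<theta> powr (- q * (1 + \<kappa>)) * (A / (R ^ DIM('a) * H k)) powr \<kappa> * A" .
  qed
  finally show ?thesis by (simp add: l'_def)
qed

end

section \<open>Iteration over levels, and interpolation over radii\<close>

definition dg_ratio :: "'a::euclidean_space itself \<Rightarrow> real \<Rightarrow> real \<Rightarrow> real" where
  "dg_ratio _ q \<kappa> = 2 powr (real DIM('a) + q + q * (1 + \<kappa>))"

text \<open>The threshold of \<open>fast_geometric_convergence\<close> for unit radius gap. With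
  gaps \<Delta>, step \<open>j\<close> has \<open>\<eta> = \<Delta> / 4 * (1/2) ^ j\<close> and
  \<open>\<theta> = (1/2) ^ Suc j\<close>: the 4 and the shift by one give the explicit factors, and
  the powers of \<open>2 ^ j\<close> give \<open>dg_ratio\<close>.\<close>

definition dg_threshold :: "'a::euclidean_space itself \<Rightarrow> real \<Rightarrow> real \<Rightarrow> real \<Rightarrow> real" where
  "dg_threshold T q \<kappa> C =
     (C * 4 powr (real DIM('a) + q) * 2 powr (q * (1 + \<kappa>))) powr (- 1 / \<kappa>)
       * dg_ratio T q \<kappa> powr (- 1 / \<kappa>\<^sup>2)"

text \<open>\<mu> is chosen so that \<open>\<mu> powr \<gamma> = 2 powr (- e)\<close>: radius gaps
  proportional to \<open>\<mu> ^ i\<close> then lower the smallness threshold exactly as fast as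
  doubling the height lowers the normalised moment. The base is the value of \<open>D powr e\<close>
  that makes the two sides balance; \<open>2 powr q\<close> pays for halving the argument of
  \<open>H\<close>.\<close>

definition sup_const :: "'a::euclidean_space itself \<Rightarrow> real \<Rightarrow> real \<Rightarrow> real \<Rightarrow> real \<Rightarrow> real" where
  "sup_const T q \<kappa> C e =
     (let \<gamma> = (real DIM('a) + q) / \<kappa>; \<mu> = 2 powr (- e / \<gamma>)
      in (2 powr q * unit_ball_vol (real DIM('a)) / dg_threshold T q \<kappa> C * ((1 - \<mu>) / 2) powr (- \<gamma>)) powr (1 / e))"

context De_Giorgi
begin

lemma pos: "0 < p" "0 < q" "0 < real DIM('a) + q" "1 \<le> q"
  using p pq by auto

lemma I_finite:
  assumes "k0 \<le> l" "r \<le> R"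
  shows "I l r < \<infinity>"
proof -
  have "I l r \<le> (\<integral>\<^sup>+x. ennreal (H M1) * indicator (ball x0 R) x \<partial>lebesgue)"
    unfolding I_def
  proof (rule nn_integral_mono_AE, use bounded in eventually_elim)
    case (elim x)
    have "H (max (u x - l) 0) \<le> H M1" if "x \<in> ball x0 r"
      using elim that assms M1 by (intro H_mono) auto
    then show ?case using assms by (auto split: split_indicator simp: ennreal_leI)
  qed
  also have "\<dots> = ennreal (H M1) * emeasure lebesgue (ball x0 R)"
    by (rule nn_integral_cmult_indicator) measurable
  also have "\<dots> < \<infinity>" using R by (simp add: emeasure_ball ennreal_mult_less_top)
  finally show ?thesis .
qed

lemma I_antimono: "l \<le> l' \<Longrightarrow> r' \<le> r \<Longrightarrow> I l' r' \<le> I l r"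
  unfolding I_def by (intro nn_integral_mono mult_mono ennreal_leI H_mono) (auto split: split_indicator)

text \<open>Levels rise from \<open>k0\<close> to \<open>k0 + k\<close> and radii shrink from
  \<open>\<sigma> * R\<close> to \<open>\<sigma>' * R\<close>, with gaps halved at each step. The
  total radius gap enters the recursion as a power \<open>- N\<close> in the constant, so the
  threshold acquires the power \<open>N / \<kappa>\<close>.\<close>

lemma sup_bound:
  fixes k \<sigma>' \<sigma> A :: real
  assumes k: "0 < k" "T \<le> h k" and \<sigma>: "1 / 2 \<le> \<sigma>'" "\<sigma>' < \<sigma>" "\<sigma> \<le> 1"
    and A: "I k0 (\<sigma> * R) \<le> ennreal A" "0 \<le> A"
    and small: "A / (R ^ DIM('a) * H k)
      \<le> dg_threshold TYPE('a) q \<kappa> C4 * (\<sigma> - \<sigma>') powr ((real DIM('a) + q) / \<kappa>)"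
  shows "AE x in lebesgue. x \<in> ball x0 (\<sigma>' * R) \<longrightarrow> u x - k0 \<le> k"
proof -
  define N where "N = real DIM('a) + q"
  define \<Delta> where "\<Delta> = \<sigma> - \<sigma>'"
  have \<Delta>: "0 < \<Delta>" using \<sigma> by (simp add: \<Delta>_def)
  define r where "r j = (\<sigma>' + \<Delta> * (1/2) ^ j) * R" for j :: nat
  define l where "l j = k0 + k * (1 - (1/2) ^ j)" for j :: nat
  define B where "B = dg_ratio TYPE('a) q \<kappa>"
  define C where "C = C4 * 4 powr N * 2 powr (q * (1 + \<kappa>)) * \<Delta> powr (- N)"
  define c where "c = R ^ DIM('a) * H k"
  have c: "0 < c" using R H_pos k by (simp add: c_def)
  \<comment> \<open>This normalisation makes the ratio occurring in \<open>De_Giorgi_step\<close>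
    equal to \<open>Y j\<close> itself.\<close>
  define Y where "Y j = enn2real (I (l j) (r j)) / c" for j
  have r: "R / 2 \<le> r j" "r j \<le> R" "r (Suc j) < r j" "\<sigma>' * R \<le> r j" for j
  proof -
    have h1: "0 < (1/2::real) ^ j" "(1/2::real) ^ j \<le> 1" by (auto intro: power_le_one)
    have "\<sigma>' \<le> \<sigma>' + \<Delta> * (1/2) ^ j" using \<Delta> by simp
    moreover have "\<sigma>' + \<Delta> * (1/2) ^ j \<le> \<sigma>' + \<Delta> * 1" using \<Delta> h1 by (intro add_left_mono mult_left_mono) auto
    ultimately have "1/2 \<le> \<sigma>' + \<Delta> * (1/2) ^ j" "\<sigma>' + \<Delta> * (1/2) ^ j \<le> 1" "\<sigma>' \<le> \<sigma>' + \<Delta> * (1/2) ^ j"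
      using \<sigma> \<Delta>_def by linarith+
    then have "(1/2) * R \<le> r j" "r j \<le> 1 * R" "\<sigma>' * R \<le> r j"
      unfolding r_def using R by - (rule mult_right_mono; simp)+
    then show "R / 2 \<le> r j" "r j \<le> R" "\<sigma>' * R \<le> r j" by auto
    show "r (Suc j) < r j" unfolding r_def using R \<Delta> h1 by (intro mult_strict_right_mono) auto
  qed
  have l: "k0 \<le> l j" "l (Suc j) = l j + (1/2) ^ Suc j * k" "l j \<le> k0 + k" for j
    using k by (auto simp: l_def power_le_one algebra_simps)
  have IY: "I (l j) (r j) = ennreal (c * Y j)" "0 \<le> Y j" for j
  proof -
    show "0 \<le> Y j" using c by (simp add: Y_def)
    show "I (l j) (r j) = ennreal (c * Y j)"
      using I_finite[OF l(1) r(2)] c by (simp add: Y_def)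
  qed
  note pw = half_power_powr
  have step: "Y (Suc j) \<le> C * B ^ j * Y j powr (1 + \<kappa>)" for j
  proof -
    define \<eta> where "\<eta> = (r j - r (Suc j)) / (2 * R)"
    define \<theta> where "\<theta> = (1/2::real) ^ Suc j"
    have \<theta>1: "0 < \<theta>" "\<theta> \<le> 1"
      unfolding \<theta>_def by (rule zero_less_power, simp, rule power_le_one) auto
    have \<eta>: "\<eta> = \<Delta> / 4 * (1/2) ^ j" using R by (simp add: \<eta>_def r_def field_simps)
    have "I (l j + \<theta> * k) (r (Suc j))
      \<le> ennreal (C4 * \<eta> powr (- (real DIM('a) + q)) * \<theta> powr (- q * (1 + \<kappa>)) * (c * Y j / (R ^ DIM('a) * H k)) powr \<kappa> * (c * Y j))"
      unfolding \<eta>_def using l r IY k c \<theta>1 by (intro De_Giorgi_step) auto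
    also have "c * Y j / (R ^ DIM('a) * H k) = Y j" using c by (simp flip: c_def)
    finally have "ennreal (c * Y (Suc j))
      \<le> ennreal (c * (C4 * \<eta> powr (- N) * \<theta> powr (- q * (1 + \<kappa>)) * (Y j powr \<kappa> * Y j)))"
      unfolding IY(1)[symmetric] l(2) \<theta>_def N_def by (simp add: mult_ac)
    then have "c * Y (Suc j) \<le> c * (C4 * \<eta> powr (- N) * \<theta> powr (- q * (1 + \<kappa>)) * (Y j powr \<kappa> * Y j))"
      using C4 c IY(2)[of j] by (subst (asm) ennreal_le_iff) auto
    then have "Y (Suc j) \<le> C4 * \<eta> powr (- N) * \<theta> powr (- q * (1 + \<kappa>)) * (Y j powr \<kappa> * Y j)"
      using c by simp
    also have "Y j powr \<kappa> * Y j = Y j powr (1 + \<kappa>)"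
      using IY(2)[of j] by (cases "Y j = 0") (auto simp: powr_add)
    also have "\<theta> powr (- q * (1 + \<kappa>)) = (2 powr (q * (1 + \<kappa>))) ^ j * 2 powr (q * (1 + \<kappa>))"
      unfolding \<theta>_def using pw[of "Suc j" "q * (1 + \<kappa>)"] by simp
    also have "\<eta> powr (- N) = \<Delta> powr (- N) * 4 powr N * (2 powr N) ^ j"
      unfolding \<eta> powr_mult pw unfolding powr_divide divide_powr by simp
    also have "C4 * (\<Delta> powr (- N) * 4 powr N * (2 powr N) ^ j) * ((2 powr (q * (1 + \<kappa>))) ^ j * 2 powr (q * (1 + \<kappa>))) * Y j powr (1 + \<kappa>)
      = C * (2 powr N * 2 powr (q * (1 + \<kappa>))) ^ j * Y j powr (1 + \<kappa>)"
      by (simp add: C_def power_mult_distrib mult_ac)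
    also have "2 powr N * 2 powr (q * (1 + \<kappa>)) = B"
      by (simp add: B_def dg_ratio_def N_def flip: powr_add)
    finally show ?thesis .
  qed
  have B: "1 < B"
  proof -
    have "0 < real DIM('a) + q + q * (1 + \<kappa>)" using pos \<kappa> by (intro add_pos_pos mult_pos_pos) auto
    then show ?thesis using powr_less_mono[of 0 "real DIM('a) + q + q * (1 + \<kappa>)" 2]
      by (simp add: B_def dg_ratio_def)
  qed
  have "Y \<longlonglongrightarrow> 0"
  proof (rule fast_geometric_convergence[OF IY(2) _ B \<kappa>(1) step])
    show "0 < C" using C4 \<Delta> by (simp add: C_def)
    have "Y 0 \<le> A / c"
    proof -
      have "r 0 = \<sigma> * R" "l 0 = k0" by (simp_all add: r_def l_def \<Delta>_def)
      then have "enn2real (I (l 0) (r 0)) \<le> A" using A by (simp add: enn2real_leI)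
      then show ?thesis using c by (simp add: Y_def divide_right_mono)
    qed
    also have "\<dots> \<le> dg_threshold TYPE('a) q \<kappa> C4 * \<Delta> powr (N / \<kappa>)"
      using small by (simp add: c_def \<Delta>_def N_def)
    also have "\<dots> = C powr (- 1 / \<kappa>) * B powr (- 1 / \<kappa>\<^sup>2)"
    proof -
      have "(\<Delta> powr (- N)) powr (- 1 / \<kappa>) = \<Delta> powr (N / \<kappa>)" by (simp add: powr_powr)
      then show ?thesis
        unfolding C_def powr_mult[of _ "\<Delta> powr (- N)"] dg_threshold_def B_def[symmetric] N_def[symmetric]
        by simp
    qed
    finally show "Y 0 \<le> C powr (- 1 / \<kappa>) * B powr (- 1 / \<kappa>\<^sup>2)" .
  qed
  then have "(\<lambda>j. ennreal (c * Y j)) \<longlonglongrightarrow> ennreal (c * 0)"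
    by (intro tendsto_ennrealI tendsto_mult tendsto_const)
  moreover have "I (k0 + k) (\<sigma>' * R) \<le> ennreal (c * Y j)" for j
    unfolding IY(1)[symmetric] by (rule I_antimono[OF l(3) r(4)])
  ultimately have "I (k0 + k) (\<sigma>' * R) \<le> ennreal (c * 0)"
    by (intro LIMSEQ_le_const) auto
  then have "I (k0 + k) (\<sigma>' * R) = 0" by simp
  then have "AE x in lebesgue. ennreal (H (max (u x - (k0 + k)) 0)) * indicator (ball x0 (\<sigma>' * R)) x = 0"
    unfolding I_def by (subst (asm) nn_integral_0_iff_AE) auto
  then show ?thesis
  proof eventually_elim
    case (elim x)
    show ?case
    proof
      assume "x \<in> ball x0 (\<sigma>' * R)"
      then have "H (max (u x - (k0 + k)) 0) = 0" using elim by (simp add: ennreal_eq_0_iff order_antisym)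
      then have "\<not> 0 < max (u x - (k0 + k)) 0" using H_pos by (metis less_irrefl)
      then show "u x - k0 \<le> k" by auto
    qed
  qed
qed

lemma threshold_pos: "0 < dg_threshold TYPE('a) q \<kappa> C4"
  using C4 unfolding dg_threshold_def dg_ratio_def by (intro mult_pos_pos) auto

text \<open>For a ratio \<open>\<tau> / c \<le> 1\<close> lowering the exponents \<open>p\<close>
  and \<open>q\<close> to \<open>e\<close> only increases the powers. Thus a known bound
  \<open>c\<close> converts a moment of order \<open>e\<close> into a bound for the energy built
  from \<open>H\<close>.\<close>

lemma power_bound:
  fixes e c \<tau> :: real
  assumes e: "0 < e" "e \<le> p" and \<tau>: "0 \<le> \<tau>" "\<tau> \<le> c" "0 < c"
  shows "H \<tau> \<le> (\<tau> / c) powr e * H c"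
proof -
  have x: "0 \<le> \<tau> / c" "\<tau> / c \<le> 1" using \<tau> by auto
  have "H \<tau> = (\<tau> / c) powr p * (c powr p / R powr (s * p)) + (\<tau> / c) powr q * (b * (c powr q / R powr (t * q)))"
    using \<tau> unfolding H_def powr_divide by simp
  also have "\<dots> \<le> (\<tau> / c) powr e * (c powr p / R powr (s * p)) + (\<tau> / c) powr e * (b * (c powr q / R powr (t * q)))"
    using x e pq b by (intro add_mono mult_right_mono powr_mono') auto
  finally show ?thesis unfolding H_def by (simp add: distrib_left)
qed

text \<open>A bound \<open>c\<close> for \<open>u - k0\<close> on one ball, combined with the moment
  \<open>X\<close>, makes the energy small relative to \<open>H (c / 2)\<close> as soon as
  \<open>c\<close> exceeds a multiple of \<open>X\<close>. \<open>sup_bound\<close> then halves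
  \<open>c\<close> on the next smaller ball, down to the size dictated by the tail.\<close>

lemma local_bound:
  fixes e X hT :: real
  assumes e: "0 < e" "e \<le> p" and X: "0 \<le> X"
    "(\<integral>\<^sup>+x. ennreal (max (u x) 0 powr e) * indicator (ball x0 R) x \<partial>lebesgue)
      \<le> ennreal (unit_ball_vol (real DIM('a)) * R ^ DIM('a) * X powr e)"
    and hT: "0 \<le> hT" "T \<le> h hT"
  shows "AE x in lebesgue. x \<in> ball x0 (R / 2) \<longrightarrow>
    u x - k0 \<le> hT + sup_const TYPE('a) q \<kappa> C4 e * X"
proof -
  define \<omega> where "\<omega> = unit_ball_vol (real DIM('a))"
  define \<gamma> where "\<gamma> = (real DIM('a) + q) / \<kappa>"
  define \<mu> where "\<mu> = 2 powr (- e / \<gamma>)"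
  define \<epsilon> where "\<epsilon> = dg_threshold TYPE('a) q \<kappa> C4"
  define D where "D = sup_const TYPE('a) q \<kappa> C4 e"
  have \<omega>: "0 < \<omega>" by (simp add: \<omega>_def)
  have \<epsilon>: "0 < \<epsilon>" unfolding \<epsilon>_def by (rule threshold_pos)
  have \<gamma>: "0 < \<gamma>" using pos \<kappa> by (simp add: \<gamma>_def)
  have \<mu>: "0 < \<mu>" "\<mu> < 1" using \<gamma> e powr_less_mono[of "- e / \<gamma>" 0 2] by (auto simp: \<mu>_def)
  have D_def': "D = (2 powr q * \<omega> / \<epsilon> * ((1 - \<mu>) / 2) powr (- \<gamma>)) powr (1 / e)"
    by (simp add: D_def sup_const_def Let_def \<omega>_def \<gamma>_def \<mu>_def \<epsilon>_def)
  have D: "0 < D" "D powr e = 2 powr q * \<omega> / \<epsilon> * ((1 - \<mu>) / 2) powr (- \<gamma>)"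
  proof -
    define Z where "Z = 2 powr q * \<omega> / \<epsilon> * ((1 - \<mu>) / 2) powr (- \<gamma>)"
    have "0 < Z" unfolding Z_def using \<omega> \<epsilon> \<mu> by simp
    then show "0 < D" "D powr e = 2 powr q * \<omega> / \<epsilon> * ((1 - \<mu>) / 2) powr (- \<gamma>)"
      unfolding D_def' Z_def[symmetric] using e by (simp_all add: powr_powr)
  qed
  define \<sigma> where "\<sigma> i = 1 - \<mu> ^ i / 2" for i :: nat
  have \<sigma>: "1 / 2 \<le> \<sigma> i" "\<sigma> i < \<sigma> (Suc i)" "\<sigma> i \<le> 1" "\<sigma> (Suc i) - \<sigma> i = \<mu> ^ i * ((1 - \<mu>) / 2)" for i
    using \<mu> by (auto simp: \<sigma>_def power_le_one field_simps)
  define Q where "Q i c \<longleftrightarrow> (AE x in lebesgue. x \<in> ball x0 (\<sigma> i * R) \<longrightarrow> u x - k0 \<le> c)" for i :: nat and c :: real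
  have Q_mono: "Q i c'" if "Q i c" "c \<le> c'" for i c c'
    using that(1) unfolding Q_def by eventually_elim (use that(2) in force)
  \<comment> \<open>If \<open>c\<close> is already at most \<open>D * 2 ^ i * X\<close>,
    monotonicity in the radius suffices; otherwise \<open>k = max (c / 2) hT\<close> satisfies both
    requirements of \<open>sup_bound\<close>.\<close>
  have step: "Q i (max (c / 2) (max hT (D * 2 ^ i * X)))" if Qc: "Q (Suc i) c" and c: "0 < c" for i c
  proof (cases "c \<le> D * 2 ^ i * X")
    case True
    have le: "\<sigma> i * R \<le> \<sigma> (Suc i) * R" using \<sigma>(2)[of i] R by simp
    have "Q i c" using Qc unfolding Q_def by eventually_elim (use le in auto)
    then show ?thesis by (rule Q_mono) (use True in auto)
  next
    case False
    define k where "k = max (c / 2) hT"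
    have k: "0 < k" using c by (simp add: k_def)
    have Tk: "T \<le> h k" using hT h_mono[of hT k] by (simp add: k_def)
    define A where "A = c powr (- e) * H c * (\<omega> * R ^ DIM('a) * X powr e)"
    have A0: "0 \<le> A" using \<omega> R by (simp add: A_def)
    have IA: "I k0 (\<sigma> (Suc i) * R) \<le> ennreal A"
    proof -
      have "I k0 (\<sigma> (Suc i) * R) \<le> (\<integral>\<^sup>+x. ennreal (c powr (- e) * H c) *
          (ennreal (max (u x) 0 powr e) * indicator (ball x0 R) x) \<partial>lebesgue)"
        unfolding I_def
      proof (rule nn_integral_mono_AE, use Qc[unfolded Q_def] in eventually_elim)
        case (elim x)
        have "H (max (u x - k0) 0) \<le> c powr (- e) * H c * max (u x) 0 powr e"
          if "x \<in> ball x0 (\<sigma> (Suc i) * R)"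
        proof -
          have "H (max (u x - k0) 0) \<le> (max (u x - k0) 0 / c) powr e * H c"
            using elim that c by (intro power_bound[OF e]) auto
          also have "\<dots> \<le> (max (u x) 0 / c) powr e * H c"
            using k0 c e by (intro mult_right_mono powr_mono2 divide_right_mono) auto
          also have "\<dots> = c powr (- e) * H c * max (u x) 0 powr e"
            unfolding powr_divide divide_powr by simp
          finally show ?thesis .
        qed
        moreover have "ball x0 (\<sigma> (Suc i) * R) \<subseteq> ball x0 R"
          using \<sigma>(3)[of "Suc i"] R mult_right_mono[of "\<sigma> (Suc i)" 1 R] by (intro subset_ball) simp
        ultimately show ?case
          by (auto split: split_indicator simp: ennreal_leI simp flip: ennreal_mult')
      qed
      also have "\<dots> = ennreal (c powr (- e) * H c) *
          (\<integral>\<^sup>+x. ennreal (max (u x) 0 powr e) * indicator (ball x0 R) x \<partial>lebesgue)"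
        by (rule nn_integral_cmult) measurable
      also have "\<dots> \<le> ennreal (c powr (- e) * H c) * ennreal (\<omega> * R ^ DIM('a) * X powr e)"
        using X unfolding \<omega>_def by (intro mult_left_mono) auto
      also have "\<dots> = ennreal A"
      proof -
        have "0 \<le> c powr (- e) * H c" by simp
        from ennreal_mult'[OF this] show ?thesis unfolding A_def by simp
      qed
      finally show ?thesis .
    qed
    have "A / (R ^ DIM('a) * H k) \<le> \<epsilon> * (\<sigma> (Suc i) - \<sigma> i) powr \<gamma>"
    proof -
      have "2 powr (- q) * H c = (1 / 2) powr q * H c" unfolding powr_divide divide_powr by simp
      also have "\<dots> \<le> H (1 / 2 * c)" using c by (intro H_scale) auto
      also have "\<dots> \<le> H k" using c by (intro H_mono) (auto simp: k_def)
      finally have Hc: "H c \<le> 2 powr q * H k" by (simp add: powr_minus field_simps)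
      have "A / (R ^ DIM('a) * H k) = c powr (- e) * \<omega> * X powr e * (H c / H k)"
        using R by (simp add: A_def)
      also have "\<dots> \<le> c powr (- e) * \<omega> * X powr e * 2 powr q"
        using Hc H_pos[OF k] \<omega> by (intro mult_left_mono) (auto simp: field_simps)
      also have "\<dots> = (2 powr q * \<omega>) * (X / c) powr e"
        unfolding powr_divide divide_powr by simp
      also have "\<dots> \<le> (2 powr q * \<omega>) * (1 / (D * 2 ^ i)) powr e"
        using False D c X e \<omega> by (intro mult_left_mono powr_mono2) (auto simp: field_simps)
      also have "(1 / (D * 2 ^ i)) powr e = 1 / (D powr e * (2 ^ i) powr e)"
        by (simp add: powr_divide powr_mult)
      also have "(2 powr q * \<omega>) * (1 / (D powr e * (2 ^ i) powr e)) = \<epsilon> * (((1 - \<mu>) / 2) powr \<gamma> * (1 / (2 ^ i) powr e))"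
        unfolding D(2) using \<omega> \<epsilon> \<mu> by (simp add: powr_minus field_simps)
      also have "1 / (2 ^ i) powr e = (\<mu> ^ i) powr \<gamma>"
      proof -
        have "\<mu> powr \<gamma> = 2 powr (- e)" using \<gamma> by (simp add: \<mu>_def powr_powr)
        then have "(\<mu> ^ i) powr \<gamma> = (2 powr (- e)) ^ i" using \<mu> by (simp add: power_powr_swap)
        then show ?thesis by (simp add: power_powr_swap powr_minus power_inverse divide_inverse)
      qed
      finally show ?thesis unfolding \<sigma>(4) powr_mult by (simp add: mult_ac)
    qed
    then have "AE x in lebesgue. x \<in> ball x0 (\<sigma> i * R) \<longrightarrow> u x - k0 \<le> k"
      unfolding \<epsilon>_def \<gamma>_def by (intro sup_bound[OF k Tk \<sigma>(1,2,3) IA A0])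
    then have "Q i k" by (simp add: Q_def)
    then show ?thesis by (rule Q_mono) (auto simp: k_def)
  qed
  \<comment> \<open>The growth in \<open>i\<close> is harmless: the term
    \<open>D * 2 ^ Suc i * X\<close> inherited from the larger ball is halved together with
    \<open>c\<close> and becomes \<open>D * 2 ^ i * X\<close>, while \<open>hT / 2\<close> stays
    below \<open>hT\<close>.\<close>
  have descend: "Q i (max (c / 2 ^ m) (hT + D * 2 ^ i * X))" if "Q (i + m) c" "0 < c" for m i c
    using that
  proof (induction m arbitrary: i)
    case 0
    then show ?case by (auto intro: Q_mono)
  next
    case (Suc m)
    define c' where "c' = max (c / 2 ^ m) (hT + D * 2 ^ Suc i * X)"
    have "Q (Suc i) c'" using Suc.IH[of "Suc i"] Suc.prems by (simp add: c'_def)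
    moreover have "0 < c'" using Suc.prems by (simp add: c'_def less_max_iff_disj)
    ultimately have "Q i (max (c' / 2) (max hT (D * 2 ^ i * X)))" by (rule step)
    then show ?case
    proof (rule Q_mono)
      have "0 \<le> D * 2 ^ i * X" using D X by simp
      moreover have "c' / 2 = max (c / 2 ^ Suc m) (hT / 2 + D * 2 ^ i * X)"
        by (simp add: c'_def max_def field_simps)
      ultimately show "max (c' / 2) (max hT (D * 2 ^ i * X)) \<le> max (c / 2 ^ Suc m) (hT + D * 2 ^ i * X)"
        using hT by auto
    qed
  qed
  have Q0: "Q 0 (max (M1 / 2 ^ m) (hT + D * X))" for m
  proof -
    have le: "\<sigma> m * R \<le> 1 * R" using \<sigma>(3)[of m] R by (intro mult_right_mono) auto
    have "Q (0 + m) M1" using bounded unfolding Q_def by eventually_elim (use le in auto)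
    from descend[OF this M1] show ?thesis by simp
  qed
  \<comment> \<open>The qualitative bound survives as \<open>M1 / 2 ^ m\<close>. All
    \<open>m\<close> are taken simultaneously, so that it can be made arbitrarily small at a fixed
    point.\<close>
  have "AE x in lebesgue. \<forall>m. x \<in> ball x0 (\<sigma> 0 * R) \<longrightarrow> u x - k0 \<le> max (M1 / 2 ^ m) (hT + D * X)"
    using Q0 unfolding Q_def AE_all_countable by blast
  then show ?thesis
  proof eventually_elim
    case (elim x)
    show ?case
    proof (intro impI, rule ccontr)
      assume x: "x \<in> ball x0 (R / 2)" and n: "\<not> u x - k0 \<le> hT + sup_const TYPE('a) q \<kappa> C4 e * X"
      have "0 \<le> hT + D * X" using hT D X by simp
      then have pos: "0 < u x - k0" and gt: "hT + D * X < u x - k0" using n by (auto simp: D_def)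
      obtain m where "(1 / 2) ^ m < (u x - k0) / M1"
        using real_arch_pow_inv[of "(u x - k0) / M1" "1 / 2"] pos M1 by auto
      then have "M1 / 2 ^ m < u x - k0" using M1 by (simp add: field_simps power_divide)
      moreover have "u x - k0 \<le> max (M1 / 2 ^ m) (hT + D * X)" using elim x by (simp add: \<sigma>_def)
      ultimately show False using gt by auto
    qed
  qed
qed

end

section \<open>Oscillation in the supercritical case\<close>

text \<open>The inner denominator is the constant \<open>c0\<close> for which the threshold of
  \<open>fast_geometric_convergence\<close> equals the unit ball volume, an upper bound for the
  initial measure when \<open>R \<le> 1\<close>. The rest solves
  \<open>K * b * m powr p / d powr p = c0\<close> for \<open>d / m\<close>.\<close>

definition osc_const :: "'a::euclidean_space itself \<Rightarrow> real \<Rightarrow> real \<Rightarrow> real" where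
  "osc_const _ s p =
     (let n = real DIM('a); \<omega> = unit_ball_vol n; \<kappa> = s * p / n - 1
      in ((2 ^ (DIM('a) + 1) / \<omega>) powr (1 + s * p / n) * 2 powr p
           / (\<omega> * (2 powr p) powr (1 / \<kappa>\<^sup>2)) powr (- \<kappa>)) powr (1 / p))"

lemma osc_const_nonneg: "0 \<le> osc_const TYPE('a::euclidean_space) s p"
  by (simp add: osc_const_def Let_def)

text \<open>Moving the centre from \<open>x\<close> towards \<open>x0\<close> by the fraction
  \<open>\<delta> / (2 * R)\<close> shifts it by at most \<open>\<delta> / 2\<close> and leaves room
  \<open>\<delta> / 2\<close> up to the sphere around \<open>x0\<close>.\<close>

lemma ball_inter_ball_contains_ball:
  fixes x x0 :: "'a::euclidean_space"
  assumes x: "x \<in> ball x0 R" and \<delta>: "0 < \<delta>" "\<delta> \<le> 2 * R"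
  obtains c where "ball c (\<delta> / 2) \<subseteq> ball x \<delta> \<inter> ball x0 R"
proof -
  define \<tau> where "\<tau> = \<delta> / (2 * R)"
  have R: "0 < R" using \<delta> by simp
  have \<tau>: "0 < \<tau>" "\<tau> \<le> 1" "\<tau> * R = \<delta> / 2" using \<delta> R by (auto simp: \<tau>_def)
  define c where "c = x + \<tau> *\<^sub>R (x0 - x)"
  have "dist x c = \<tau> * norm (x0 - x)" using \<tau> by (simp add: c_def dist_norm)
  also have "\<dots> \<le> \<tau> * R" using x \<tau> by (intro mult_left_mono) (auto simp: dist_norm)
  finally have 1: "dist x c \<le> \<delta> / 2" using \<tau> by simp
  have "x0 - c = (1 - \<tau>) *\<^sub>R (x0 - x)" by (simp add: c_def algebra_simps)
  then have "dist x0 c = (1 - \<tau>) * norm (x0 - x)" using \<tau> by (simp add: dist_norm)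
  also have "\<dots> \<le> (1 - \<tau>) * R" using x \<tau> by (intro mult_left_mono) (auto simp: dist_norm)
  finally have 2: "dist x0 c \<le> R - \<delta> / 2" using \<tau> by (simp add: algebra_simps)
  show ?thesis
  proof (rule that[of c], rule subsetI)
    fix y assume y: "y \<in> ball c (\<delta> / 2)"
    have "dist x y \<le> dist x c + dist c y" "dist x0 y \<le> dist x0 c + dist c y"
      by (rule dist_triangle)+
    then show "y \<in> ball x \<delta> \<inter> ball x0 R" using y 1 2 by auto
  qed
qed

text \<open>Around each \<open>x\<close> with \<open>u x > h\<close> there is, inside the ball and
  within distance \<delta>, a set of measure at least \<open>Nk\<close> on which
  \<open>u \<le> k\<close>. Each such \<open>x\<close> therefore contributes at least
  \<open>g\<close> to the Gagliardo integral, and integrating over these \<open>x\<close> bounds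
  \<open>g * Nh\<close>.\<close>

lemma superlevel_decay:
  fixes u :: "'a::euclidean_space \<Rightarrow> real"
  assumes u[measurable]: "u \<in> borel_measurable lebesgue" and R: "0 < R"
    and sp: "0 < s" "1 < p" and m: "0 \<le> m" and hk: "k < h"
    and E: "(\<integral>\<^sup>+z. ennreal (\<bar>u (fst z) - u (snd z)\<bar> powr p
        / dist (fst z) (snd z) powr (real DIM('a) + s * p)) * indicator (ball x0 R \<times> ball x0 R) z \<partial>lebesgue)
      \<le> ennreal (m powr p)"
    and Nk: "emeasure lebesgue {x \<in> ball x0 R. k < u x} = ennreal Nk" "0 \<le> Nk"
      "2 * Nk \<le> unit_ball_vol (real DIM('a)) * R ^ DIM('a)"
    and Nh: "emeasure lebesgue {x \<in> ball x0 R. h < u x} = ennreal Nh" "0 \<le> Nh"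
  shows "Nh \<le> (2 ^ (DIM('a) + 1) / unit_ball_vol (real DIM('a))) powr (1 + s * p / real DIM('a))
      * Nk powr (s * p / real DIM('a)) * (h - k) powr (- p) * m powr p"
proof -
  define n where "n = real DIM('a)"
  define \<omega> where "\<omega> = unit_ball_vol n"
  have n: "0 < n" and \<omega>: "0 < \<omega>" by (auto simp: n_def \<omega>_def)
  let ?B = "ball x0 R"
  note L = superlevel_sets_lebesgue(3)[OF u, of x0 R]
  show ?thesis
  proof (cases "Nk = 0")
    case True
    have "ennreal Nh \<le> ennreal Nk" unfolding Nk(1)[symmetric] Nh(1)[symmetric]
      using L hk by (intro emeasure_mono) auto
    then have "Nh \<le> 0" using True by (simp add: ennreal_eq_0_iff)
    then show ?thesis using True by simp
  next
    case False
    then have Np: "0 < Nk" using Nk by simp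
    \<comment> \<open>A ball of radius \<open>\<delta> / 2\<close> has volume \<open>2 * Nk\<close>,
      so removing the superlevel set leaves at least \<open>Nk\<close>. The assumption that the
      superlevel set fills at most half of the ball is what gives
      \<open>\<delta> \<le> 2 * R\<close>.\<close>
    define \<delta> where "\<delta> = 2 * (2 * Nk / \<omega>) powr (1 / n)"
    have \<delta>: "0 < \<delta>" using Np \<omega> by (simp add: \<delta>_def)
    have \<delta>n: "(\<delta> / 2) ^ DIM('a) = 2 * Nk / \<omega>"
    proof -
      have "(\<delta> / 2) ^ DIM('a) = (\<delta> / 2) powr n" using \<delta> by (simp add: n_def powr_realpow)
      also have "\<dots> = 2 * Nk / \<omega>" using n Np \<omega> by (simp add: \<delta>_def powr_powr)
      finally show ?thesis .
    qed
    have \<delta>R: "\<delta> \<le> 2 * R"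
    proof -
      have "2 * Nk / \<omega> \<le> R ^ DIM('a)" using Nk(3) \<omega> by (simp add: \<omega>_def n_def field_simps)
      then have "(\<delta> / 2) ^ DIM('a) \<le> R ^ DIM('a)" by (simp add: \<delta>n)
      then have "\<delta> / 2 \<le> R" using R by (rule_tac power_le_imp_le_base[of _ "DIM('a) - 1"]) auto
      then show ?thesis by simp
    qed
    define g where "g = Nk * ((h - k) powr p * \<delta> powr (- (n + s * p)))"
    have inner: "ennreal g \<le> (\<integral>\<^sup>+y. ennreal (\<bar>u x - u y\<bar> powr p / dist x y powr (n + s * p))
        * indicator ?B y \<partial>lebesgue)" if x: "x \<in> ?B" "h < u x" for x
    proof -
      obtain c where c: "ball c (\<delta> / 2) \<subseteq> ball x \<delta> \<inter> ?B"
        using ball_inter_ball_contains_ball[OF x(1) \<delta> \<delta>R] .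
      define G where "G = ball c (\<delta> / 2) - {y \<in> ?B. k < u y}"
      have G: "G \<in> sets lebesgue" unfolding G_def using L by (intro sets.Diff) auto
      have "ennreal Nk + ennreal Nk = emeasure lebesgue (ball c (\<delta> / 2))"
        using \<delta> \<delta>n \<omega> Np by (subst emeasure_lebesgue_ball) (simp_all flip: \<omega>_def n_def ennreal_plus)
      also have "\<dots> \<le> emeasure lebesgue (G \<union> {y \<in> ?B. k < u y})"
        using G L by (intro emeasure_mono) (auto simp: G_def)
      also have "\<dots> \<le> emeasure lebesgue G + ennreal Nk"
        using emeasure_subadditive[OF G L[of k]] Nk by simp
      finally have Gm: "ennreal Nk \<le> emeasure lebesgue G"
        by (cases "emeasure lebesgue G") (use Np in \<open>auto simp: add_top simp flip: ennreal_plus\<close>)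
      have "ennreal g = ennreal ((h - k) powr p * \<delta> powr (- (n + s * p))) * ennreal Nk"
        by (subst ennreal_mult'[symmetric]) (auto simp: g_def mult_ac)
      also have "\<dots> \<le> ennreal ((h - k) powr p * \<delta> powr (- (n + s * p))) * emeasure lebesgue G"
        using Gm by (intro mult_left_mono) auto
      also have "\<dots> = (\<integral>\<^sup>+y. ennreal ((h - k) powr p * \<delta> powr (- (n + s * p))) * indicator G y \<partial>lebesgue)"
        by (rule nn_integral_cmult_indicator[OF G, symmetric])
      also have "\<dots> \<le> (\<integral>\<^sup>+y. ennreal (\<bar>u x - u y\<bar> powr p / dist x y powr (n + s * p)) * indicator ?B y \<partial>lebesgue)"
      proof (rule nn_integral_mono)
        fix y
        show "ennreal ((h - k) powr p * \<delta> powr (- (n + s * p))) * indicator G y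
          \<le> ennreal (\<bar>u x - u y\<bar> powr p / dist x y powr (n + s * p)) * indicator ?B y"
        proof (cases "y \<in> G")
          case True
          have y: "y \<in> ball x \<delta>" "y \<in> ?B" "u y \<le> k" using True c by (auto simp: G_def)
          have xy: "x \<noteq> y" using y x hk by auto
          have nn: "- (n + s * p) \<le> 0" using n sp mult_pos_pos[of s p] by linarith
          have "(h - k) powr p * \<delta> powr (- (n + s * p)) \<le> \<bar>u x - u y\<bar> powr p * dist x y powr (- (n + s * p))"
          proof (intro mult_mono)
            show "(h - k) powr p \<le> \<bar>u x - u y\<bar> powr p" using y x hk sp by (intro powr_mono2) auto
            show "\<delta> powr (- (n + s * p)) \<le> dist x y powr (- (n + s * p))"
              using nn xy y by (intro powr_mono2') auto
          qed auto
          then show ?thesis using True y by (simp add: divide_powr ennreal_leI)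
        qed simp
      qed
      finally show ?thesis .
    qed
    have g0: "0 < g" using Np hk \<delta> by (simp add: g_def)
    have "ennreal (g * Nh) = (\<integral>\<^sup>+x. ennreal g * indicator {x \<in> ?B. h < u x} x \<partial>lebesgue)"
      using L[of h] Nh g0 by (subst nn_integral_cmult_indicator) (auto simp: ennreal_mult')
    also have "\<dots> \<le> (\<integral>\<^sup>+x. \<integral>\<^sup>+y. ennreal (\<bar>u x - u y\<bar> powr p / dist x y powr (n + s * p))
        * indicator (?B \<times> ?B) (x, y) \<partial>lebesgue \<partial>lebesgue)"
    proof (rule nn_integral_mono)
      fix x
      show "ennreal g * indicator {x \<in> ?B. h < u x} x \<le> (\<integral>\<^sup>+y. ennreal (\<bar>u x - u y\<bar> powr p / dist x y powr (n + s * p))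
        * indicator (?B \<times> ?B) (x, y) \<partial>lebesgue)"
      proof (cases "x \<in> ?B \<and> h < u x")
        case True
        have "(\<integral>\<^sup>+y. ennreal (\<bar>u x - u y\<bar> powr p / dist x y powr (n + s * p)) * indicator (?B \<times> ?B) (x, y) \<partial>lebesgue)
          = (\<integral>\<^sup>+y. ennreal (\<bar>u x - u y\<bar> powr p / dist x y powr (n + s * p)) * indicator ?B y \<partial>lebesgue)"
          using True by (intro nn_integral_cong) (auto split: split_indicator)
        then show ?thesis using True inner[of x] by simp
      qed auto
    qed
    also have "\<dots> = (\<integral>\<^sup>+z. ennreal (\<bar>u (fst z) - u (snd z)\<bar> powr p
        / dist (fst z) (snd z) powr (n + s * p)) * indicator (?B \<times> ?B) z \<partial>lebesgue)"
    proof -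
      have [measurable]: "?B \<times> ?B \<in> sets lebesgue" by (auto simp: open_Times)
      show ?thesis by (subst lebesgue_Tonelli(1)) simp_all
    qed
    also have "\<dots> \<le> ennreal (m powr p)" using E by (simp add: n_def)
    finally have "g * Nh \<le> m powr p" by (simp add: ennreal_le_iff)
    then have "Nh \<le> m powr p / g" using g0 by (simp add: field_simps)
    also have "\<dots> = (2 ^ (DIM('a) + 1) / \<omega>) powr (1 + s * p / n) * Nk powr (s * p / n) * (h - k) powr (- p) * m powr p"
    proof -
      have "\<delta> ^ DIM('a) = 2 ^ (DIM('a) + 1) / \<omega> * Nk"
        using \<delta>n by (simp add: power_divide field_simps)
      then have "\<delta> powr n = 2 ^ (DIM('a) + 1) / \<omega> * Nk"
        using \<delta> by (simp add: n_def powr_realpow)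
      then have "(\<delta> powr n) powr (1 + s * p / n) = (2 ^ (DIM('a) + 1) / \<omega> * Nk) powr (1 + s * p / n)" by simp
      moreover have "n * (1 + s * p / n) = n + s * p" using n by (simp add: field_simps)
      ultimately have d: "\<delta> powr (n + s * p) = (2 ^ (DIM('a) + 1) / \<omega>) powr (1 + s * p / n) * Nk powr (1 + s * p / n)"
        unfolding powr_powr powr_mult by simp
      have "m powr p / g = m powr p / Nk * (h - k) powr (- p) * \<delta> powr (n + s * p)"
      proof -
        have "g = Nk / (\<delta> powr (n + s * p)) * (h - k) powr p"
          by (simp add: g_def divide_powr)
        then show ?thesis by (simp add: powr_minus divide_inverse)
      qed
      also have "\<dots> = (2 ^ (DIM('a) + 1) / \<omega>) powr (1 + s * p / n) * (Nk powr (1 + s * p / n) / Nk) * (h - k) powr (- p) * m powr p"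
        unfolding d by simp
      also have "Nk powr (1 + s * p / n) / Nk = Nk powr (s * p / n)"
        using Np by (simp add: powr_add)
      finally show ?thesis .
    qed
    finally show ?thesis by (simp add: n_def \<omega>_def)
  qed
qed

text \<open>The supercritical embedding, obtained from the decay of superlevel sets rather than from
  averages over shrinking balls.\<close>

lemma fractional_oscillation_bound:
  fixes u :: "'a::euclidean_space \<Rightarrow> real"
  assumes u[measurable]: "u \<in> borel_measurable lebesgue" and R: "0 < R" "R \<le> 1"
    and sp: "0 < s" "1 < p" "real DIM('a) < s * p" and m: "0 < m"
    and E: "(\<integral>\<^sup>+z. ennreal (\<bar>u (fst z) - u (snd z)\<bar> powr p
        / dist (fst z) (snd z) powr (real DIM('a) + s * p)) * indicator (ball x0 R \<times> ball x0 R) z \<partial>lebesgue)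
      \<le> ennreal (m powr p)"
    and half: "emeasure lebesgue {x \<in> ball x0 R. k0 < u x}
      \<le> ennreal (unit_ball_vol (real DIM('a)) * R ^ DIM('a) / 2)"
  shows "AE x in lebesgue. x \<in> ball x0 R \<longrightarrow> u x - k0 \<le> osc_const TYPE('a) s p * m"
proof -
  define n where "n = real DIM('a)"
  define \<omega> where "\<omega> = unit_ball_vol n"
  have n: "0 < n" and \<omega>: "0 < \<omega>" by (auto simp: n_def \<omega>_def)
  define \<kappa> where "\<kappa> = s * p / n - 1"
  have \<kappa>: "0 < \<kappa>" using sp n by (simp add: \<kappa>_def n_def)
  define K where "K = (2 ^ (DIM('a) + 1) / \<omega>) powr (1 + s * p / n)"
  define b where "b = (2::real) powr p"
  have b: "1 < b" using sp powr_less_mono[of 0 p 2] by (simp add: b_def)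
  define c0 where "c0 = (\<omega> * b powr (1 / \<kappa>\<^sup>2)) powr (- \<kappa>)"
  have c0: "0 < c0" using \<omega> b by (simp add: c0_def)
  have K: "0 < K" using \<omega> by (simp add: K_def)
  define d where "d = osc_const TYPE('a) s p * m"
  have osc: "osc_const TYPE('a) s p = (K * b / c0) powr (1 / p)"
    by (simp add: osc_const_def Let_def K_def b_def c0_def \<kappa>_def \<omega>_def n_def)
  have d: "0 < d" using K b c0 m by (simp add: d_def osc)
  have dp: "d powr p = K * b / c0 * m powr p"
    unfolding d_def osc powr_mult using K b c0 sp by (simp add: powr_powr)
  let ?B = "ball x0 R"
  define l where "l j = k0 + d * (1 - (1/2) ^ j)" for j :: nat
  define N where "N c = enn2real (emeasure lebesgue {x \<in> ?B. c < u x})" for c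
  note L = superlevel_sets_lebesgue(3)[OF u, of x0 R]
  have Nle: "emeasure lebesgue {x \<in> ?B. c < u x} \<le> ennreal (\<omega> * R ^ DIM('a) / 2)" if "k0 \<le> c" for c
  proof -
    have "emeasure lebesgue {x \<in> ?B. c < u x} \<le> emeasure lebesgue {x \<in> ?B. k0 < u x}"
      using L that by (intro emeasure_mono) auto
    then show ?thesis using half by (simp add: \<omega>_def n_def)
  qed
  have N: "emeasure lebesgue {x \<in> ?B. c < u x} = ennreal (N c)" "0 \<le> N c" "2 * N c \<le> \<omega> * R ^ DIM('a)" if "k0 \<le> c" for c
  proof -
    have "emeasure lebesgue {x \<in> ?B. c < u x} < \<infinity>" using Nle[OF that] by (auto intro: le_less_trans)
    then show 1: "emeasure lebesgue {x \<in> ?B. c < u x} = ennreal (N c)" by (simp add: N_def)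
    show "0 \<le> N c" by (simp add: N_def)
    have "0 \<le> \<omega> * R ^ DIM('a) / 2" using \<omega> R by simp
    then have "N c \<le> \<omega> * R ^ DIM('a) / 2" using Nle[OF that] unfolding 1 by (simp add: ennreal_le_iff)
    then show "2 * N c \<le> \<omega> * R ^ DIM('a)" by simp
  qed
  have l: "k0 \<le> l j" "l (Suc j) - l j = d * (1/2) ^ Suc j" "l j \<le> k0 + d" for j
    using d by (auto simp: l_def power_le_one algebra_simps)
  have l_less: "l j < l (Suc j)" for j
  proof -
    have "0 < d * (1/2) ^ Suc j" using d by simp
    then show ?thesis using l(2)[of j] by linarith
  qed
  have step: "N (l (Suc j)) \<le> c0 * b ^ j * N (l j) powr (1 + \<kappa>)" for j
  proof -
    have "N (l (Suc j)) \<le> K * N (l j) powr (s * p / n) * (l (Suc j) - l j) powr (- p) * m powr p"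
      unfolding K_def n_def \<omega>_def
      by (rule superlevel_decay[OF u R(1) sp(1,2) less_imp_le[OF m] l_less E N(1,2)[OF l(1)]
            N(3)[OF l(1), unfolded n_def \<omega>_def] N(1,2)[OF l(1)]])
    also have "(l (Suc j) - l j) powr (- p) = d powr (- p) * (b ^ j * b)"
    proof -
      have "((1/2::real) ^ Suc j) powr (- p) = b ^ Suc j"
        unfolding b_def by (rule half_power_powr)
      then show ?thesis unfolding l(2) powr_mult by (simp add: mult_ac)
    qed
    also have "K * N (l j) powr (s * p / n) * (d powr (- p) * (b ^ j * b)) * m powr p
      = (K * b * m powr p / d powr p) * b ^ j * N (l j) powr (s * p / n)"
      by (simp only: powr_minus divide_inverse mult_ac)
    also have "K * b * m powr p / d powr p = c0"
      unfolding dp using K b c0 m by (simp add: field_simps)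
    \<comment> \<open>Supercriticality: the power of the measure in the recursion exceeds 1.\<close>
    also have "s * p / n = 1 + \<kappa>" by (simp add: \<kappa>_def)
    finally show ?thesis .
  qed
  have "(\<lambda>j. N (l j)) \<longlonglongrightarrow> 0"
  proof (rule fast_geometric_convergence[OF N(2)[OF l(1)] c0 b \<kappa> step])
    have "R ^ DIM('a) \<le> 1" using R by (intro power_le_one) auto
    then have "\<omega> * R ^ DIM('a) \<le> \<omega> * 1" using \<omega> by (intro mult_left_mono) auto
    then have "N (l 0) \<le> \<omega>" using N(2,3)[OF l(1)[of 0]] by linarith
    also have "\<omega> = c0 powr (- 1 / \<kappa>) * b powr (- 1 / \<kappa>\<^sup>2)"
    proof -
      have "c0 powr (- 1 / \<kappa>) = \<omega> * b powr (1 / \<kappa>\<^sup>2)"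
        unfolding c0_def powr_powr using \<kappa> \<omega> b by simp
      moreover have "b powr (1 / \<kappa>\<^sup>2) * b powr (- 1 / \<kappa>\<^sup>2) = 1" using b by (simp flip: powr_add)
      ultimately show ?thesis by simp
    qed
    finally show "N (l 0) \<le> c0 powr (- 1 / \<kappa>) * b powr (- 1 / \<kappa>\<^sup>2)" .
  qed
  moreover have "N (k0 + d) \<le> N (l j)" for j
  proof -
    have "emeasure lebesgue {x \<in> ?B. k0 + d < u x} \<le> emeasure lebesgue {x \<in> ?B. l j < u x}"
      using L l(3)[of j] by (intro emeasure_mono) auto
    then have "ennreal (N (k0 + d)) \<le> ennreal (N (l j))"
      using N(1)[OF l(1)[of j]] N(1)[of "k0 + d"] d by (simp del: emeasure_completion)
    then show ?thesis using N(2)[OF l(1)] by simp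
  qed
  ultimately have "N (k0 + d) \<le> 0" by (intro LIMSEQ_le_const) auto
  then have "emeasure lebesgue {x \<in> ?B. k0 + d < u x} = 0"
    using N(1)[of "k0 + d"] d by (simp add: ennreal_neg)
  then have "{x \<in> ?B. k0 + d < u x} \<in> null_sets lebesgue" using L by auto
  then show ?thesis unfolding d_def[symmetric] by (rule AE_I') auto
qed

section \<open>Qualitative local boundedness\<close>

text \<open>The starting point of the preliminary iteration. The Caccioppoli inequality cannot serve
  here, since the integral of \<open>w powr q\<close> on its right side may still be infinite; the
  finite energy of \<open>u\<close> is used directly.\<close>

lemma (in cutoff) gagliardo_cutoff_finite:
  assumes G: "\<And>x. local_gag s p \<phi> x \<le> ennreal G" "0 \<le> G"
  shows "gagliardo s p f < \<infinity>"
proof -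
  have gd: "(\<integral>\<^sup>+z. ennreal (gdens u z) * indicator (C_dom \<Omega>) z \<partial>lebesgue) < \<infinity>"
    and Lp: "(\<integral>\<^sup>+x\<in>\<Omega>. ennreal (\<bar>u x\<bar> powr p) \<partial>lebesgue) < \<infinity>"
    using u_A A_space_eq by blast+
  have good_le: "good p z * kp z \<le> gdens u z * indicator (C_dom \<Omega>) z" for z
  proof (cases "z \<in> B \<times> B")
    case True
    obtain x y where z: "z = (x, y)" by (cases z)
    have phi1: "\<phi> x powr q \<le> 1" for x using \<phi> p pq by (intro powr_le1) auto
    have "max (\<phi> x powr q) (\<phi> y powr q) * \<bar>w x - w y\<bar> powr p \<le> 1 * \<bar>u x - u y\<bar> powr p"
      using phi1 p by (intro mult_mono powr_mono2) (auto simp: w_def)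
    then have "good p z * kp z \<le> \<bar>u x - u y\<bar> powr p * kp z"
      using True by (intro mult_right_mono) (auto simp: good_def z)
    also have "\<dots> \<le> gdens u z" by (simp add: gdens_def z)
    finally show ?thesis using True ball by (auto simp: C_dom_def z)
  qed (simp add: good_def gdens_nonneg)
  have wp: "wint p < \<infinity>"
  proof -
    have "wint p \<le> (\<integral>\<^sup>+x\<in>\<Omega>. ennreal (\<bar>u x\<bar> powr p) \<partial>lebesgue)"
      unfolding wint_def using ball k p
      by (intro nn_integral_mono mult_mono ennreal_leI powr_mono2) (auto simp: w_def split: split_indicator)
    then show ?thesis using Lp by (rule le_less_trans)
  qed
  have "gagliardo s p f = (\<integral>\<^sup>+z. ennreal (\<bar>f (fst z) - f (snd z)\<bar> powr p * kp z) \<partial>lebesgue)"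
    by (simp add: gagliardo_def divide_powr kp_def)
  also have "\<dots> \<le> (\<integral>\<^sup>+z. ennreal (2 powr q) * (ennreal (gdens u z) * indicator (C_dom \<Omega>) z)
      + ennreal (2 powr q * q powr q) * ennreal (near_err p z * kp z) \<partial>lebesgue)"
  proof (rule nn_integral_mono)
    fix z
    have "\<bar>f (fst z) - f (snd z)\<bar> powr p * kp z \<le> 2 powr q * (good p z + q powr q * near_err p z) * kp z"
      using f_phase[of p z] p pq by (intro mult_right_mono) auto
    also have "\<dots> = 2 powr q * (good p z * kp z) + 2 powr q * q powr q * (near_err p z * kp z)"
      by (simp add: algebra_simps)
    also have "\<dots> \<le> 2 powr q * (gdens u z * indicator (C_dom \<Omega>) z) + 2 powr q * q powr q * (near_err p z * kp z)"
      using good_le by (intro add_right_mono mult_left_mono) auto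
    finally have "ennreal (\<bar>f (fst z) - f (snd z)\<bar> powr p * kp z) \<le> ennreal \<dots>" by (rule ennreal_leI)
    also have "\<dots> = ennreal (2 powr q) * (ennreal (gdens u z) * indicator (C_dom \<Omega>) z)
      + ennreal (2 powr q * q powr q) * ennreal (near_err p z * kp z)"
      using gdens_nonneg[of u z] by (auto simp: ennreal_mult' split: split_indicator)
    finally show "ennreal (\<bar>f (fst z) - f (snd z)\<bar> powr p * kp z) \<le> \<dots>" .
  qed
  also have "\<dots> = ennreal (2 powr q) * (\<integral>\<^sup>+z. ennreal (gdens u z) * indicator (C_dom \<Omega>) z \<partial>lebesgue)
      + ennreal (2 powr q * q powr q) * (\<integral>\<^sup>+z. ennreal (near_err p z * kp z) \<partial>lebesgue)"
    by (subst nn_integral_add) (auto simp: nn_integral_cmult)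
  also have "\<dots> < \<infinity>"
  proof -
    have "(\<integral>\<^sup>+z. ennreal (near_err p z * kp z) \<partial>lebesgue) \<le> ennreal (2 * G) * wint p"
      using near_err_integral[OF G] by (simp add: kp_def)
    also have "\<dots> < \<infinity>" using wp by (simp add: ennreal_mult_less_top)
    finally show ?thesis using gd by (simp add: ennreal_mult_less_top)
  qed
  finally show ?thesis .
qed

definition excess :: "('a::euclidean_space \<Rightarrow> real) \<Rightarrow> real \<Rightarrow> 'a \<Rightarrow> real \<Rightarrow> real \<Rightarrow> ennreal" where
  "excess u m x0 l r = (\<integral>\<^sup>+x. ennreal (max (u x - l) 0 powr m) * indicator (ball x0 r) x \<partial>lebesgue)"

lemma excess_antimono:
  assumes "0 \<le> m" "l \<le> l'" "r' \<le> r"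
  shows "excess u m x0 l' r' \<le> excess u m x0 l r"
  unfolding excess_def using assms
  by (intro nn_integral_mono mult_mono ennreal_leI powr_mono2) (auto split: split_indicator)

text \<open>\<open>m\<close> is an exponent reached by the Sobolev inequality: larger than
  \<open>p\<close>, so that the recursion is superlinear, and at least \<open>q\<close>, so that
  \<open>excess\<close> controls both phases. Only finiteness is wanted, so constants may depend on
  every parameter.\<close>

locale local_boundedness = double_phase +
  fixes u :: "'a \<Rightarrow> real" and x0 :: 'a and R1 R2 a2 T m G1 G2 :: real
  assumes minimizer: "is_minimizer s t p q Ksp Ktq a \<Omega> u"
    and ball: "ball x0 R2 \<subseteq> \<Omega>" and R: "0 < R1" "R1 < R2" "R2 \<le> R1 + 1"
    and a_upper: "\<And>x y. x \<in> ball x0 R2 \<Longrightarrow> y \<in> ball x0 R2 \<Longrightarrow> a (x, y) \<le> a2"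
    and T: "0 \<le> T"
    and tail: "\<And>x. x \<in> ball x0 R2 \<Longrightarrow>
      far_tail s t p q a (\<lambda>y. max (u y) 0) x0 R1 x \<le> ennreal T"
    and m: "p < m" "q \<le> m" "real DIM('a) / p - real DIM('a) / m \<le> s"
    and G1: "cutoff_const TYPE('a) s p G1" and G2: "cutoff_const TYPE('a) t q G2"
begin

definition V :: real where "V = unit_ball_vol (real DIM('a)) * R2 ^ DIM('a)"

definition KS :: real where
  "KS = sob_const TYPE('a) s p * V powr (s * p / real DIM('a) - (1 - p / m)) * 2 powr (m - p)"

definition C7 :: real where
  "C7 = 2 powr q * \<Lambda>\<^sup>2 * q powr q * 4 * (G1 + a2 * G2 + R2 powr (real DIM('a) + q) * T)"

lemma u_meas [measurable]: "u \<in> borel_measurable lebesgue"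
  using minimizer by (auto simp: is_minimizer_def A_space_def)

lemma V: "0 < V" using R by (simp add: V_def)

lemma KS: "0 < KS"
  using V sob_const_pos[where ?'a = 'a, of s p] by (simp add: KS_def)

lemma a2: "0 \<le> a2"
proof -
  have "a (x0, x0) \<le> a2" using R by (intro a_upper) auto
  then show ?thesis using a_nonneg[of "(x0, x0)"] by linarith
qed

lemma G12: "0 < G1" "0 < G2"
  using G1 G2 by (auto simp: cutoff_const_def)

lemma C7: "0 \<le> C7"
  using a2 G12 T unfolding C7_def by (intro mult_nonneg_nonneg add_nonneg_nonneg) auto

lemma cutoff_locale:
  assumes "0 \<le> l" "0 < d" "d < r" "r \<le> R2"
  shows "cutoff s t p q \<Lambda> \<Omega> Ksp Ktq a u x0 r d l (cut x0 (r - d) d)"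
proof
  show "ball x0 r \<subseteq> \<Omega>" using ball assms by auto
  show "x \<notin> ball x0 (r - d) \<Longrightarrow> cut x0 (r - d) d x = 0" for x using assms by (auto simp: cut_eq_0)
qed (use minimizer assms cut_bounds in auto)

lemma Sobolev_excess:
  assumes l: "0 \<le> l" and d: "0 < d" "d < r" "r \<le> R2"
    and E: "gagliardo s p (cutoff.f q u l (cut x0 (r - d) d)) \<le> ennreal E" "0 \<le> E"
  shows "excess u m x0 l (r - d - d) \<le> ennreal ((KS * E) powr (m / p))"
proof -
  interpret c: cutoff s t p q \<Lambda> \<Omega> Ksp Ktq a u x0 r d l "cut x0 (r - d) d"
    using l d by (rule cutoff_locale)
  have supp: "emeasure lebesgue {x. 0 < c.f x} \<le> ennreal V"
  proof -
    have "0 < c.f x \<Longrightarrow> x \<in> ball x0 R2" for x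
      using c.\<phi>(3)[of x] d by (cases "x \<in> ball x0 (r - d)") (auto simp: c.f_def)
    then have "emeasure lebesgue {x. 0 < c.f x} \<le> emeasure lebesgue (ball x0 R2)"
      by (intro emeasure_mono) auto
    then show ?thesis using R by (simp add: V_def emeasure_ball)
  qed
  have "excess u m x0 l (r - d - d) \<le> (\<integral>\<^sup>+x. ennreal (c.f x powr m) \<partial>lebesgue)"
    unfolding excess_def
  proof (rule nn_integral_mono)
    fix x
    show "ennreal (max (u x - l) 0 powr m) * indicator (ball x0 (r - d - d)) x \<le> ennreal (c.f x powr m)"
      using cut_eq_1[OF d(1), of x x0 "r - d"] by (auto simp: c.f_def c.w_def split: split_indicator)
  qed
  also have "\<dots> \<le> ennreal ((KS * E) powr (m / p))"
    unfolding KS_def using s p V supp m E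
    by (intro Sobolev) auto
  finally show ?thesis .
qed

lemma excess_finite:
  assumes d: "0 < d" "d < R2"
  shows "excess u m x0 0 (R2 - d - d) < \<infinity>"
proof -
  interpret c: cutoff s t p q \<Lambda> \<Omega> Ksp Ktq a u x0 R2 d 0 "cut x0 (R2 - d) d"
    using d by (intro cutoff_locale) auto
  have "gagliardo s p c.f < \<infinity>"
    using cut_local_gag[OF G1 d(1), of x0 "R2 - d"] G12 by (intro c.gagliardo_cutoff_finite) auto
  then obtain E where "gagliardo s p c.f = ennreal E" "0 \<le> E"
    by (cases "gagliardo s p c.f") auto
  then have "excess u m x0 0 (R2 - d - d) \<le> ennreal ((KS * E) powr (m / p))"
    using d by (intro Sobolev_excess) auto
  then show ?thesis by (auto intro: le_less_trans)
qed

lemma excess_step: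
  assumes l: "0 \<le> l" and k: "1 \<le> k" and \<theta>: "0 < \<theta>" "\<theta> \<le> 1"
    and r: "R1 \<le> r'" "r' < r" "r \<le> R2" and A: "excess u m x0 l r \<le> ennreal A" "0 \<le> A"
  defines "d \<equiv> (r - r') / 2"
  shows "excess u m x0 (l + \<theta> * k) r'
    \<le> ennreal ((KS * (C7 * d powr (- (real DIM('a) + q)) * \<theta> powr (- m) * A)) powr (m / p))"
proof -
  define l' where "l' = l + \<theta> * k"
  have d: "0 < d" "d < r" "r - d - d = r'" "d \<le> 1" using r R by (auto simp: d_def field_simps)
  have l': "l \<le> l'" "0 \<le> l'" using l \<theta> k by (auto simp: l'_def)
  interpret c: cutoff s t p q \<Lambda> \<Omega> Ksp Ktq a u x0 r d l' "cut x0 (r - d) d"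
    using l' d r by (intro cutoff_locale) auto
  have pos: "0 < p" "0 < q" "1 \<le> q" using p pq by auto
  \<comment> \<open>On the set where \<open>w\<close> is positive, \<open>u - l\<close> exceeds
    \<open>\<theta> * k\<close>, which is at least \<theta> because \<open>k \<ge> 1\<close>. The
    quotient by \<theta> is thus at least 1, and every power \<open>e \<le> m\<close> may be raised
    to \<open>m\<close>.\<close>
  have wpt: "c.w x powr e \<le> \<theta> powr (- m) * max (u x - l) 0 powr m" if e: "0 \<le> e" "e \<le> m" for e x
  proof (cases "0 < c.w x")
    case False
    then have "c.w x = 0" using c.w_nonneg[of x] by linarith
    then show ?thesis by simp
  next
    case True
    let ?W = "max (u x - l) 0"
    have "l' < u x" using True by (simp add: c.w_def)
    then have "\<theta> * k \<le> ?W" by (simp add: l'_def)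
    moreover have "\<theta> * 1 \<le> \<theta> * k" using \<theta> k by (intro mult_left_mono) auto
    ultimately have "\<theta> \<le> ?W" by linarith
    then have W: "1 \<le> ?W / \<theta>" using \<theta> by (simp only: pos_le_divide_eq mult_1_left)
    have "c.w x \<le> ?W" using l' by (auto simp: c.w_def)
    also have "?W * 1 \<le> ?W / \<theta>"
      using \<theta> mult_left_mono[of 1 "1 / \<theta>" ?W] by (simp add: field_simps)
    finally have "c.w x powr e \<le> (?W / \<theta>) powr e" using e by (intro powr_mono2) auto
    also have "\<dots> \<le> (?W / \<theta>) powr m" using W e by (intro powr_mono) auto
    also have "\<dots> = \<theta> powr (- m) * ?W powr m" unfolding powr_divide divide_powr by simp
    finally show ?thesis .
  qed
  define X where "X = \<theta> powr (- m) * A"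
  have X: "0 \<le> X" using A by (simp add: X_def)
  have wint: "(\<integral>\<^sup>+x. ennreal (c.w x powr e) * indicator (ball x0 r) x \<partial>lebesgue) \<le> ennreal X"
    if e: "0 \<le> e" "e \<le> m" for e
  proof -
    have "(\<integral>\<^sup>+x. ennreal (c.w x powr e) * indicator (ball x0 r) x \<partial>lebesgue)
      \<le> (\<integral>\<^sup>+x. ennreal (\<theta> powr (- m)) * (ennreal (max (u x - l) 0 powr m) * indicator (ball x0 r) x) \<partial>lebesgue)"
      using wpt[OF e] by (intro nn_integral_mono)
        (auto split: split_indicator simp: ennreal_leI simp flip: ennreal_mult')
    also have "\<dots> = ennreal (\<theta> powr (- m)) * excess u m x0 l r"
      unfolding excess_def by (rule nn_integral_cmult) measurable
    also have "\<dots> \<le> ennreal (\<theta> powr (- m)) * ennreal A" using A by (intro mult_left_mono) auto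
    finally show ?thesis by (simp add: X_def ennreal_mult')
  qed
  have w1: "c.wint1 \<le> ennreal X"
    using wint[of 1] p m c.w_nonneg by (simp add: c.wint1_def powr_one)
  have wp: "c.wint p \<le> ennreal X" "c.wint q \<le> ennreal X"
    unfolding c.wint_def using p pq m by (intro wint; simp)+
  define Gp where "Gp = G1 * d powr (- (s * p))"
  define Gq where "Gq = G2 * d powr (- (t * q))"
  define Z where "Z = (r / d) powr (real DIM('a) + q) * T"
  have nn: "0 \<le> Gp" "0 \<le> Gq" "0 \<le> Z" using G12 T by (auto simp: Gp_def Gq_def Z_def)
  have tails: "far_tail s t p q a c.w x0 r x \<le> ennreal T" if "x \<in> ball x0 r" for x
  proof (rule order_trans[OF far_tail_mono])
    show "far_tail s t p q a (\<lambda>y. max (u y) 0) x0 R1 x \<le> ennreal T" using that r by (intro tail) auto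
  qed (use l' r p pq in \<open>auto simp: c.w_def\<close>)
  define E where "E = C7 * d powr (- (real DIM('a) + q)) * X"
  have "gagliardo s p c.f \<le> gagliardo s p c.f + ennreal 0 * gagliardo t q c.f" by simp
  also have "\<dots> \<le> ennreal (2 powr q * \<Lambda>\<^sup>2 * q powr q * 4) *
       (ennreal Gp * c.wint p + ennreal (a2 * Gq) * c.wint q + ennreal Z * c.wint1)"
    unfolding Z_def
  proof (rule c.Caccioppoli)
    show "local_gag s p (cut x0 (r - d) d) x \<le> ennreal Gp" for x
      unfolding Gp_def by (rule cut_local_gag[OF G1 d(1)])
    show "local_gag t q (cut x0 (r - d) d) x \<le> ennreal Gq" for x
      unfolding Gq_def by (rule cut_local_gag[OF G2 d(1)])
    show "a (x, y) \<le> a2" if "x \<in> ball x0 r" "y \<in> ball x0 r" for x y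
      using that r by (intro a_upper) auto
  qed (use nn T tails in auto)
  also have "\<dots> \<le> ennreal (2 powr q * \<Lambda>\<^sup>2 * q powr q * 4) *
       (ennreal Gp * ennreal X + ennreal (a2 * Gq) * ennreal X + ennreal Z * ennreal X)"
    using wp w1 by (intro mult_left_mono add_mono) auto
  also have "\<dots> = ennreal (2 powr q * \<Lambda>\<^sup>2 * q powr q * 4 * (Gp * X + a2 * Gq * X + Z * X))"
  proof -
    have e: "ennreal Gp * ennreal X = ennreal (Gp * X)" "ennreal (a2 * Gq) * ennreal X = ennreal (a2 * Gq * X)"
      "ennreal Z * ennreal X = ennreal (Z * X)"
      using X by (simp_all add: ennreal_mult'')
    show ?thesis unfolding e using nn X a2 by (intro ennreal_mult_sum3) auto
  qed
  also have "\<dots> \<le> ennreal E"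
  proof (rule ennreal_leI)
    let ?x = "d powr (- (real DIM('a) + q))"
    note ord = exponent_bounds
    have et: "d powr (- c) \<le> ?x" if "c \<le> q" for c
      using that d by (intro powr_mono') auto
    have 1: "Gp \<le> G1 * ?x" unfolding Gp_def using et[OF ord(1)] G12 by (intro mult_left_mono) auto
    have 2: "a2 * Gq \<le> a2 * G2 * ?x"
      unfolding Gq_def mult.assoc using et[OF ord(2)] G12 a2 by (intro mult_left_mono) auto
    have 3: "Z \<le> R2 powr (real DIM('a) + q) * T * ?x"
    proof -
      have "(r / d) powr (real DIM('a) + q) = r powr (real DIM('a) + q) * ?x"
        unfolding powr_divide divide_powr ..
      also have "\<dots> \<le> R2 powr (real DIM('a) + q) * ?x"
        using r R pos by (intro mult_right_mono powr_mono2) auto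
      finally have "(r / d) powr (real DIM('a) + q) * T \<le> R2 powr (real DIM('a) + q) * ?x * T"
        using T by (intro mult_right_mono)
      then show ?thesis by (simp add: Z_def mult_ac)
    qed
    have "Gp * X + a2 * Gq * X + Z * X = (Gp + a2 * Gq + Z) * X" by (simp add: distrib_right)
    also have "\<dots> \<le> ((G1 + a2 * G2 + R2 powr (real DIM('a) + q) * T) * ?x) * X"
      using 1 2 3 X by (intro mult_right_mono) (auto simp: distrib_right)
    finally have "2 powr q * \<Lambda>\<^sup>2 * q powr q * 4 * (Gp * X + a2 * Gq * X + Z * X)
      \<le> 2 powr q * \<Lambda>\<^sup>2 * q powr q * 4 * (((G1 + a2 * G2 + R2 powr (real DIM('a) + q) * T) * ?x) * X)"
      by (intro mult_left_mono) auto
    also have "\<dots> = E" by (simp add: E_def C7_def)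
    finally show "2 powr q * \<Lambda>\<^sup>2 * q powr q * 4 * (Gp * X + a2 * Gq * X + Z * X) \<le> E" .
  qed
  finally have "gagliardo s p c.f \<le> ennreal E" .
  then have "excess u m x0 l' (r - d - d) \<le> ennreal ((KS * E) powr (m / p))"
    using l' d r C7 X by (intro Sobolev_excess) (auto simp: E_def)
  then show ?thesis unfolding d(3) l'_def E_def X_def by (simp only: mult.assoc)
qed

text \<open>Provides the smallness that starts the iteration: no quantitative bound is at hand, but
  a sufficiently high initial level works.\<close>

lemma excess_vanishes:
  assumes fin: "excess u m x0 0 r < \<infinity>"
  shows "(\<lambda>j. excess u m x0 (real j) r) \<longlonglongrightarrow> 0"
proof -
  have m0: "0 < m" using p m by simp
  have "(\<lambda>j. excess u m x0 (real j) r) \<longlonglongrightarrow> (\<integral>\<^sup>+x. 0 \<partial>(lebesgue :: 'a measure))"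
    unfolding excess_def
  proof (rule nn_integral_dominated_convergence[where
        w = "\<lambda>x. ennreal (max (u x) 0 powr m) * indicator (ball x0 r) x"])
    show "AE x in lebesgue. ennreal (max (u x - real j) 0 powr m) * indicator (ball x0 r) x
        \<le> ennreal (max (u x) 0 powr m) * indicator (ball x0 r) x" for j
      using m0 by (intro AE_I2 mult_right_mono ennreal_leI powr_mono2) auto
    show "(\<integral>\<^sup>+x. ennreal (max (u x) 0 powr m) * indicator (ball x0 r) x \<partial>lebesgue) < \<infinity>"
      using fin by (simp add: excess_def)
    show "AE x in lebesgue. (\<lambda>j. ennreal (max (u x - real j) 0 powr m) * indicator (ball x0 r) x) \<longlonglongrightarrow> 0"
    proof (rule AE_I2)
      fix x
      obtain J :: nat where J: "u x \<le> real J" using real_arch_simple by blast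
      have "ennreal (max (u x - real j) 0 powr m) * indicator (ball x0 r) x = 0" if "J \<le> j" for j
      proof -
        have "real J \<le> real j" using that by simp
        then have "max (u x - real j) 0 = 0" using J by simp
        then show ?thesis by simp
      qed
      then show "(\<lambda>j. ennreal (max (u x - real j) 0 powr m) * indicator (ball x0 r) x) \<longlonglongrightarrow> 0"
        by (intro tendsto_eventually eventually_sequentiallyI[of J])
    qed
  qed measurable
  then show ?thesis by simp
qed

lemma bounded_above:
  obtains c where "AE x in lebesgue. x \<in> ball x0 R1 \<longrightarrow> u x \<le> c"
proof -
  define e where "e = (R2 - R1) / 2"
  define d0 where "d0 = e / 2"
  define R' where "R' = R1 + e"
  define N where "N = real DIM('a) + q"
  have e: "0 < e" "R' < R2" "R2 - d0 - d0 = R'" "0 < d0" "d0 < R2"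
    using R by (auto simp: e_def d0_def R'_def field_simps)
  have m0: "0 < m" "0 < p" using p m by auto
  define \<kappa> where "\<kappa> = m / p - 1"
  have \<kappa>: "0 < \<kappa>" using m m0 by (simp add: \<kappa>_def)
  define b where "b = 2 powr ((N + m) * (m / p))"
  have b: "1 < b"
  proof -
    have "0 < (N + m) * (m / p)" using m0 p pq by (intro mult_pos_pos) (auto simp: N_def)
    then show ?thesis using powr_less_mono[of 0 "(N + m) * (m / p)" 2] by (simp add: b_def)
  qed
  \<comment> \<open>The summand 1 makes \<open>C\<close> positive; the first summand is only known
    to be nonnegative.\<close>
  define C where "C = (KS * (C7 * (e / 4) powr (- N) * 2 powr m)) powr (m / p) + 1"
  have C: "0 < C" by (simp add: C_def add_nonneg_pos)
  define y where "y = C powr (- 1 / \<kappa>) * b powr (- 1 / \<kappa>\<^sup>2)"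
  have y: "0 < y" using C b by (simp add: y_def)
  have fin: "excess u m x0 0 R' < \<infinity>" using excess_finite[OF e(4,5)] e by simp
  have "eventually (\<lambda>j. excess u m x0 (real j) R' < ennreal y) sequentially"
    using excess_vanishes[OF fin] y by (intro order_tendstoD(2)) auto
  then have "eventually (\<lambda>j. excess u m x0 (real j) R' < ennreal y \<and> 1 \<le> j) sequentially"
    by (intro eventually_conj eventually_ge_at_top)
  then obtain k0 :: nat where k0: "excess u m x0 (real k0) R' < ennreal y" "1 \<le> k0"
    by (auto dest: eventually_happens)
  define k where "k = real k0"
  have k: "1 \<le> k" "excess u m x0 k R' < ennreal y" using k0 by (auto simp: k_def)
  define r where "r j = R1 + e * (1/2) ^ j" for j :: nat
  define l where "l j = k + k * (1 - (1/2) ^ j)" for j :: nat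
  have h1: "0 < (1/2::real) ^ j" "(1/2::real) ^ j \<le> 1" for j by (auto intro: power_le_one)
  have r: "R1 \<le> r j" "r (Suc j) < r j" "r j \<le> R'" for j
  proof -
    have "e * (1/2) ^ j \<le> e * 1" using e h1 by (intro mult_left_mono) auto
    then show "r j \<le> R'" by (simp add: r_def R'_def)
    show "R1 \<le> r j" using e by (simp add: r_def)
    have "0 < e * (1/2) ^ j" using e by simp
    then show "r (Suc j) < r j" by (simp add: r_def)
  qed
  have l: "0 \<le> l j" "l (Suc j) = l j + (1/2) ^ Suc j * k" "l j \<le> 2 * k" "k \<le> l j" for j
    using k h1[of j] by (auto simp: l_def algebra_simps mult_left_le)
  define Y where "Y j = enn2real (excess u m x0 (l j) (r j))" for j
  have Y: "excess u m x0 (l j) (r j) = ennreal (Y j)" "0 \<le> Y j" for j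
  proof -
    have "excess u m x0 (l j) (r j) \<le> excess u m x0 0 R'"
      using m0 l r by (intro excess_antimono) auto
    then have "excess u m x0 (l j) (r j) < \<infinity>" using fin by (rule le_less_trans)
    then show "excess u m x0 (l j) (r j) = ennreal (Y j)" "0 \<le> Y j" by (simp_all add: Y_def)
  qed
  note pw = half_power_powr
  have stepY: "Y (Suc j) \<le> C * b ^ j * Y j powr (1 + \<kappa>)" for j
  proof -
    define \<theta> where "\<theta> = (1/2::real) ^ Suc j"
    have \<theta>: "0 < \<theta>" "\<theta> \<le> 1" unfolding \<theta>_def by (rule h1)+
    have d: "(r j - r (Suc j)) / 2 = e / 4 * (1/2) ^ j" by (simp add: r_def)
    have "excess u m x0 (l j + \<theta> * k) (r (Suc j))
      \<le> ennreal ((KS * (C7 * ((r j - r (Suc j)) / 2) powr (- (real DIM('a) + q)) * \<theta> powr (- m) * Y j)) powr (m / p))"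
      using l r[of j] r(1)[of "Suc j"] e \<theta> Y k by (intro excess_step) (auto intro: order_trans less_imp_le)
    then have "Y (Suc j) \<le> (KS * (C7 * (e / 4 * (1/2) ^ j) powr (- N) * \<theta> powr (- m) * Y j)) powr (m / p)"
      unfolding d l(2)[symmetric] \<theta>_def[symmetric] N_def
      using l(2)[of j] Y(1)[of "Suc j"] by (simp add: \<theta>_def)
    also have "\<theta> powr (- m) = (2 powr m) ^ j * 2 powr m"
      unfolding \<theta>_def using pw[of "Suc j" m] by simp
    also have "(e / 4 * (1/2) ^ j) powr (- N) = (e / 4) powr (- N) * (2 powr N) ^ j"
      unfolding powr_mult pw ..
    also have "KS * (C7 * ((e / 4) powr (- N) * (2 powr N) ^ j) * ((2 powr m) ^ j * 2 powr m) * Y j)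
      = KS * (C7 * (e / 4) powr (- N) * 2 powr m) * (2 powr (N + m)) ^ j * Y j"
      by (simp add: powr_add power_mult_distrib mult_ac)
    also have "\<dots> powr (m / p) = (KS * (C7 * (e / 4) powr (- N) * 2 powr m)) powr (m / p) * b ^ j * Y j powr (1 + \<kappa>)"
    proof -
      have "((2 powr (N + m)) ^ j) powr (m / p) = b ^ j"
        by (subst power_powr_swap) (simp_all add: b_def powr_powr)
      then show ?thesis by (simp add: powr_mult \<kappa>_def)
    qed
    also have "\<dots> \<le> C * b ^ j * Y j powr (1 + \<kappa>)"
      using b by (intro mult_right_mono) (auto simp: C_def)
    finally show ?thesis .
  qed
  have "Y \<longlonglongrightarrow> 0"
  proof (rule fast_geometric_convergence[OF Y(2) C b \<kappa> stepY])
    have "l 0 = k" "r 0 = R'" by (simp_all add: l_def r_def R'_def)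
    then have "ennreal (Y 0) < ennreal y" using Y(1)[of 0] k by simp
    then show "Y 0 \<le> C powr (- 1 / \<kappa>) * b powr (- 1 / \<kappa>\<^sup>2)"
      unfolding y_def[symmetric] using y Y(2)[of 0] by (simp add: ennreal_less_iff)
  qed
  then have "(\<lambda>j. ennreal (Y j)) \<longlonglongrightarrow> ennreal 0" by (rule tendsto_ennrealI)
  moreover have "excess u m x0 (2 * k) R1 \<le> ennreal (Y j)" for j
    unfolding Y(1)[symmetric] using m0 l r by (intro excess_antimono) auto
  ultimately have "excess u m x0 (2 * k) R1 \<le> ennreal 0" by (intro LIMSEQ_le_const) auto
  then have "excess u m x0 (2 * k) R1 = 0" by simp
  then have ae: "AE x in lebesgue. ennreal (max (u x - 2 * k) 0 powr m) * indicator (ball x0 R1) x = 0"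
    unfolding excess_def by (subst (asm) nn_integral_0_iff_AE) auto
  have "AE x in lebesgue. x \<in> ball x0 R1 \<longrightarrow> u x \<le> 2 * k"
    using ae
  proof eventually_elim
    case (elim x)
    show ?case
    proof
      assume "x \<in> ball x0 R1"
      then have "max (u x - 2 * k) 0 powr m = 0" using elim by (simp add: ennreal_eq_0_iff order_antisym)
      then show "u x \<le> 2 * k" by simp
    qed
  qed
  then show ?thesis by (rule that)
qed

end

text \<open>For a possibly nonmeasurable integrand: each simple function below \<open>c * f\<close>
  is divided by \<open>c\<close>. It is applied to tails at every \<open>x\<close>, where the
  section of \<open>a\<close> need not be measurable.\<close>

lemma nn_integral_cmult_le:
  fixes f :: "'a \<Rightarrow> ennreal"
  assumes c: "0 < c" "c < \<infinity>"
  shows "(\<integral>\<^sup>+x. c * f x \<partial>M) \<le> c * (\<integral>\<^sup>+x. f x \<partial>M)"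
  unfolding nn_integral_def[of M "\<lambda>x. c * f x"]
proof (rule SUP_least, clarify)
  fix g assume g: "simple_function M g" and le: "g \<le> (\<lambda>x. c * f x)"
  have cc: "c * inverse c = 1" using c by (cases c) (auto simp: inverse_ennreal simp flip: ennreal_mult)
  have [measurable]: "g \<in> borel_measurable M" using g by (rule borel_measurable_simple_function)
  have "integral\<^sup>S M g = (\<integral>\<^sup>+x. g x \<partial>M)" using g by (simp add: nn_integral_eq_simple_integral)
  also have "\<dots> = (\<integral>\<^sup>+x. c * (inverse c * g x) \<partial>M)"
    by (simp add: mult.assoc[symmetric] cc)
  also have "\<dots> = c * (\<integral>\<^sup>+x. inverse c * g x \<partial>M)"
    by (rule nn_integral_cmult) measurable
  also have "\<dots> \<le> c * (\<integral>\<^sup>+x. f x \<partial>M)"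
  proof (intro mult_left_mono nn_integral_mono)
    fix x
    have "inverse c * g x \<le> inverse c * (c * f x)"
      using le by (intro mult_left_mono) (auto simp: le_fun_def)
    then show "inverse c * g x \<le> f x" by (simp add: mult.assoc[symmetric] mult.commute[of _ c] cc)
  qed simp
  finally show "integral\<^sup>S M g \<le> c * (\<integral>\<^sup>+x. f x \<partial>M)" .
qed

section \<open>From the hypotheses of the theorem to bounds on a ball\<close>

context double_phase
begin

lemma a_upper_on_ball:
  assumes "regularity_cond s t \<alpha> A a"
  obtains a2 where "\<And>x y. x \<in> ball x0 r \<Longrightarrow> y \<in> ball x0 r \<Longrightarrow> a (x, y) \<le> a2"
proof (cases "s \<le> t")
  case True
  have *: "a (x, y) \<le> a (x0, x0) + \<bar>A\<bar> * (2 * r) powr \<alpha>" if "x \<in> ball x0 r" "y \<in> ball x0 r" for x y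
  proof -
    have "\<bar>a (x, y) - a (x0, x0)\<bar> \<le> A * (dist x x0 + dist y x0) powr \<alpha>"
      using assms True by (auto simp: regularity_cond_def)
    also have "\<dots> \<le> \<bar>A\<bar> * (2 * r) powr \<alpha>"
      using that assms True by (intro mult_mono powr_mono2) (auto simp: regularity_cond_def dist_commute)
    finally show ?thesis by linarith
  qed
  show ?thesis by (rule that[OF *])
next
  case False
  then have "\<And>x y. a (x, y) \<le> A" using assms by (auto simp: regularity_cond_def abs_le_iff)
  then show ?thesis using that by blast
qed

text \<open>At distance at least \<open>R1\<close> from \<open>x0\<close> one has
  \<open>1 + norm y \<le> g * dist y x0\<close>, so the weights centred at \<open>x0\<close> are
  dominated by those of the tail spaces.\<close>

lemma tail_finite:
  assumes u: "u \<in> tail_space_p s p" "u \<in> tail_space_q t q a \<Omega>" and R1: "0 < R1"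
    and v: "\<And>y. 0 \<le> v y" "\<And>y. v y \<le> \<bar>u y\<bar>"
  obtains T where "0 \<le> T" "\<And>x. x \<in> \<Omega> \<Longrightarrow> far_tail s t p q a v x0 R1 x \<le> ennreal T"
proof -
  define g where "g = (1 + norm x0) / R1 + 1"
  have g: "0 < g" using R1 by (simp add: g_def add_nonneg_pos)
  have far: "1 / dist y x0 powr c \<le> g powr c * (1 / (1 + norm y) powr c)"
    if "y \<notin> ball x0 R1" "0 \<le> c" for y c
  proof -
    have d: "R1 \<le> dist y x0" using that by (auto simp: dist_commute)
    have "1 + norm y \<le> (1 + norm x0) + dist y x0"
      using norm_triangle_ineq[of "y - x0" x0] by (simp add: dist_norm)
    also have "(1 + norm x0) \<le> (1 + norm x0) / R1 * dist y x0"
      using d R1 mult_left_mono[OF d, of "1 + norm x0"] by (simp add: field_simps)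
    finally have "1 + norm y \<le> g * dist y x0" by (simp add: g_def distrib_right)
    then have "(1 + norm y) powr c \<le> (g * dist y x0) powr c" using that by (intro powr_mono2) auto
    moreover have "0 < 1 + norm y" "0 < dist y x0" using d R1 by (auto simp: add_pos_nonneg)
    ultimately show ?thesis by (simp add: powr_mult field_simps)
  qed
  have c0: "0 \<le> real DIM('a) + s * p" "0 \<le> real DIM('a) + t * q" using s t p pq by auto
  let ?P = "\<integral>\<^sup>+y. ennreal (\<bar>u y\<bar> powr (p - 1) / (1 + norm y) powr (real DIM('a) + s * p)) \<partial>lebesgue"
  let ?Q = "\<lambda>x. \<integral>\<^sup>+y. ennreal (a (x, y) * (\<bar>u y\<bar> powr (q - 1) / (1 + norm y) powr (real DIM('a) + t * q))) \<partial>lebesgue"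
  have P: "?P < \<infinity>" using u by (simp add: tail_space_p_def)
  have Q: "(SUP x\<in>\<Omega>. ?Q x) < \<infinity>" using u by (simp add: tail_space_q_def)
  let ?cp = "ennreal (g powr (real DIM('a) + s * p))"
  let ?cq = "ennreal (g powr (real DIM('a) + t * q))"
  define S where "S = ?cp * ?P + ?cq * (SUP x\<in>\<Omega>. ?Q x)"
  have S: "S < \<infinity>" unfolding S_def using P Q by (simp add: ennreal_mult_less_top)
  have P': "(\<integral>\<^sup>+y. ennreal (v y powr (p - 1) / dist y x0 powr (real DIM('a) + s * p))
          * indicator (- ball x0 R1) y \<partial>lebesgue) \<le> ?cp * ?P"
  proof (rule order_trans[OF nn_integral_mono nn_integral_cmult_le])
    fix y
    have "v y powr (p - 1) * (1 / dist y x0 powr (real DIM('a) + s * p))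
       \<le> \<bar>u y\<bar> powr (p - 1) * (g powr (real DIM('a) + s * p) * (1 / (1 + norm y) powr (real DIM('a) + s * p)))"
      if "y \<notin> ball x0 R1"
      using v p far[OF that c0(1)] by (intro mult_mono powr_mono2) auto
    then show "ennreal (v y powr (p - 1) / dist y x0 powr (real DIM('a) + s * p)) * indicator (- ball x0 R1) y
      \<le> ?cp * ennreal (\<bar>u y\<bar> powr (p - 1) / (1 + norm y) powr (real DIM('a) + s * p))"
      by (auto split: split_indicator simp: mult_ac intro!: ennreal_leI simp flip: ennreal_mult')
  qed (use g in auto)
  have Q': "(\<integral>\<^sup>+y. ennreal (a (x, y) * (v y powr (q - 1) / dist y x0 powr (real DIM('a) + t * q)))
          * indicator (- ball x0 R1) y \<partial>lebesgue) \<le> ?cq * ?Q x" for x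
  proof (rule order_trans[OF nn_integral_mono nn_integral_cmult_le])
    fix y
    have "a (x, y) * (v y powr (q - 1) * (1 / dist y x0 powr (real DIM('a) + t * q)))
       \<le> a (x, y) * (\<bar>u y\<bar> powr (q - 1) * (g powr (real DIM('a) + t * q) * (1 / (1 + norm y) powr (real DIM('a) + t * q))))"
      if "y \<notin> ball x0 R1"
      using v p pq far[OF that c0(2)] by (intro mult_left_mono mult_mono powr_mono2) auto
    then show "ennreal (a (x, y) * (v y powr (q - 1) / dist y x0 powr (real DIM('a) + t * q))) * indicator (- ball x0 R1) y
      \<le> ?cq * ennreal (a (x, y) * (\<bar>u y\<bar> powr (q - 1) / (1 + norm y) powr (real DIM('a) + t * q)))"
      by (auto split: split_indicator simp: mult_ac intro!: ennreal_leI simp flip: ennreal_mult')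
  qed (use g in auto)
  show ?thesis
  proof (rule that[of "enn2real S"])
    fix x assume x: "x \<in> \<Omega>"
    have "?cq * ?Q x \<le> ?cq * (SUP x\<in>\<Omega>. ?Q x)" using x by (intro mult_left_mono SUP_upper) auto
    then show "far_tail s t p q a v x0 R1 x \<le> ennreal (enn2real S)"
      using S add_mono[OF P' order_trans[OF Q'[of x]]] by (simp add: S_def far_tail_def)
  qed simp
qed

lemma minimizer_locally_bounded_above:
  assumes minimizer: "is_minimizer s t p q Ksp Ktq a \<Omega> u" and reg: "regularity_cond s t \<alpha> A a"
    and u: "u \<in> tail_space_p s p" "u \<in> tail_space_q t q a \<Omega>"
    and R: "0 < R" "closure (ball x0 R) \<subseteq> \<Omega>"
    and sub: "s * p \<le> real DIM('a)"
      "s * p < real DIM('a) \<Longrightarrow> q \<le> real DIM('a) * p / (real DIM('a) - s * p)"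
  obtains c where "AE x in lebesgue. x \<in> ball x0 R \<longrightarrow> u x \<le> c"
proof -
  have cb: "cball x0 R \<subseteq> \<Omega>" using R by (simp add: closure_ball)
  obtain e0 where e0: "0 < e0" "(\<Union>x\<in>cball x0 R. ball x e0) \<subseteq> \<Omega>"
    using compact_subset_open_imp_ball_epsilon_subset[OF compact_cball open_\<Omega> cb] by metis
  \<comment> \<open>Compactness of the closed ball leaves room for a ball of radius
    \<open>R + e\<close> inside \<Omega>; the cap at 1 meets \<open>R2 \<le> R1 + 1\<close>.\<close>
  define e where "e = min e0 1"
  have e: "0 < e" "e \<le> 1" "e \<le> e0" using e0 by (auto simp: e_def)
  have ballR2: "ball x0 (R + e) \<subseteq> \<Omega>"
  proof
    fix y assume y: "y \<in> ball x0 (R + e)"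
    show "y \<in> \<Omega>"
    proof (cases "y \<in> cball x0 R")
      case True then show ?thesis using cb by auto
    next
      case False
      define \<tau> where "\<tau> = R / dist x0 y"
      have d: "R < dist x0 y" "dist x0 y < R + e" using y False by auto
      have \<tau>: "0 < \<tau>" "\<tau> < 1" "\<tau> * dist x0 y = R" 
        using d R less_trans[OF R(1) d(1)] by (simp_all add: \<tau>_def divide_simps)
      \<comment> \<open>The point of the sphere of radius \<open>R\<close> on the segment from
        \<open>x0\<close> to \<open>y\<close>.\<close>
      define z where "z = x0 + \<tau> *\<^sub>R (y - x0)"
      have "dist x0 z = \<tau> * dist x0 y" using \<tau> by (simp add: z_def dist_norm norm_minus_commute)
      then have z: "z \<in> cball x0 R" using \<tau> by simp
      have "y - z = (1 - \<tau>) *\<^sub>R (y - x0)" by (simp add: z_def algebra_simps)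
      then have "dist z y = (1 - \<tau>) * dist x0 y"
        using \<tau> by (simp add: dist_norm norm_minus_commute[of _ y] norm_minus_commute[of z])
      then have "dist z y < e0" using \<tau> d e by (simp add: left_diff_distrib)
      then have "y \<in> (\<Union>x\<in>cball x0 R. ball x e0)" using z by (intro UN_I[of z]) simp_all
      then show ?thesis using e0 by blast
    qed
  qed
  obtain a2 where a2: "\<And>x y. x \<in> ball x0 (R + e) \<Longrightarrow> y \<in> ball x0 (R + e) \<Longrightarrow> a (x, y) \<le> a2"
    using a_upper_on_ball[OF reg] by metis
  obtain T where T: "0 \<le> T" "\<And>x. x \<in> \<Omega> \<Longrightarrow> far_tail s t p q a (\<lambda>y. max (u y) 0) x0 R x \<le> ennreal T"
    by (rule tail_finite[OF u R(1), where v = "\<lambda>y. max (u y) 0" and ?x0.0 = x0]) (auto simp: max_def)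
  obtain G1 where G1: "cutoff_const TYPE('a) s p G1" using cutoff_const_exists s p by (metis less_imp_le)
  obtain G2 where G2: "cutoff_const TYPE('a) t q G2"
    using cutoff_const_exists t p pq by (metis less_imp_le order_trans)
  define n where "n = real DIM('a)"
  have n: "0 < n" by (simp add: n_def)
  \<comment> \<open>Below the dimension this is the critical exponent, and the assumption on
    \<open>q\<close> says exactly \<open>q \<le> m\<close>. In the borderline case every finite
    exponent is admissible.\<close>
  define m where "m = (if s * p < n then n * p / (n - s * p) else q + 1)"
  have m: "p < m" "q \<le> m" "n / p - n / m \<le> s"
  proof -
    have p0: "0 < p" using p by simp
    show "q \<le> m" using sub by (auto simp: m_def n_def)
    show "p < m"
    proof (cases "s * p < n")
      case True
      have "p * (n - s * p) < p * n" using p0 s by (intro mult_strict_left_mono) auto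
      then show ?thesis using True by (simp add: m_def field_simps)
    qed (use pq in \<open>simp add: m_def\<close>)
    show "n / p - n / m \<le> s"
    proof (cases "s * p < n")
      case True
      then have "n / m = (n - s * p) / p" using n p0 by (simp add: m_def field_simps)
      then show ?thesis using p0 by (simp add: diff_divide_distrib)
    next
      case False
      then have "n / p = s" using sub p0 by (simp add: n_def field_simps)
      moreover have "0 \<le> n / m" using n p0 pq False by (simp add: m_def)
      ultimately show ?thesis by simp
    qed
  qed
  interpret lb: local_boundedness s t p q \<Lambda> \<Omega> Ksp Ktq a u x0 R "R + e" a2 T m G1 G2
  proof
    show "far_tail s t p q a (\<lambda>y. max (u y) 0) x0 R x \<le> ennreal T" if "x \<in> ball x0 (R + e)" for x
      using T(2)[of x] that ballR2 by auto
  qed (use minimizer ballR2 R e a2 T m G1 G2 in \<open>auto simp: n_def\<close>)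
  show ?thesis using lb.bounded_above that by blast
qed

text \<open>The energy is even in the function, so upper bounds for \<open>- u\<close> become lower
  bounds for \<open>u\<close>.\<close>

lemma minimizer_uminus:
  assumes "is_minimizer s t p q Ksp Ktq a \<Omega> u"
  shows "is_minimizer s t p q Ksp Ktq a \<Omega> (\<lambda>x. - u x)"
proof -
  have dens: "dens (\<lambda>x. - v x) = dens v" for v
    by (auto simp: dens_def fun_eq_iff abs_minus_commute)
  have energy: "energy p q Ksp Ktq a (\<lambda>x. - v x) \<Omega> = energy p q Ksp Ktq a v \<Omega>" for v
    by (simp add: energy_eq dens)
  have A: "(\<lambda>x. - v x) \<in> A_space s t p q a \<Omega>" if "v \<in> A_space s t p q a \<Omega>" for v
    using that unfolding A_space_energy energy by auto
  show ?thesis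
    unfolding is_minimizer_def
  proof (intro conjI ballI impI)
    show "(\<lambda>x. - u x) \<in> A_space s t p q a \<Omega>" using assms A by (auto simp: is_minimizer_def)
    fix v assume v: "v \<in> A_space s t p q a \<Omega>" and ae: "AE x in lebesgue. x \<notin> \<Omega> \<longrightarrow> v x = - u x"
    have "AE x in lebesgue. x \<notin> \<Omega> \<longrightarrow> - v x = u x" using ae by eventually_elim auto
    then have "energy p q Ksp Ktq a u \<Omega> \<le> energy p q Ksp Ktq a (\<lambda>x. - v x) \<Omega>"
      using assms A[OF v] by (simp add: is_minimizer_def)
    then show "energy p q Ksp Ktq a (\<lambda>x. - u x) \<Omega> \<le> energy p q Ksp Ktq a v \<Omega>"
      by (simp add: energy)
  qed
qed

text \<open>\<open>enn2real\<close> maps infinity to 0, so the norm has to be finite before its real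
  value can be used as a bound for \<open>u\<close>.\<close>

lemma minimizer_Linf_finite:
  assumes minimizer: "is_minimizer s t p q Ksp Ktq a \<Omega> u" and reg: "regularity_cond s t \<alpha> A a"
    and u: "u \<in> tail_space_p s p" "u \<in> tail_space_q t q a \<Omega>"
    and R: "0 < R" "closure (ball x0 R) \<subseteq> \<Omega>"
    and sub: "s * p \<le> real DIM('a)"
      "s * p < real DIM('a) \<Longrightarrow> q \<le> real DIM('a) * p / (real DIM('a) - s * p)"
  shows "Linf_norm (ball x0 R) u < \<infinity>"
proof -
  obtain c1 where c1: "AE x in lebesgue. x \<in> ball x0 R \<longrightarrow> u x \<le> c1"
    by (rule minimizer_locally_bounded_above[OF assms])
  have u': "(\<lambda>x. - u x) \<in> tail_space_p s p" "(\<lambda>x. - u x) \<in> tail_space_q t q a \<Omega>"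
    using u by (auto simp: tail_space_p_def tail_space_q_def)
  obtain c2 where c2: "AE x in lebesgue. x \<in> ball x0 R \<longrightarrow> - u x \<le> c2"
    by (rule minimizer_locally_bounded_above[OF minimizer_uminus[OF minimizer] reg u' R sub])
  have [measurable]: "u \<in> borel_measurable lebesgue" using u by (simp add: tail_space_p_def)
  have ae: "AE x in lebesgue. x \<in> ball x0 R \<longrightarrow> ennreal \<bar>u x\<bar> \<le> ennreal (max c1 c2)"
    using c1 c2 by eventually_elim (auto intro!: ennreal_leI simp: abs_if)
  have "Linf_norm (ball x0 R) u \<le> ennreal (max c1 c2)"
    unfolding Linf_norm_def
  proof (rule esssup_I)
    show "(\<lambda>x. ennreal \<bar>u x\<bar>) \<in> borel_measurable (lebesgue_on (ball x0 R))"
      by (intro measurable_restrict_space1) measurable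
    show "AE x in lebesgue_on (ball x0 R). ennreal \<bar>u x\<bar> \<le> ennreal (max c1 c2)"
      using ae by (subst AE_restrict_space_iff) auto
  qed
  then show ?thesis by (rule le_less_trans) simp
qed

end

section \<open>The sup estimate\<close>

lemma power_mean_ball_cases:
  fixes x0 :: "'a::euclidean_space"
  assumes "0 < R" "0 < l"
  obtains "power_mean l (ball x0 R) f = \<infinity>"
  | P where "0 \<le> P" "power_mean l (ball x0 R) f = ennreal P"
      "(\<integral>\<^sup>+x. ennreal (f x powr l) * indicator (ball x0 R) x \<partial>lebesgue)
        = ennreal (unit_ball_vol (real DIM('a)) * R ^ DIM('a) * P powr l)"
proof -
  define v where "v = unit_ball_vol (real DIM('a)) * R ^ DIM('a)"
  have v: "0 < v" "emeasure lebesgue (ball x0 R) = ennreal v"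
    using assms by (auto simp: v_def emeasure_ball)
  let ?I = "\<integral>\<^sup>+x. ennreal (f x powr l) * indicator (ball x0 R) x \<partial>lebesgue"
  show ?thesis
  proof (cases ?I)
    case top
    then show ?thesis using v that(1) by (simp add: power_mean_def enn_powr_def ennreal_top_divide)
  next
    case (real i)
    have iv: "?I / emeasure lebesgue (ball x0 R) = ennreal (i / v)"
      using real v by (simp add: divide_ennreal)
    define P where "P = (i / v) powr (1 / l)"
    have "v * P powr l = i" using real v assms by (simp add: P_def powr_powr)
    then show ?thesis
      using that(2)[of P] real iv v by (simp add: power_mean_def enn_powr_def P_def v_def)
  qed
qed

text \<open>Splitting at height \<open>P\<close> gives
  \<open>f powr e \<le> P powr e + P powr (e - l) * f powr l\<close>. Both terms integrate to the
  same value, which produces the factor 2 and hence \<open>2 powr (1 / e)\<close>.\<close>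

lemma moment_le:
  fixes x0 :: "'a::euclidean_space"
  assumes f[measurable]: "f \<in> borel_measurable lebesgue" and f0: "\<And>x. 0 \<le> f x"
    and e: "0 < e" "e \<le> l" and P: "0 \<le> P" and R: "0 < R"
    and I: "(\<integral>\<^sup>+x. ennreal (f x powr l) * indicator (ball x0 R) x \<partial>lebesgue)
        = ennreal (unit_ball_vol (real DIM('a)) * R ^ DIM('a) * P powr l)"
  shows "(\<integral>\<^sup>+x. ennreal (f x powr e) * indicator (ball x0 R) x \<partial>lebesgue)
        \<le> ennreal (unit_ball_vol (real DIM('a)) * R ^ DIM('a) * (2 powr (1 / e) * P) powr e)"
proof -
  define v where "v = unit_ball_vol (real DIM('a)) * R ^ DIM('a)"
  have v: "0 < v" "emeasure lebesgue (ball x0 R) = ennreal v"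
    using R by (auto simp: v_def emeasure_ball)
  show ?thesis
  proof (cases "P = 0")
    case True
    then have "(\<integral>\<^sup>+x. ennreal (f x powr l) * indicator (ball x0 R) x \<partial>lebesgue) = 0" using I by simp
    then have "AE x in lebesgue. ennreal (f x powr l) * indicator (ball x0 R) x = 0"
      by (subst (asm) nn_integral_0_iff_AE) auto
    then have "AE x in lebesgue. ennreal (f x powr e) * indicator (ball x0 R) x = 0"
      by eventually_elim (auto simp: ennreal_eq_0_iff order_antisym split: split_indicator)
    then have "(\<integral>\<^sup>+x. ennreal (f x powr e) * indicator (ball x0 R) x \<partial>lebesgue) = 0"
      by (subst nn_integral_0_iff_AE) auto
    then show ?thesis by simp
  next
    case False
    then have P0: "0 < P" using P by simp
    have pt: "f x powr e \<le> P powr e + P powr (e - l) * f x powr l" for x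
    proof (cases "f x \<le> P")
      case True
      have "f x powr e \<le> P powr e" using True f0 e by (intro powr_mono2) auto
      moreover have "0 \<le> P powr (e - l) * f x powr l" by simp
      ultimately show ?thesis by linarith
    next
      case False
      then have "1 \<le> f x / P" using P0 by simp
      then have "(f x / P) powr e \<le> (f x / P) powr l" using e by (intro powr_mono) auto
      then have "P powr e * (f x / P) powr e \<le> P powr e * (f x / P) powr l" by (intro mult_left_mono) auto
      moreover have "P powr e * (f x / P) powr e = f x powr e"
        using P0 by (simp add: powr_divide)
      moreover have "P powr e * (f x / P) powr l = P powr (e - l) * f x powr l"
        using P0 by (simp add: powr_divide powr_diff)
      ultimately have "f x powr e \<le> P powr (e - l) * f x powr l" by simp
      then show ?thesis by (simp add: add_increasing)
    qed
    have "(\<integral>\<^sup>+x. ennreal (f x powr e) * indicator (ball x0 R) x \<partial>lebesgue)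
      \<le> (\<integral>\<^sup>+x. ennreal (P powr e) * indicator (ball x0 R) x
          + ennreal (P powr (e - l)) * (ennreal (f x powr l) * indicator (ball x0 R) x) \<partial>lebesgue)"
    proof (rule nn_integral_mono)
      fix x
      show "ennreal (f x powr e) * indicator (ball x0 R) x \<le> ennreal (P powr e) * indicator (ball x0 R) x
          + ennreal (P powr (e - l)) * (ennreal (f x powr l) * indicator (ball x0 R) x)"
        using ennreal_leI[OF pt[of x]] by (auto simp: ennreal_mult' split: split_indicator)
    qed
    also have "\<dots> = ennreal (P powr e) * ennreal v + ennreal (P powr (e - l)) * ennreal (v * P powr l)"
      using v I by (subst nn_integral_add) (auto simp: nn_integral_cmult nn_integral_cmult_indicator v_def)
    also have "\<dots> = ennreal (P powr e * v + P powr (e - l) * (v * P powr l))"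
      using v by (simp add: ennreal_mult'[symmetric])
    also have "P powr (e - l) * (v * P powr l) = P powr e * v"
      using P0 by (simp add: powr_diff)
    also have "P powr e * v + P powr e * v = v * (2 powr (1 / e) * P) powr e"
      using e by (simp add: powr_mult powr_powr)
    finally show ?thesis by (simp add: v_def)
  qed
qed

text \<open>Chebyshev at the height whose \<open>e\<close>-th power is \<open>2 * X powr e\<close>.
  If \<open>X = 0\<close> that height is 0 and the superlevel set is null.\<close>

lemma superlevel_half:
  fixes x0 :: "'a::euclidean_space"
  assumes u[measurable]: "u \<in> borel_measurable lebesgue" and e: "0 < e" and X: "0 \<le> X" and R: "0 < R"
    and I: "(\<integral>\<^sup>+x. ennreal (max (u x) 0 powr e) * indicator (ball x0 R) x \<partial>lebesgue)
        \<le> ennreal (unit_ball_vol (real DIM('a)) * R ^ DIM('a) * X powr e)"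
  shows "emeasure lebesgue {x \<in> ball x0 R. 2 powr (1 / e) * X < u x}
    \<le> ennreal (unit_ball_vol (real DIM('a)) * R ^ DIM('a) / 2)"
proof -
  define v where "v = unit_ball_vol (real DIM('a)) * R ^ DIM('a)"
  have v: "0 < v" using R by (auto simp: v_def)
  define k where "k = 2 powr (1 / e) * X"
  let ?S = "{x \<in> ball x0 R. k < u x}"
  have S: "?S \<in> sets lebesgue" using u by (rule superlevel_sets_lebesgue)
  show ?thesis
  proof (cases "X = 0")
    case True
    then have "(\<integral>\<^sup>+x. ennreal (max (u x) 0 powr e) * indicator (ball x0 R) x \<partial>lebesgue) = 0" using I by simp
    then have "AE x in lebesgue. ennreal (max (u x) 0 powr e) * indicator (ball x0 R) x = 0"
      by (subst (asm) nn_integral_0_iff_AE) auto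
    then have "AE x in lebesgue. x \<notin> ?S"
    proof eventually_elim
      case (elim x)
      show ?case
      proof
        assume x: "x \<in> ?S"
        then have "0 < max (u x) 0 powr e" using True by (simp add: k_def)
        then show False using elim x by (simp add: ennreal_eq_0_iff)
      qed
    qed
    then have "emeasure lebesgue ?S = 0"
      using S by (subst (asm) AE_iff_measurable[OF S]) auto
    then show ?thesis by (simp flip: k_def)
  next
    case False
    then have X0: "0 < X" using X by simp
    have k0: "0 \<le> k" using X by (simp add: k_def)
    have ke: "k powr e = 2 * X powr e" using e by (simp add: k_def powr_mult powr_powr)
    have "ennreal (2 * X powr e) * emeasure lebesgue ?S
      = (\<integral>\<^sup>+x. ennreal (k powr e) * indicator ?S x \<partial>lebesgue)"
      unfolding ke by (rule nn_integral_cmult_indicator[OF S, symmetric])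
    also have "\<dots> \<le> (\<integral>\<^sup>+x. ennreal (max (u x) 0 powr e) * indicator (ball x0 R) x \<partial>lebesgue)"
      using k0 e by (intro nn_integral_mono) (auto split: split_indicator intro!: ennreal_leI powr_mono2)
    also have "\<dots> \<le> ennreal (v * X powr e)" using I by (simp add: v_def)
    finally have *: "ennreal (2 * X powr e) * emeasure lebesgue ?S \<le> ennreal (v * X powr e)" .
    have "emeasure lebesgue ?S = ennreal (1 / (2 * X powr e)) * (ennreal (2 * X powr e) * emeasure lebesgue ?S)"
    proof -
      have "ennreal (1 / (2 * X powr e)) * ennreal (2 * X powr e) = 1"
        using X0 by (subst ennreal_mult'[symmetric]) auto
      then show ?thesis by (simp flip: mult.assoc)
    qed
    also have "\<dots> \<le> ennreal (1 / (2 * X powr e)) * ennreal (v * X powr e)"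
      using * by (intro mult_left_mono) auto
    also have "\<dots> = ennreal (v / 2)"
      using X0 by (subst ennreal_mult'[symmetric]) auto
    finally show ?thesis by (simp add: v_def flip: k_def)
  qed
qed

text \<open>At \<tau>1 the first summand alone equals \<open>T\<close>, so the intermediate value
  theorem puts \<open>T\<close> in the range of \<open>h_fun\<close>, and \<open>inv_into\<close>
  returns a genuine solution.\<close>

lemma h_inv_solves:
  fixes s t p q R T :: real
  assumes p: "1 < p" "p \<le> q" and R: "0 < R" and b: "0 \<le> a_minus a x0 R" and T: "0 \<le> T"
  defines "\<tau> \<equiv> inv_into {0..} (h_fun s t p q a x0 R) T"
  shows "0 \<le> \<tau>" "h_fun s t p q a x0 R \<tau> = T"
proof -
  let ?h = "h_fun s t p q a x0 R"
  have Rp: "0 < R powr c" for c using R by simp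
  define \<tau>1 where "\<tau>1 = (T * R powr (s * p)) powr (1 / (p - 1))"
  have "?h 0 \<le> T" using T p by (simp add: h_fun_def)
  moreover have "T \<le> ?h \<tau>1"
  proof -
    have "\<tau>1 powr (p - 1) = T * R powr (s * p)"
      using T p Rp[of "s * p"] by (simp add: \<tau>1_def powr_powr)
    then have "\<tau>1 powr (p - 1) / R powr (s * p) = T" using R by simp
    moreover have "0 \<le> a_minus a x0 R * (\<tau>1 powr (q - 1) / R powr (t * q))" using b by simp
    ultimately show ?thesis unfolding h_fun_def by linarith
  qed
  moreover have "0 \<le> \<tau>1" by (simp add: \<tau>1_def)
  moreover have "continuous_on {0..\<tau>1} ?h"
  proof -
    have pc: "continuous_on {0..\<tau>1} (\<lambda>\<tau>. \<tau> powr m)" if "0 < m" for m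
      using that by (intro continuous_on_powr' continuous_on_id continuous_on_const) auto
    show ?thesis
      unfolding h_fun_def using R p
      by (intro continuous_on_add continuous_on_mult_left continuous_on_divide continuous_on_const pc) auto
  qed
  ultimately have "\<exists>x\<ge>0. x \<le> \<tau>1 \<and> ?h x = T" by (intro IVT') auto
  then have "T \<in> ?h ` {0..}" by auto
  then show "0 \<le> \<tau>" "?h \<tau> = T"
    unfolding \<tau>_def using f_inv_into_f[of T ?h "{0..}"] inv_into_into[of T ?h "{0..}"] by auto
qed

context double_phase
begin

lemma a_minus_bounds:
  assumes R: "0 < R"
  shows "0 \<le> a_minus a x0 R"
    and "x \<in> ball x0 R \<Longrightarrow> y \<in> ball x0 R \<Longrightarrow> a_minus a x0 R \<le> a (x, y)"
    and "(\<And>x' y'. x' \<in> ball x0 R \<Longrightarrow> y' \<in> ball x0 R \<Longrightarrow> a (x, y) \<le> a (x', y') + c) \<Longrightarrow>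
      a (x, y) \<le> a_minus a x0 R + c"
proof -
  have ne: "ball x0 R \<times> ball x0 R \<noteq> {}" using R by auto
  show "0 \<le> a_minus a x0 R"
    unfolding a_minus_def using ne by (intro cINF_greatest) auto
  show "x \<in> ball x0 R \<Longrightarrow> y \<in> ball x0 R \<Longrightarrow> a_minus a x0 R \<le> a (x, y)"
    unfolding a_minus_def by (intro cINF_lower bdd_belowI2[where m = 0]) auto
  assume *: "\<And>x' y'. x' \<in> ball x0 R \<Longrightarrow> y' \<in> ball x0 R \<Longrightarrow> a (x, y) \<le> a (x', y') + c"
  have "a (x, y) - c \<le> a_minus a x0 R"
    unfolding a_minus_def using ne
  proof (rule cINF_greatest)
    fix z assume "z \<in> ball x0 R \<times> ball x0 R"
    then show "a (x, y) - c \<le> a z" using *[of "fst z" "snd z"] by (cases z) auto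
  qed
  then show "a (x, y) \<le> a_minus a x0 R + c" by simp
qed

text \<open>This is where the bounds relating \<open>t q\<close> and \<open>s p\<close> enter.\<close>

lemma coefficient_oscillation:
  assumes reg: "regularity_cond s t \<alpha> A a" and R: "0 < R" "R \<le> 1"
    and tq: "s \<le> t \<Longrightarrow> t * q \<le> s * p + \<alpha>" "s > t \<Longrightarrow> t * q \<le> s * p"
  obtains osc where "0 \<le> osc" "osc * R powr (- (t * q)) \<le> 4 * \<bar>A\<bar> * R powr (- (s * p))"
    "\<And>x y. x \<in> ball x0 R \<Longrightarrow> y \<in> ball x0 R \<Longrightarrow> a (x, y) \<le> a_minus a x0 R + osc"
proof (cases "s \<le> t")
  case True
  then have \<alpha>: "0 < \<alpha>" "\<alpha> \<le> 1" using reg by (auto simp: regularity_cond_def)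
  show ?thesis
  \<comment> \<open>Two points of the ball are less than \<open>2 * R\<close> apart, in each of the
    two variables, and \<open>4 powr \<alpha> \<le> 4\<close>.\<close>
  proof (rule that[of "4 * \<bar>A\<bar> * R powr \<alpha>"])
    have "R powr \<alpha> * R powr (- (t * q)) = R powr (\<alpha> - t * q)" by (simp flip: powr_add)
    also have "\<dots> \<le> R powr (- (s * p))" using tq(1)[OF True] R by (intro powr_mono') auto
    finally have "4 * \<bar>A\<bar> * (R powr \<alpha> * R powr (- (t * q))) \<le> 4 * \<bar>A\<bar> * R powr (- (s * p))"
      by (intro mult_left_mono) auto
    then show "4 * \<bar>A\<bar> * R powr \<alpha> * R powr (- (t * q)) \<le> 4 * \<bar>A\<bar> * R powr (- (s * p))"
      by (simp add: mult.assoc)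
    show "a (x, y) \<le> a_minus a x0 R + 4 * \<bar>A\<bar> * R powr \<alpha>" if xy: "x \<in> ball x0 R" "y \<in> ball x0 R" for x y
    proof (rule a_minus_bounds(3)[OF R(1)])
      fix x' y' assume xy': "x' \<in> ball x0 R" "y' \<in> ball x0 R"
      have "dist x x' \<le> dist x0 x + dist x0 x'" "dist y y' \<le> dist x0 y + dist x0 y'"
        by (metis dist_commute dist_triangle)+
      then have d: "dist x x' + dist y y' \<le> 4 * R" using xy xy' by simp
      have "\<bar>a (x, y) - a (x', y')\<bar> \<le> A * (dist x x' + dist y y') powr \<alpha>"
        using reg True by (auto simp: regularity_cond_def)
      also have "\<dots> \<le> \<bar>A\<bar> * (4 * R) powr \<alpha>"
        using d \<alpha> by (intro mult_mono powr_mono2) auto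
      also have "\<dots> = \<bar>A\<bar> * (4 powr \<alpha> * R powr \<alpha>)" by (simp add: powr_mult)
      also have "\<dots> \<le> \<bar>A\<bar> * (4 * R powr \<alpha>)"
        using \<alpha> powr_mono[of \<alpha> 1 4] by (intro mult_left_mono mult_right_mono) auto
      finally show "a (x, y) \<le> a (x', y') + 4 * \<bar>A\<bar> * R powr \<alpha>" by linarith
    qed
  qed simp
next
  case False
  show ?thesis
  proof (rule that[of "4 * \<bar>A\<bar>"])
    have "R powr (- (t * q)) \<le> R powr (- (s * p))" using tq(2) False R by (intro powr_mono') auto
    then show "4 * \<bar>A\<bar> * R powr (- (t * q)) \<le> 4 * \<bar>A\<bar> * R powr (- (s * p))" by (intro mult_left_mono) auto
    show "a (x, y) \<le> a_minus a x0 R + 4 * \<bar>A\<bar>" for x y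
    proof -
      have "\<bar>a (x, y)\<bar> \<le> A" using reg False by (auto simp: regularity_cond_def)
      then show ?thesis using a_minus_bounds(1)[OF R(1), of x0] by linarith
    qed
  qed simp
qed

text \<open>The added 1s keep the bound, and the argument of the oscillation estimate, positive when
  the norm or seminorm vanishes.\<close>

definition sup_level :: "real \<Rightarrow> real" where
  "sup_level M = (if s * p \<le> real DIM('a) then M + 1 else osc_const TYPE('a) s p * (M + 1) + 1)"

lemma excess_level_bound:
  assumes minimizer: "is_minimizer s t p q Ksp Ktq a \<Omega> u" and reg: "regularity_cond s t \<alpha> A a"
    and u: "u \<in> tail_space_p s p" "u \<in> tail_space_q t q a \<Omega>"
    and R: "0 < R" "R \<le> 1" "closure (ball x0 R) \<subseteq> \<Omega>"
    and sub: "s * p < real DIM('a) \<Longrightarrow> q \<le> real DIM('a) * p / (real DIM('a) - s * p)"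
    and half: "emeasure lebesgue {x \<in> ball x0 R. k0 < u x}
      \<le> ennreal (unit_ball_vol (real DIM('a)) * R ^ DIM('a) / 2)" and k0: "0 \<le> k0"
  shows "AE x in lebesgue. x \<in> ball x0 R \<longrightarrow> u x - k0 \<le> sup_level (enn2real (u_data s p (ball x0 R) u))"
proof (cases "s * p \<le> real DIM('a)")
  case True
  define M where "M = u_data s p (ball x0 R) u"
  have M: "M = Linf_norm (ball x0 R) u" using True by (simp add: M_def u_data_def)
  have fin: "M < \<infinity>" unfolding M
    by (rule minimizer_Linf_finite[OF minimizer reg u R(1,3) True sub])
  have "AE x in lebesgue_on (ball x0 R). ennreal \<bar>u x\<bar> \<le> M"
    unfolding M Linf_norm_def by (rule esssup_AE)
  then have "AE x in lebesgue. x \<in> ball x0 R \<longrightarrow> ennreal \<bar>u x\<bar> \<le> M"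
    by (subst (asm) AE_restrict_space_iff) auto
  then show ?thesis
    unfolding M_def[symmetric]
  proof eventually_elim
    case (elim x)
    show ?case
    proof
      assume "x \<in> ball x0 R"
      then have "ennreal \<bar>u x\<bar> \<le> ennreal (enn2real M)" using elim fin by simp
      then have "\<bar>u x\<bar> \<le> enn2real M" by simp
      then show "u x - k0 \<le> sup_level (enn2real M)" using k0 True by (simp add: sup_level_def)
    qed
  qed
next
  case False
  define J where "J = (\<integral>\<^sup>+z. ennreal (\<bar>u (fst z) - u (snd z)\<bar> powr p
        / dist (fst z) (snd z) powr (real DIM('a) + s * p)) * indicator (ball x0 R \<times> ball x0 R) z \<partial>lebesgue)"
  have uA: "u \<in> A_space s t p q a \<Omega>" using minimizer by (simp add: is_minimizer_def)
  have B: "ball x0 R \<subseteq> \<Omega>" using R closure_subset by blast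
  \<comment> \<open>The seminorm is finite because its density is one summand of the finite energy
    integral over \<open>C_dom \<Omega>\<close>.\<close>
  have "J \<le> (\<integral>\<^sup>+z. ennreal (gdens u z) * indicator (C_dom \<Omega>) z \<partial>lebesgue)"
    unfolding J_def
  proof (rule nn_integral_mono)
    fix z :: "'a \<times> 'a"
    have "\<bar>u (fst z) - u (snd z)\<bar> powr p / dist (fst z) (snd z) powr (real DIM('a) + s * p) \<le> gdens u z"
      unfolding divide_powr gdens_def kp_def[symmetric] by simp
    then show "ennreal (\<bar>u (fst z) - u (snd z)\<bar> powr p
        / dist (fst z) (snd z) powr (real DIM('a) + s * p)) * indicator (ball x0 R \<times> ball x0 R) z
      \<le> ennreal (gdens u z) * indicator (C_dom \<Omega>) z"
      using B by (auto split: split_indicator simp: C_dom_def intro!: ennreal_leI)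
  qed
  also have "\<dots> < \<infinity>" using uA A_space_eq by blast
  finally have fin: "J < \<infinity>" .
  define j where "j = enn2real J"
  have j: "J = ennreal j" "0 \<le> j" using fin by (auto simp: j_def)
  have "(\<integral>\<^sup>+(x, y)\<in>ball x0 R \<times> ball x0 R. ennreal
        (\<bar>u x - u y\<bar> powr p / dist x y powr (real DIM('a) + s * p)) \<partial>lebesgue) = J"
    unfolding J_def by (intro nn_integral_cong) auto
  then have ud: "u_data s p (ball x0 R) u = ennreal (j powr (1 / p))"
    using False j by (simp add: u_data_def Wsp_seminorm_def enn_powr_def)
  define m where "m = j powr (1 / p) + 1"
  have m: "0 < m" by (simp add: m_def add_nonneg_pos)
  have "J \<le> ennreal (m powr p)"
  proof -
    have "j = (j powr (1 / p)) powr p" using j p by (simp add: powr_powr)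
    also have "\<dots> \<le> m powr p" using p by (intro powr_mono2) (auto simp: m_def)
    finally show ?thesis unfolding j by (rule ennreal_leI)
  qed
  moreover have "u \<in> borel_measurable lebesgue" using u by (simp add: tail_space_p_def)
  moreover have "real DIM('a) < s * p" using False by simp
  ultimately have "AE x in lebesgue. x \<in> ball x0 R \<longrightarrow> u x - k0 \<le> osc_const TYPE('a) s p * m"
    unfolding J_def by (intro fractional_oscillation_bound[OF _ R(1,2) s(1) p _ m _ half])
  then show ?thesis
    by eventually_elim (use False in \<open>auto simp: sup_level_def ud m_def\<close>)
qed

end

text \<open>The quantifiers express the dependence of the constant: the numerical data and the value
  \<open>M\<close> of \<open>u_data\<close> are given first, then \<open>C\<close> is chosen, and
  only afterwards the domain, kernels, coefficient, minimizer and ball.\<close>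

lemma nonlocal_double_phase_sup_estimate:
  fixes s t p q \<Lambda> \<alpha> A l :: real and M :: ennreal
  assumes s: "0 < s" "s < 1" and t: "0 < t" "t < 1" and p: "1 < p" "p \<le> q" and \<Lambda>: "1 \<le> \<Lambda>"
    and sub: "s * p < real DIM('a::euclidean_space) \<Longrightarrow> q \<le> real DIM('a) * p / (real DIM('a) - s * p)"
    and tq: "s \<le> t \<Longrightarrow> t * q \<le> s * p + \<alpha>" "s > t \<Longrightarrow> t * q \<le> s * p"
    and l: "0 < l"
  shows "\<exists>C::real. 1 \<le> C \<and>
    (\<forall>(\<Omega> :: 'a set) Ksp Ktq a u x0 R.
       open \<Omega> \<and> bounded \<Omega> \<and>
       kernel_cond s p \<Lambda> Ksp \<and> kernel_cond t q \<Lambda> Ktq \<and>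
       coefficient_cond \<Omega> a \<and> regularity_cond s t \<alpha> A a \<and>
       0 < R \<and> R \<le> 1 \<and> closure (ball x0 R) \<subseteq> \<Omega> \<and>
       u \<in> A_space s t p q a \<Omega> \<inter> tail_space_p s p \<inter> tail_space_q t q a \<Omega> \<and>
       is_minimizer s t p q Ksp Ktq a \<Omega> u \<and>
       u_data s p (ball x0 R) u = M \<longrightarrow>
       ess_sup_on (ball x0 (R / 2)) u \<le>
         enn2ereal (ennreal C * power_mean l (ball x0 R) (\<lambda>x. max (u x) 0)
           + ennreal C * h_inv s t p q a x0 R
               (two_radius_tail s t p q a (R / 2) R (\<lambda>x. max (u x) 0) x0)))"
proof -
  obtain G1 where G1: "cutoff_const TYPE('a) s p G1" using cutoff_const_exists s p by (metis less_imp_le)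
  obtain G2 where G2: "cutoff_const TYPE('a) t q G2"
    using cutoff_const_exists t p by (metis less_imp_le order_trans)
  \<comment> \<open>The interpolation needs an exponent at most \<open>p\<close>; for larger
    \<open>l\<close> the moment of order \<open>e\<close> is controlled by that of order
    \<open>l\<close>.\<close>
  define e where "e = min l p"
  have e: "0 < e" "e \<le> l" "e \<le> p" using l p by (auto simp: e_def)
  define K1 where "K1 = 4 * \<bar>A\<bar>"
  define M1 where "M1 = (if s * p \<le> real DIM('a) then enn2real M + 1
     else osc_const TYPE('a) s p * (enn2real M + 1) + 1)"
  have M1: "0 < M1"
    using osc_const_nonneg[where ?'a = 'a, of s p] by (auto simp: M1_def intro!: add_nonneg_pos mult_nonneg_nonneg)
  define \<kappa> where "\<kappa> = dg_exponent TYPE('a) s t p q"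
  define C4 where "C4 = dg_const TYPE('a) s t p q \<Lambda> K1 M1 G1 G2"
  define D where "D = sup_const TYPE('a) q \<kappa> C4 e"
  have D: "0 \<le> D" by (simp add: D_def sup_const_def Let_def)
  define c where "c = 2 powr (1 / e)"
  have c: "0 < c" by (simp add: c_def)
  \<comment> \<open>The factor \<open>c\<close> occurs twice: in \<open>X = c * P\<close> when
    passing from order \<open>l\<close> to \<open>e\<close>, and in \<open>k0 = c * X\<close> from
    Chebyshev. The final bound \<open>k0 + D * X + \<tau>\<close> is then
    \<open>(c + D) * c * P + \<tau>\<close>.\<close>
  define C where "C = 1 + (c + D) * c"
  have C: "1 \<le> C" using c D by (simp add: C_def)
  show ?thesis
  proof (intro exI[of _ C] conjI allI impI C)
    fix \<Omega> :: "'a set" and Ksp Ktq a u x0 R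
    assume *: "open \<Omega> \<and> bounded \<Omega> \<and>
       kernel_cond s p \<Lambda> Ksp \<and> kernel_cond t q \<Lambda> Ktq \<and>
       coefficient_cond \<Omega> a \<and> regularity_cond s t \<alpha> A a \<and>
       0 < R \<and> R \<le> 1 \<and> closure (ball x0 R) \<subseteq> \<Omega> \<and>
       u \<in> A_space s t p q a \<Omega> \<inter> tail_space_p s p \<inter> tail_space_q t q a \<Omega> \<and>
       is_minimizer s t p q Ksp Ktq a \<Omega> u \<and>
       u_data s p (ball x0 R) u = M"
    then have R: "0 < R" "R \<le> 1" "closure (ball x0 R) \<subseteq> \<Omega>" and reg: "regularity_cond s t \<alpha> A a"
      and u: "u \<in> tail_space_p s p" "u \<in> tail_space_q t q a \<Omega>"
      and minimizer: "is_minimizer s t p q Ksp Ktq a \<Omega> u" and M: "u_data s p (ball x0 R) u = M" by auto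
    have [measurable]: "u \<in> borel_measurable lebesgue" using u by (simp add: tail_space_p_def)
    interpret dp: double_phase s t p q \<Lambda> \<Omega> Ksp Ktq a
      using * s t p \<Lambda> by unfold_locales auto
    let ?f = "\<lambda>x. max (u x) 0"
    let ?P = "power_mean l (ball x0 R) ?f"
    let ?T = "two_radius_tail s t p q a (R / 2) R ?f x0"
    let ?h = "h_inv s t p q a x0 R ?T"
    show "ess_sup_on (ball x0 (R / 2)) u \<le> enn2ereal (ennreal C * ?P + ennreal C * ?h)"
    proof (cases "?P = \<infinity> \<or> ?T = \<infinity>")
      case True
      then have inf: "ennreal C * ?P + ennreal C * ?h = \<infinity>"
        using C by (auto simp: h_inv_def ennreal_mult_top)
      show ?thesis unfolding inf by simp
    next
      case False
      then have "?P \<noteq> \<infinity>" by simp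
      then obtain P where P: "0 \<le> P" "?P = ennreal P"
        "(\<integral>\<^sup>+x. ennreal (?f x powr l) * indicator (ball x0 R) x \<partial>lebesgue)
          = ennreal (unit_ball_vol (real DIM('a)) * R ^ DIM('a) * P powr l)"
        by - (rule power_mean_ball_cases[OF R(1) l, of x0 ?f], blast, blast)
      define T where "T = enn2real ?T"
      have T: "?T = ennreal T" "0 \<le> T" using False by (auto simp: T_def less_top)
      define X where "X = c * P"
      have X0: "0 \<le> X" using c P by (simp add: X_def)
      have X: "(\<integral>\<^sup>+x. ennreal (?f x powr e) * indicator (ball x0 R) x \<partial>lebesgue)
          \<le> ennreal (unit_ball_vol (real DIM('a)) * R ^ DIM('a) * X powr e)"
        unfolding X_def c_def by (rule moment_le[OF _ _ e(1,2) P(1) R(1) P(3)]) auto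
      define k0 where "k0 = c * X"
      have k0: "0 \<le> k0" using c X0 by (simp add: k0_def)
      have half: "emeasure lebesgue {x \<in> ball x0 R. k0 < u x}
          \<le> ennreal (unit_ball_vol (real DIM('a)) * R ^ DIM('a) / 2)"
        unfolding k0_def c_def by (rule superlevel_half[OF _ e(1) X0 R(1) X]) measurable
      have bounded: "AE x in lebesgue. x \<in> ball x0 R \<longrightarrow> u x - k0 \<le> M1"
        using dp.excess_level_bound[OF minimizer reg u R sub half k0]
        by (simp add: M dp.sup_level_def M1_def)
      obtain osc where osc: "0 \<le> osc" "osc * R powr (- (t * q)) \<le> K1 * R powr (- (s * p))"
        "\<And>x y. x \<in> ball x0 R \<Longrightarrow> y \<in> ball x0 R \<Longrightarrow> a (x, y) \<le> a_minus a x0 R + osc"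
        by (rule dp.coefficient_oscillation[OF reg R(1,2) tq, where ?x0.0 = x0])
          (assumption, assumption, rule that, auto simp: K1_def)
      interpret dg: De_Giorgi s t p q \<Lambda> \<Omega> Ksp Ktq a u x0 R "a_minus a x0 R" osc K1 k0 M1 T G1 G2
        \<kappa> "energy_const p q \<Lambda> K1 M1 G1 G2" C4
      proof
        show "ball x0 R \<subseteq> \<Omega>" using R closure_subset by blast
        fix x assume x: "x \<in> ball x0 R"
        let ?Q = "\<lambda>x. \<integral>\<^sup>+y. ennreal (a (x, y) * (?f y powr (q - 1) / dist y x0 powr (real DIM('a) + t * q)))
          * indicator (UNIV - ball x0 (R / 2)) y \<partial>lebesgue"
        \<comment> \<open>The supremum over the larger ball in \<open>two_radius_tail\<close> is
          what bounds the tail at every single \<open>x\<close>, without exceptional points.\<close>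
        have "?Q x \<le> (SUP x\<in>ball x0 R. ?Q x)" using x by (rule SUP_upper)
        then show "far_tail s t p q a ?f x0 (R / 2) x \<le> ennreal T"
          unfolding T(1)[symmetric] two_radius_tail_def far_tail_def Compl_eq_Diff_UNIV
          by (simp add: abs_of_nonneg add_left_mono)
      qed (use minimizer R dp.a_minus_bounds[OF R(1)] osc k0 M1 bounded T G1 G2 \<kappa>_def C4_def in auto)
      define \<tau> where "\<tau> = inv_into {0..} (h_fun s t p q a x0 R) T"
      have \<tau>: "0 \<le> \<tau>" "h_fun s t p q a x0 R \<tau> = T"
        unfolding \<tau>_def using h_inv_solves[OF p R(1) dp.a_minus_bounds(1)[OF R(1)] T(2)] by auto
      have h: "?h = ennreal \<tau>" using T by (simp add: h_inv_def \<tau>_def)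
      have "T \<le> dg.h \<tau>" using \<tau> by (simp add: dg.h_def h_fun_def)
      then have bound: "AE x in lebesgue. x \<in> ball x0 (R / 2) \<longrightarrow> u x - k0 \<le> \<tau> + D * X"
        unfolding D_def by (rule dg.local_bound[OF e(1,3) X0 X \<tau>(1)])
      have le: "k0 + (\<tau> + D * X) \<le> C * P + C * \<tau>"
      proof -
        have "k0 + D * X = (c + D) * c * P" by (simp add: k0_def X_def algebra_simps)
        also have "\<dots> \<le> C * P" using P by (intro mult_right_mono) (simp_all add: C_def)
        finally have "k0 + D * X \<le> C * P" .
        moreover have "1 * \<tau> \<le> C * \<tau>" using C \<tau> by (intro mult_right_mono)
        ultimately show ?thesis by simp
      qed
      have ae: "AE x in lebesgue. x \<in> ball x0 (R / 2) \<longrightarrow> ereal (u x) \<le> ereal (C * P + C * \<tau>)"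
        using bound by eventually_elim (use le in auto)
      have "ess_sup_on (ball x0 (R / 2)) u \<le> ereal (C * P + C * \<tau>)"
        unfolding ess_sup_on_def
      proof (rule esssup_I)
        show "(\<lambda>x. ereal (u x)) \<in> borel_measurable (lebesgue_on (ball x0 (R / 2)))"
          by (intro measurable_restrict_space1) measurable
        show "AE x in lebesgue_on (ball x0 (R / 2)). ereal (u x) \<le> ereal (C * P + C * \<tau>)"
          using ae by (subst AE_restrict_space_iff) auto
      qed
      also have "ereal (C * P + C * \<tau>) = enn2ereal (ennreal C * ?P + ennreal C * ?h)"
      proof -
        have "ennreal C * ?P + ennreal C * ?h = ennreal (C * P + C * \<tau>)"
          unfolding P(2) h using C P(1) \<tau>(1) by (simp add: ennreal_mult' mult_nonneg_nonneg)
        moreover have "0 \<le> C * P + C * \<tau>" using C P(1) \<tau>(1) by simp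
        ultimately show ?thesis by (simp only: enn2ereal_ennreal)
      qed
      finally show ?thesis .
    qed
  qed
qed

theorem theorem1p1:
  fixes s t p q \<Lambda> \<alpha> A l :: real and M :: ennreal
  assumes "2 \<le> CARD('n::finite)"
    and "0 < s" "s < 1" "0 < t" "t < 1" "1 < p" "p \<le> q"
    and "1 \<le> \<Lambda>"
    and "s * p < real CARD('n) \<Longrightarrow> q \<le> real CARD('n) * p / (real CARD('n) - s * p)"
    and "s \<le> t \<Longrightarrow> t * q \<le> s * p + \<alpha>"
    and "s > t \<Longrightarrow> t * q \<le> s * p"
    and "0 < l"
  shows "\<exists>C::real. 1 \<le> C \<and>
    (\<forall>(\<Omega> :: (real ^ 'n) set) Ksp Ktq a u x0 R.
       open \<Omega> \<and> bounded \<Omega> \<and>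
       kernel_cond s p \<Lambda> Ksp \<and> kernel_cond t q \<Lambda> Ktq \<and>
       coefficient_cond \<Omega> a \<and> regularity_cond s t \<alpha> A a \<and>
       0 < R \<and> R \<le> 1 \<and> closure (ball x0 R) \<subseteq> \<Omega> \<and>
       u \<in> A_space s t p q a \<Omega> \<inter> tail_space_p s p \<inter> tail_space_q t q a \<Omega> \<and>
       is_minimizer s t p q Ksp Ktq a \<Omega> u \<and>
       u_data s p (ball x0 R) u = M \<longrightarrow>
       ess_sup_on (ball x0 (R / 2)) u \<le>
         enn2ereal (ennreal C * power_mean l (ball x0 R) (\<lambda>x. max (u x) 0)
           + ennreal C * h_inv s t p q a x0 R
               (two_radius_tail s t p q a (R / 2) R (\<lambda>x. max (u x) 0) x0)))"
  using assms by (intro nonlocal_double_phase_sup_estimate) auto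

end
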